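(* Let $$\begin{array}{ccc} A & \longrightarrow & B\\ \downarrow & & \downarrow\\ C & \longrightarrow & D\end{array}$$ be a (strictly) commutative square of spaces. The square is absolutely cartesian if and only if it is a map of two absolutely cartesian $1$-cubes; that is, if and only if at least one of the following holds: (i) both maps $A\to B$ and $C\to D$ are weak equivalences, or (ii) both maps $A\to C$ and $B\to D$ are weak equivalences (in either case the other two maps may also be equivalences).
   Context: "Spaces" means topological spaces, forming the category $\mathrm{Top}$, with weak homotopy equivalences as the equivalences. A homotopy functor is a (covariant) functor $F:\mathrm{Top}\to\mathrm{Top}$ that preserves weak equivalences. An $n$-cube of spaces is a functor $\mathcal{X}$ to $\mathrm{Top}$ from the poset $\mathcal{P}(\{0,1,\dots,n-1\})$ of all subsets of $\{0,\dots,n-1\}$, ordered by inclusion; a square is a $2$-cube. A map of two $(n-1)$-cubes $Y\to Z$ (a natural transformation) is regarded as an $n$-cube, and every $n$-cube can be written as such a map in $n$ ways, one for each coordinate direction. An $n$-cube $\mathcal{X}$ is cartesian (meaning homotopy cartesian) if the canonical map $\mathcal{X}(\emptyset)\to \operatorname{holim}_{S\neq\emptyset}\mathcal{X}(S)$ is a weak equivalence. It is absolutely cartesian if $F(\mathcal{X})=F\circ\mathcal{X}$ is cartesian for every homotopy functor $F$. In particular, a $1$-cube $X\to Y$ is absolutely cartesian exactly when it is a weak equivalence. *)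

theory Defs
  imports "HOL-Analysis.Analysis"
begin

section \<open>Weak homotopy equivalences\<close>

text \<open>Continuous maps between values of type \<open>'a topology\<close> are total functions that matter only
  on the topological carrier; all notions below are insensitive to the values elsewhere.\<close>

definition unit_cube :: "nat \<Rightarrow> (nat \<Rightarrow> real) set" where
  "unit_cube n = {t. \<forall>i. 0 \<le> t i \<and> t i \<le> 1 \<and> (n \<le> i \<longrightarrow> t i = 0)}"

definition cube_boundary :: "nat \<Rightarrow> (nat \<Rightarrow> real) set" where
  "cube_boundary n = {t \<in> unit_cube n. \<exists>i<n. t i = 0 \<or> t i = 1}"

definition spheroids :: "nat \<Rightarrow> 'a topology \<Rightarrow> 'a \<Rightarrow> ((nat \<Rightarrow> real) \<Rightarrow> 'a) set" where
  "spheroids n X x =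
     {\<gamma>. continuous_map (top_of_set (unit_cube n)) X \<gamma> \<and> \<gamma> ` cube_boundary n \<subseteq> {x}}"

definition spheroid_rel ::
  "nat \<Rightarrow> 'a topology \<Rightarrow> 'a \<Rightarrow> (((nat \<Rightarrow> real) \<Rightarrow> 'a) \<times> ((nat \<Rightarrow> real) \<Rightarrow> 'a)) set" where
  "spheroid_rel n X x =
     {(\<gamma>, \<delta>). homotopic_with (\<lambda>\<eta>. \<eta> ` cube_boundary n \<subseteq> {x}) (top_of_set (unit_cube n)) X \<gamma> \<delta>}"

definition homotopy_group :: "nat \<Rightarrow> 'a topology \<Rightarrow> 'a \<Rightarrow> ((nat \<Rightarrow> real) \<Rightarrow> 'a) set set" where
  "homotopy_group n X x = spheroids n X x // spheroid_rel n X x"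

definition homotopy_group_map ::
  "nat \<Rightarrow> 'b topology \<Rightarrow> ('a \<Rightarrow> 'b) \<Rightarrow> 'a \<Rightarrow> ((nat \<Rightarrow> real) \<Rightarrow> 'a) set \<Rightarrow> ((nat \<Rightarrow> real) \<Rightarrow> 'b) set" where
  "homotopy_group_map n Y f x c = spheroid_rel n Y (f x) `` ((\<lambda>\<gamma>. f \<circ> \<gamma>) ` c)"

definition path_components_map :: "'b topology \<Rightarrow> ('a \<Rightarrow> 'b) \<Rightarrow> 'a set \<Rightarrow> 'b set" where
  "path_components_map Y f c = (\<Union>x\<in>c. path_component_of_set Y (f x))"

text \<open>The map induced on the \<open>n\<close>-th homotopy groups, \<open>n \<ge> 1\<close>, is always a homomorphism
  (concatenation of spheroids commutes with composition), so it is an isomorphism of groups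
  iff it is bijective. For the empty space only the condition on path components has content.\<close>

definition weak_equivalence :: "'a topology \<Rightarrow> 'b topology \<Rightarrow> ('a \<Rightarrow> 'b) \<Rightarrow> bool" where
  "weak_equivalence X Y f \<longleftrightarrow>
     continuous_map X Y f \<and>
     bij_betw (path_components_map Y f) (path_components_of X) (path_components_of Y) \<and>
     (\<forall>n\<ge>1. \<forall>x\<in>topspace X.
        bij_betw (homotopy_group_map n Y f x) (homotopy_group n X x) (homotopy_group n Y (f x)))"


section \<open>The category of spaces and homotopy functors\<close>

text \<open>HOL has no type of all topological spaces. As usual in the presence of universes, Top is the
  category of spaces whose underlying set is small, where the points are taken from an arbitrary
  type \<open>'u\<close> and small means having strictly fewer elements than \<open>'u\<close>. The type is
  required to be uncountable, and small sets to be closed under power sets. This holds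
  for every uncountable Grothendieck universe; regularity of its cardinality is not needed.\<close>

definition small_set :: "'u set \<Rightarrow> bool" where
  "small_set S \<longleftrightarrow> S \<prec> (UNIV :: 'u set)"

definition universe :: "'u itself \<Rightarrow> bool" where
  "universe _ \<longleftrightarrow>
     uncountable (UNIV :: 'u set) \<and> (\<forall>S :: 'u set. small_set S \<longrightarrow> Pow S \<prec> (UNIV :: 'u set))"

definition small_space :: "'u topology \<Rightarrow> bool" where
  "small_space X \<longleftrightarrow> small_set (topspace X)"

text \<open>The action on maps takes source and target as arguments, since these are part of
  a morphism of Top but cannot be recovered from the underlying function.\<close>

record 'u top_functor =
  on_space :: "'u topology \<Rightarrow> 'u topology"
  on_map :: "'u topology \<Rightarrow> 'u topology \<Rightarrow> ('u \<Rightarrow> 'u) \<Rightarrow> 'u \<Rightarrow> 'u"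

definition is_functor :: "'u top_functor \<Rightarrow> bool" where
  "is_functor F \<longleftrightarrow>
     (\<forall>X. small_space X \<longrightarrow> small_space (on_space F X)) \<and>
     (\<forall>X Y f. small_space X \<and> small_space Y \<and> continuous_map X Y f \<longrightarrow>
        continuous_map (on_space F X) (on_space F Y) (on_map F X Y f)) \<and>
     (\<forall>X Y f g. small_space X \<and> small_space Y \<and> continuous_map X Y f \<and> continuous_map X Y g \<and>
        (\<forall>x\<in>topspace X. f x = g x) \<longrightarrow>
        (\<forall>x\<in>topspace (on_space F X). on_map F X Y f x = on_map F X Y g x)) \<and>
     (\<forall>X. small_space X \<longrightarrow> (\<forall>x\<in>topspace (on_space F X). on_map F X X id x = x)) \<and>
     (\<forall>X Y Z f g. small_space X \<and> small_space Y \<and> small_space Z \<and>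
        continuous_map X Y f \<and> continuous_map Y Z g \<longrightarrow>
        (\<forall>x\<in>topspace (on_space F X).
           on_map F X Z (g \<circ> f) x = on_map F Y Z g (on_map F X Y f x)))"

definition homotopy_functor :: "'u top_functor \<Rightarrow> bool" where
  "homotopy_functor F \<longleftrightarrow>
     is_functor F \<and>
     (\<forall>X Y f. small_space X \<and> small_space Y \<and> weak_equivalence X Y f \<longrightarrow>
        weak_equivalence (on_space F X) (on_space F Y) (on_map F X Y f))"


section \<open>Cubes of spaces\<close>

record 'a cube =
  vertex :: "nat set \<Rightarrow> 'a topology"
  edge :: "nat set \<Rightarrow> nat set \<Rightarrow> 'a \<Rightarrow> 'a"

definition is_cube :: "nat \<Rightarrow> 'a cube \<Rightarrow> bool" where
  "is_cube n \<X> \<longleftrightarrow>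
     (\<forall>S T. S \<subseteq> T \<and> T \<subseteq> {..<n} \<longrightarrow> continuous_map (vertex \<X> S) (vertex \<X> T) (edge \<X> S T)) \<and>
     (\<forall>S. S \<subseteq> {..<n} \<longrightarrow> (\<forall>x\<in>topspace (vertex \<X> S). edge \<X> S S x = x)) \<and>
     (\<forall>R S T. R \<subseteq> S \<and> S \<subseteq> T \<and> T \<subseteq> {..<n} \<longrightarrow>
        (\<forall>x\<in>topspace (vertex \<X> R). edge \<X> R T x = edge \<X> S T (edge \<X> R S x)))"

definition is_small_cube :: "nat \<Rightarrow> 'u cube \<Rightarrow> bool" where
  "is_small_cube n \<X> \<longleftrightarrow> is_cube n \<X> \<and> (\<forall>S. S \<subseteq> {..<n} \<longrightarrow> small_space (vertex \<X> S))"

definition map_cube :: "'u top_functor \<Rightarrow> 'u cube \<Rightarrow> 'u cube" where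
  "map_cube F \<X> =
     \<lparr>vertex = (\<lambda>S. on_space F (vertex \<X> S)),
      edge = (\<lambda>S T. on_map F (vertex \<X> S) (vertex \<X> T) (edge \<X> S T))\<rparr>"


subsection \<open>Homotopy limits over punctured cubes\<close>

definition simplex_on :: "nat set \<Rightarrow> (nat \<Rightarrow> real) set" where
  "simplex_on S = {t. (\<forall>i. 0 \<le> t i) \<and> (\<forall>i. i \<notin> S \<longrightarrow> t i = 0) \<and> sum t S = 1}"

definition compact_open :: "'a topology \<Rightarrow> 'b topology \<Rightarrow> ('a \<Rightarrow> 'b) topology" where
  "compact_open K X = topology_generated_by
     {{\<phi>. \<phi> \<in> extensional (topspace K) \<and> continuous_map K X \<phi> \<and> \<phi> ` C \<subseteq> U} |C U.
        compactin K C \<and> openin X U}"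

definition punctured :: "nat \<Rightarrow> nat set set" where
  "punctured n = {S. S \<subseteq> {..<n} \<and> S \<noteq> {}}"

text \<open>The Bousfield-Kan formula: the homotopy limit is the space of natural transformations
  from \<open>S \<mapsto> |N(P / S)|\<close> to the diagram, where \<open>P\<close> is the poset of nonempty
  subsets. Here \<open>|N(P / S)|\<close> is the barycentric subdivision of the simplex with vertex
  set \<open>S\<close>, and the transition maps are the inclusions of faces. For \<open>n = 2\<close> this is
  the space of points of \<open>B\<close> and \<open>C\<close> together with a path in \<open>D\<close> between their images.\<close>

definition punctured_holim :: "nat \<Rightarrow> 'a cube \<Rightarrow> (nat set \<Rightarrow> (nat \<Rightarrow> real) \<Rightarrow> 'a) topology" where
  "punctured_holim n \<X> =
     subtopology
       (product_topology (\<lambda>S. compact_open (top_of_set (simplex_on S)) (vertex \<X> S)) (punctured n))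
       {\<phi>. \<forall>S\<in>punctured n. \<forall>T\<in>punctured n. S \<subseteq> T \<longrightarrow>
             (\<forall>t\<in>simplex_on S. \<phi> T t = edge \<X> S T (\<phi> S t))}"

definition to_holim :: "nat \<Rightarrow> 'a cube \<Rightarrow> 'a \<Rightarrow> nat set \<Rightarrow> (nat \<Rightarrow> real) \<Rightarrow> 'a" where
  "to_holim n \<X> a = (\<lambda>S\<in>punctured n. \<lambda>t\<in>simplex_on S. edge \<X> {} S a)"

definition cartesian :: "nat \<Rightarrow> 'a cube \<Rightarrow> bool" where
  "cartesian n \<X> \<longleftrightarrow> weak_equivalence (vertex \<X> {}) (punctured_holim n \<X>) (to_holim n \<X>)"

definition absolutely_cartesian :: "nat \<Rightarrow> 'u cube \<Rightarrow> bool" where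
  "absolutely_cartesian n \<X> \<longleftrightarrow>
     is_small_cube n \<X> \<and> (\<forall>F. homotopy_functor F \<longrightarrow> cartesian n (map_cube F \<X>))"


subsection \<open>Maps and squares as cubes\<close>

definition arrow_cube :: "'a topology \<Rightarrow> 'a topology \<Rightarrow> ('a \<Rightarrow> 'a) \<Rightarrow> 'a cube" where
  "arrow_cube X Y f =
     \<lparr>vertex = (\<lambda>S. if 0 \<in> S then Y else X),
      edge = (\<lambda>S T. if 0 \<in> T \<and> 0 \<notin> S then f else id)\<rparr>"

text \<open>The square with \<open>f : A \<rightarrow> B\<close>, \<open>g : A \<rightarrow> C\<close>, \<open>h : B \<rightarrow> D\<close> and \<open>k : C \<rightarrow> D\<close>.\<close>

definition square_cube ::
  "'a topology \<Rightarrow> 'a topology \<Rightarrow> 'a topology \<Rightarrow> 'a topology \<Rightarrow>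
   ('a \<Rightarrow> 'a) \<Rightarrow> ('a \<Rightarrow> 'a) \<Rightarrow> ('a \<Rightarrow> 'a) \<Rightarrow> ('a \<Rightarrow> 'a) \<Rightarrow> 'a cube" where
  "square_cube A B C D f g h k =
     \<lparr>vertex = (\<lambda>S. if 0 \<in> S then (if 1 \<in> S then D else B) else (if 1 \<in> S then C else A)),
      edge = (\<lambda>S T.
        if S = {} \<and> T = {0} then f
        else if S = {} \<and> T = {1} then g
        else if S = {0} \<and> T = {0, 1} then h
        else if S = {1} \<and> T = {0, 1} then k
        else if S = {} \<and> T = {0, 1} then h \<circ> f
        else id)\<rparr>"

end

theory Submission
  imports Defs "HOL-Complex_Analysis.Winding_Numbers"
begin

text \<open>If \<open>k\<close> is a weak equivalence, the projection from the homotopy pullback to \<open>B\<close> lifts maps of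
  cubes relative to the boundary, so the square is cartesian iff \<open>f\<close> is a weak equivalence;
  likewise for \<open>h\<close> and \<open>g\<close>. This proves one direction, since homotopy functors preserve weak
  equivalences, and for the other one it remains to see that \<open>h\<close> or \<open>k\<close> is a weak equivalence.

  Otherwise there are functors \<open>\<Phi>\<^sub>1\<close> and \<open>\<Phi>\<^sub>2\<close> to sets that invert weak equivalences, namely free homotopy
  classes of maps from bouquets of spheres, such that \<open>\<Phi>\<^sub>1 h\<close> and \<open>\<Phi>\<^sub>2 k\<close> are not bijective. Let
  \<open>\<Phi> = \<Phi>\<^sub>1 \<times> \<Phi>\<^sub>2\<close> and apply the hypothesis to the homotopy functors sending \<open>X\<close> to the space of all maps
  from the power set of \<open>\<Phi> X\<close> to \<open>M\<close>, where \<open>M\<close> is \<open>{1, -1}\<close> or the circle. For \<open>M = {1, -1}\<close> the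
  resulting square of sets is a pullback, which forbids that \<open>\<Phi> h\<close> and \<open>\<Phi> k\<close> both fail to be injective
  and that an element of \<open>\<Phi> D\<close> is missed by one of them and hit twice by the other. For the circle, an element
  of \<open>\<Phi> D\<close> missed by both of them gives a loop that is not a product of loops coming from \<open>B\<close> and \<open>C\<close>.
  Together these exclude all the ways in which \<open>\<Phi>\<^sub>1 h\<close> and \<open>\<Phi>\<^sub>2 k\<close> can fail to be bijective.\<close>

section \<open>Cells and filling\<close>

text \<open>A failure of \<open>h\<close> and a failure of \<open>k\<close> may be visible only to
  different functors, which is why a product has to be formed. A witness of failure in one factor
  then needs a partner in the other, and such partners come from applying the same restrictions to
  each factor alone. The set-valued functor \<Phi> itself, read as a discrete space, is too weak a
  test: every cospan of sets has a pullback, so it restricts neither \<open>h\<close> nor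
  \<open>k\<close>. Taking preimages twice, which sends X to the functions on the power set of
  \<Phi> X, is covariant again but far from preserving pullbacks, and the contradictions come from
  there. Signs alone do not suffice either. If A, B, C are empty and D is a point, the square for
  {1, -1} is a pullback of injections. A missed element of \<Phi> D only shows up in the fundamental
  group of a power of M, hence the circle. All these functors must have values in small spaces over
  the one type of points; this is where the closure of the universe under power sets is
  used.\<close>

abbreviation cmap :: "'a::topological_space set \<Rightarrow> 'b topology \<Rightarrow> ('a \<Rightarrow> 'b) \<Rightarrow> bool" where
  "cmap K X f \<equiv> continuous_map (top_of_set K) X f"

lemma cmap_cong: "\<lbrakk>cmap K X f; \<And>x. x \<in> K \<Longrightarrow> f x = g x\<rbrakk> \<Longrightarrow> cmap K X g"
  by (erule continuous_map_eq) simp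

lemma cmap_compose:
  assumes "cmap K X f" "continuous_on L e" "e ` L \<subseteq> K"
  shows "cmap L X (\<lambda>x. f (e x))"
proof -
  have "continuous_map (top_of_set L) (top_of_set K) e"
    using assms by auto
  from continuous_map_compose[OF this assms(1)] show ?thesis by (simp add: o_def)
qed

lemma cmap_post:
  assumes "cmap K X f" "continuous_map X Y g"
  shows "cmap K Y (\<lambda>x. g (f x))"
  using continuous_map_compose[OF assms] by (simp add: o_def)

lemma cmap_subset: "\<lbrakk>cmap K X f; L \<subseteq> K\<rbrakk> \<Longrightarrow> cmap L X f"
  by (metis continuous_map_from_subtopology_mono)

lemma cmap_in: "\<lbrakk>cmap K X f; x \<in> K\<rbrakk> \<Longrightarrow> f x \<in> topspace X"
  by (auto simp: continuous_map_def)

lemma cmap_Un: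
  assumes S: "closed S" and T: "closed T" and f: "cmap S X f" "cmap T X f"
  shows "cmap (S \<union> T) X f"
proof (subst continuous_map_closedin, intro conjI ballI allI impI)
  show "f \<in> topspace (top_of_set (S \<union> T)) \<rightarrow> topspace X"
    using f by (auto simp: continuous_map_def)
  fix C assume C: "closedin X C"
  have "closedin (top_of_set S) {x \<in> S. f x \<in> C}" "closedin (top_of_set T) {x \<in> T. f x \<in> C}"
    using f C by (auto simp: continuous_map_closedin)
  then have "closed {x \<in> S. f x \<in> C}" "closed {x \<in> T. f x \<in> C}"
    using S T closedin_closed_trans by blast+
  then have "closed ({x \<in> S. f x \<in> C} \<union> {x \<in> T. f x \<in> C})" by auto
  moreover have "{x \<in> S. f x \<in> C} \<union> {x \<in> T. f x \<in> C} = {x \<in> S \<union> T. f x \<in> C}" by auto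
  ultimately have "closed {x \<in> S \<union> T. f x \<in> C}" by simp
  then show "closedin (top_of_set (S \<union> T)) {x \<in> topspace (top_of_set (S \<union> T)). f x \<in> C}"
    by (auto intro: closed_subset)
qed

lemma cmap_glue:
  assumes "closed S" "closed T" "cmap S X f" "cmap T X g" "\<And>x. x \<in> S \<Longrightarrow> x \<in> T \<Longrightarrow> f x = g x"
  obtains u where "cmap (S \<union> T) X u" "\<And>x. x \<in> S \<Longrightarrow> u x = f x" "\<And>x. x \<in> T \<Longrightarrow> u x = g x"
proof
  let ?u = "\<lambda>x. if x \<in> S then f x else g x"
  show "cmap (S \<union> T) X ?u"
    using assms by (intro cmap_Un cmap_cong[of S X f ?u] cmap_cong[of T X g ?u]) auto
  show "?u x = f x" if "x \<in> S" for x using that by simp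
  show "?u x = g x" if "x \<in> T" for x using that assms by simp
qed

text \<open>A pair homeomorphic to a ball and its boundary sphere, presented by the norm and the radial
  expansion \<open>\<sigma> M x = x / M\<close>. This is all that is needed to write down the radial projection of a
  cylinder from a point above its top face.\<close>

definition cell :: "'a::t2_space set \<Rightarrow> 'a set \<Rightarrow> bool" where
  "cell K dK \<longleftrightarrow> closed K \<and>
     (\<exists>m \<sigma>. continuous_on K m \<and> (\<forall>x\<in>K. 0 \<le> m x \<and> m x \<le> (1::real)) \<and> dK = {x \<in> K. m x = 1} \<and>
        continuous_on {(M, x). x \<in> K \<and> 1/2 \<le> M \<and> M \<le> 1 \<and> m x \<le> M} (\<lambda>(M, x). \<sigma> M x) \<and>
        (\<forall>x\<in>K. \<forall>M. 1/2 \<le> M \<and> M \<le> 1 \<and> m x \<le> M \<longrightarrow> \<sigma> M x \<in> K \<and> m (\<sigma> M x) = m x / M) \<and>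
        (\<forall>x\<in>K. \<sigma> 1 x = x))"

lemma cell_closed: "cell K dK \<Longrightarrow> closed K"
  by (simp add: cell_def)

lemma cell_closed_bdry: assumes "cell K dK" shows "closed dK"
proof -
  obtain m where m: "closed K" "continuous_on K m" "dK = {x \<in> K. m x = (1::real)}"
    using assms unfolding cell_def by blast
  have "{x \<in> K. m x = 1} = K \<inter> m -` {1}" by auto
  then show ?thesis using m by (simp add: continuous_closed_preimage)
qed

text \<open>Projection from the point at height 2 over the centre. The ray from there through (t, x)
  is stretched by 1 / M; it meets the bottom for M = 1 - t/2 and the side for M = m x, and the
  larger M belongs to the first hit. As t \<le> 1, this M is at least 1/2, which is the origin of
  the bound in \<open>cell\<close>.\<close>

lemma cell_retract:
  assumes "cell K dK"
  obtains r where "continuous_on ({0..1::real} \<times> K) r"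
    "r ` ({0..1} \<times> K) \<subseteq> {0} \<times> K \<union> {0..1} \<times> dK"
    "\<And>z. z \<in> {0} \<times> K \<union> {0..1} \<times> dK \<Longrightarrow> r z = z"
proof -
  obtain m \<sigma> where cm: "continuous_on K m" and m01: "\<And>x. x \<in> K \<Longrightarrow> 0 \<le> m x \<and> m x \<le> (1::real)"
    and dK: "dK = {x \<in> K. m x = 1}"
    and cs: "continuous_on {(M, x). x \<in> K \<and> 1/2 \<le> M \<and> M \<le> 1 \<and> m x \<le> M} (\<lambda>(M, x). \<sigma> M x)"
    and s: "\<And>x M. x \<in> K \<Longrightarrow> 1/2 \<le> M \<Longrightarrow> M \<le> 1 \<Longrightarrow> m x \<le> M \<Longrightarrow> \<sigma> M x \<in> K \<and> m (\<sigma> M x) = m x / M"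
    and s1: "\<And>x. x \<in> K \<Longrightarrow> \<sigma> 1 x = x"
    using assms unfolding cell_def by auto
  define M where "M = (\<lambda>(t::real, x). max (1 - t/2) (m x))"
  define r where "r = (\<lambda>z. (2 - (2 - fst z) / M z, (\<lambda>(M, x). \<sigma> M x) (M z, snd z)))"
  have M: "1/2 \<le> M z" "M z \<le> 1" "m (snd z) \<le> M z" "1 - fst z / 2 \<le> M z"
     "M z = 1 - fst z / 2 \<or> M z = m (snd z)" if "z \<in> {0..1} \<times> K" for z
    using that m01 by (auto simp: M_def max_def)
  have cM: "continuous_on ({0..1} \<times> K) M"
    unfolding M_def case_prod_unfold
    by (intro continuous_intros continuous_on_compose2[OF cm]) auto
  have "continuous_on ({0..1} \<times> K) r"
    unfolding r_def
  proof (intro continuous_on_Pair continuous_on_diff continuous_on_divide continuous_on_const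
      continuous_on_fst continuous_on_id cM continuous_on_compose2[OF cs] continuous_on_snd)
    show "\<forall>z\<in>{0..1} \<times> K. M z \<noteq> 0" using M by force
    show "(\<lambda>z. (M z, snd z)) ` ({0..1} \<times> K) \<subseteq> {(M, x). x \<in> K \<and> 1/2 \<le> M \<and> M \<le> 1 \<and> m x \<le> M}"
      using M by force
  qed
  moreover have "r z \<in> {0} \<times> K \<union> {0..1} \<times> dK" if z: "z \<in> {0..1} \<times> K" for z
  proof -
    note Mz = M[OF z]
    have K: "snd z \<in> K" and z01: "0 \<le> fst z" "fst z \<le> 1" using z by auto
    have s': "\<sigma> (M z) (snd z) \<in> K" "m (\<sigma> (M z) (snd z)) = m (snd z) / M z"
      using s[OF K Mz(1-3)] by auto
    have "(2 - fst z) / M z \<le> 2" "1 \<le> (2 - fst z) / M z"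
      using Mz z01 by (auto simp: field_simps)
    moreover from Mz(5) have "2 - (2 - fst z) / M z = 0 \<or> m (snd z) / M z = 1"
    proof
      assume a: "M z = 1 - fst z / 2"
      then have "(2 - fst z) / M z = 2"
        using Mz(1) by (auto simp: field_simps)
      then show ?thesis by simp
    next
      assume "M z = m (snd z)" then show ?thesis using Mz(1) by auto
    qed
    ultimately show ?thesis using s' by (auto simp: r_def dK)
  qed
  moreover have "r z = z" if "z \<in> {0} \<times> K \<union> {0..1} \<times> dK" for z
  proof -
    have "M z = 1" and "snd z \<in> K" using that m01[of "snd z"] by (auto simp: M_def dK max_def)
    then show ?thesis by (auto simp: r_def s1)
  qed
  ultimately show thesis using that by blast
qed

text \<open>Homotopy extension for the pair: the data on the bottom and the side form one map, which
  is pulled back along the retraction of the cylinder.\<close>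

lemma fill:
  assumes cell: "cell K dK" and Q: "cmap K X Q" and R: "cmap ({0..1::real} \<times> dK) X R"
    and QR: "\<And>x. x \<in> dK \<Longrightarrow> R (0, x) = Q x"
  obtains H where "cmap ({0..1} \<times> K) X H" "\<And>x. x \<in> K \<Longrightarrow> H (0, x) = Q x"
    "\<And>s x. s \<in> {0..1} \<Longrightarrow> x \<in> dK \<Longrightarrow> H (s, x) = R (s, x)"
proof -
  obtain r where r: "continuous_on ({0..1::real} \<times> K) r"
    "r ` ({0..1} \<times> K) \<subseteq> {0} \<times> K \<union> {0..1} \<times> dK"
    "\<And>z. z \<in> {0} \<times> K \<union> {0..1} \<times> dK \<Longrightarrow> r z = z"
    using cell_retract[OF cell] by blast
  have Q0: "cmap ({0} \<times> K) X (\<lambda>z. Q (snd z))"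
    by (rule cmap_compose[OF Q]) (auto intro: continuous_intros)
  obtain u where u: "cmap ({0} \<times> K \<union> {0..1} \<times> dK) X u"
     "\<And>z. z \<in> {0} \<times> K \<Longrightarrow> u z = Q (snd z)" "\<And>z. z \<in> {0..1} \<times> dK \<Longrightarrow> u z = R z"
    by (rule cmap_glue[OF _ _ Q0 R])
      (use cell_closed[OF cell] cell_closed_bdry[OF cell] QR in \<open>auto intro!: closed_Times\<close>)
  have "cmap ({0..1} \<times> K) X (\<lambda>z. u (r z))"
    using u(1) r(1,2) by (rule cmap_compose)
  moreover have "u (r (0, x)) = Q x" if "x \<in> K" for x
    using that r(3)[of "(0,x)"] u(2)[of "(0,x)"] by simp
  moreover have "u (r (s, x)) = R (s, x)" if "s \<in> {0..1}" "x \<in> dK" for s x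
    using that r(3)[of "(s,x)"] u(3)[of "(s,x)"] by simp
  ultimately show thesis using that by blast
qed

definition prism_bdry :: "'a set \<Rightarrow> 'a set \<Rightarrow> (real \<times> 'a) set" where
  "prism_bdry K dK = {0,1} \<times> K \<union> {0..1} \<times> dK"

text \<open>The interval is recentred at 1/2, so that its norm is the absolute value of 2t - 1. A
  product of balls is a ball for the maximum of the norms, and stretching acts in each
  factor.\<close>

lemma cell_prism:
  assumes "cell K dK" shows "cell ({0..1} \<times> K) (prism_bdry K dK)"
proof -
  obtain m \<sigma> where cm: "continuous_on K m" and m01: "\<And>x. x \<in> K \<Longrightarrow> 0 \<le> m x \<and> m x \<le> (1::real)"
    and dK: "dK = {x \<in> K. m x = 1}"
    and cs: "continuous_on {(M, x). x \<in> K \<and> 1/2 \<le> M \<and> M \<le> 1 \<and> m x \<le> M} (\<lambda>(M, x). \<sigma> M x)"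
    and s: "\<And>x M. x \<in> K \<Longrightarrow> 1/2 \<le> M \<Longrightarrow> M \<le> 1 \<Longrightarrow> m x \<le> M \<Longrightarrow> \<sigma> M x \<in> K \<and> m (\<sigma> M x) = m x / M"
    and s1: "\<And>x. x \<in> K \<Longrightarrow> \<sigma> 1 x = x"
    using assms unfolding cell_def by auto
  define m' where "m' = (\<lambda>z. max \<bar>2 * fst z - 1\<bar> (m (snd z)))"
  define \<sigma>' where "\<sigma>' = (\<lambda>M z. ((1 + (2 * fst z - 1) / M) / 2, (\<lambda>(M, x). \<sigma> M x) (M, snd z)))"
  let ?K = "{0..1::real} \<times> K"
  have "continuous_on ?K m'"
    unfolding m'_def by (intro continuous_intros continuous_on_compose2[OF cm]) auto
  moreover have "\<forall>z\<in>?K. 0 \<le> m' z \<and> m' z \<le> 1"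
    using m01 by (auto simp: m'_def)
  moreover have "prism_bdry K dK = {z \<in> ?K. m' z = 1}"
    using m01 by (fastforce simp: m'_def dK max_def prism_bdry_def split: if_splits)
  moreover have "continuous_on {(M, z). z \<in> ?K \<and> 1/2 \<le> M \<and> M \<le> 1 \<and> m' z \<le> M} (\<lambda>(M, z). \<sigma>' M z)"
    unfolding \<sigma>'_def case_prod_unfold
    by (intro continuous_intros continuous_on_compose2[OF cs[unfolded case_prod_unfold]]) (auto simp: m'_def)
  moreover have "\<forall>z\<in>?K. \<forall>M. 1/2 \<le> M \<and> M \<le> 1 \<and> m' z \<le> M \<longrightarrow> \<sigma>' M z \<in> ?K \<and> m' (\<sigma>' M z) = m' z / M"
  proof (intro ballI allI impI)
    fix z M assume z: "z \<in> ?K" and M: "1/2 \<le> M \<and> M \<le> (1::real) \<and> m' z \<le> M"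
    then have sz: "\<sigma> M (snd z) \<in> K" "m (\<sigma> M (snd z)) = m (snd z) / M"
      using s[of "snd z" M] by (auto simp: m'_def)
    define a where "a = (2 * fst z - 1) / M"
    have a: "\<bar>a\<bar> \<le> 1" "\<bar>a\<bar> = \<bar>2 * fst z - 1\<bar> / M" using M by (auto simp: a_def m'_def)
    have eq: "\<sigma>' M z = ((1 + a) / 2, \<sigma> M (snd z))" by (simp add: \<sigma>'_def a_def)
    have "m' (\<sigma>' M z) = max \<bar>a\<bar> (m (snd z) / M)"
      unfolding eq m'_def fst_conv snd_conv sz by (simp add: field_simps)
    also have "\<dots> = m' z / M"
      using M a(2) by (auto simp: m'_def max_def divide_le_cancel)
    finally show "\<sigma>' M z \<in> ?K \<and> m' (\<sigma>' M z) = m' z / M"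
      using sz a(1) by (auto simp: eq abs_le_iff)
  qed
  moreover have "\<forall>z\<in>?K. \<sigma>' 1 z = z" by (auto simp: \<sigma>'_def s1)
  ultimately show ?thesis
    using cell_closed[OF assms] unfolding cell_def by (auto simp: closed_Times intro!: exI[of _ m'] exI[of _ \<sigma>'])
qed

lemma cmap_prism_bdry:
  assumes K: "closed K" "closed dK"
    and 0: "cmap K X (\<lambda>x. f (0, x))" and 1: "cmap K X (\<lambda>x. f (1, x))" and d: "cmap ({0..1} \<times> dK) X f"
  shows "cmap (prism_bdry K dK) X f"
proof -
  have "cmap ({0} \<times> K) X (\<lambda>z. f (0, snd z))" "cmap ({1} \<times> K) X (\<lambda>z. f (1, snd z))"
    by (rule cmap_compose[OF 0] cmap_compose[OF 1]; auto intro: continuous_intros)+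
  then have "cmap ({0} \<times> K) X f" "cmap ({1} \<times> K) X f"
    by (auto elim!: cmap_cong)
  then have "cmap (({0} \<times> K \<union> {1} \<times> K) \<union> {0..1} \<times> dK) X f"
    using K d by (intro cmap_Un closed_Un closed_Times) auto
  moreover have "({0} \<times> K \<union> {1} \<times> K) \<union> {0..1} \<times> dK = prism_bdry K dK"
    by (auto simp: prism_bdry_def)
  ultimately show ?thesis by simp
qed

text \<open>This is \<open>fill\<close> over the prism with s as the direction of filling:
  \<open>Q\<close> is the bottom, while \<open>P0\<close>, \<open>P1\<close> and \<open>R\<close>
  cover the walls. The face s = 1 is left open, and most later homotopies are constructed by reading
  off that face.\<close>

lemma fill_square:
  assumes cell: "cell K dK"
    and P: "cmap ({0..1::real} \<times> K) X P0" "cmap ({0..1::real} \<times> K) X P1" and Q: "cmap ({0..1::real} \<times> K) X Q"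
    and R: "cmap ({0..1::real} \<times> {0..1::real} \<times> dK) X R"
    and PQ: "\<And>x. x \<in> K \<Longrightarrow> Q (0, x) = P0 (0, x)" "\<And>x. x \<in> K \<Longrightarrow> Q (1, x) = P1 (0, x)"
    and PR: "\<And>s x. s \<in> {0..1} \<Longrightarrow> x \<in> dK \<Longrightarrow> R (s, 0, x) = P0 (s, x)"
      "\<And>s x. s \<in> {0..1} \<Longrightarrow> x \<in> dK \<Longrightarrow> R (s, 1, x) = P1 (s, x)"
    and QR: "\<And>t x. t \<in> {0..1} \<Longrightarrow> x \<in> dK \<Longrightarrow> R (0, t, x) = Q (t, x)"
  obtains H where "cmap ({0..1} \<times> {0..1} \<times> K) X H"
    "\<And>s x. s \<in> {0..1} \<Longrightarrow> x \<in> K \<Longrightarrow> H (s, 0, x) = P0 (s, x)"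
    "\<And>s x. s \<in> {0..1} \<Longrightarrow> x \<in> K \<Longrightarrow> H (s, 1, x) = P1 (s, x)"
    "\<And>t x. t \<in> {0..1} \<Longrightarrow> x \<in> K \<Longrightarrow> H (0, t, x) = Q (t, x)"
    "\<And>s t x. s \<in> {0..1} \<Longrightarrow> t \<in> {0..1} \<Longrightarrow> x \<in> dK \<Longrightarrow> H (s, t, x) = R (s, t, x)"
proof -
  note cl = cell_closed[OF cell] cell_closed_bdry[OF cell]
  let ?I = "{0..1::real}"
  have P': "cmap (?I \<times> {0::real} \<times> K) X (\<lambda>(s, t, x). P0 (s, x))" "cmap (?I \<times> {1::real} \<times> K) X (\<lambda>(s, t, x). P1 (s, x))"
    unfolding case_prod_unfold
    by (rule cmap_compose[OF P(1)] cmap_compose[OF P(2)]; auto intro!: continuous_intros)+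
  have disj: "\<And>z. z \<in> ?I \<times> {0::real} \<times> K \<Longrightarrow> z \<in> ?I \<times> {1::real} \<times> K \<Longrightarrow>
      (\<lambda>(s, t, x). P0 (s, x)) z = (\<lambda>(s, t, x). P1 (s, x)) z" by auto
  obtain u where u: "cmap (?I \<times> {0::real} \<times> K \<union> ?I \<times> {1::real} \<times> K) X u"
    "\<And>z. z \<in> ?I \<times> {0::real} \<times> K \<Longrightarrow> u z = (\<lambda>(s, t, x). P0 (s, x)) z"
    "\<And>z. z \<in> ?I \<times> {1::real} \<times> K \<Longrightarrow> u z = (\<lambda>(s, t, x). P1 (s, x)) z"
    by (rule cmap_glue[OF _ _ P' disj]) (use cl in \<open>(intro closed_Times; simp) | blast\<close>)+
  obtain v where v: "cmap ((?I \<times> {0::real} \<times> K \<union> ?I \<times> {1::real} \<times> K) \<union> ?I \<times> ?I \<times> dK) X v"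
    "\<And>z. z \<in> ?I \<times> {0::real} \<times> K \<union> ?I \<times> {1::real} \<times> K \<Longrightarrow> v z = u z"
    "\<And>z. z \<in> ?I \<times> ?I \<times> dK \<Longrightarrow> v z = R z"
    by (rule cmap_glue[OF _ _ u(1) R]) (use cl u(2,3) PR in \<open>auto intro!: closed_Times\<close>)
  have eq: "(?I \<times> {0::real} \<times> K \<union> ?I \<times> {1::real} \<times> K) \<union> ?I \<times> ?I \<times> dK = ?I \<times> prism_bdry K dK"
    by (auto simp: prism_bdry_def)
  have v': "cmap (?I \<times> prism_bdry K dK) X v" using v(1) eq by simp
  have vQ: "v (0, x) = Q x" if "x \<in> prism_bdry K dK" for x
    using that u(2,3) v(2,3) PQ QR by (auto simp: prism_bdry_def)
  obtain H where H: "cmap (?I \<times> ?I \<times> K) X H" "\<And>x. x \<in> ?I \<times> K \<Longrightarrow> H (0, x) = Q x"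
    "\<And>s x. s \<in> ?I \<Longrightarrow> x \<in> prism_bdry K dK \<Longrightarrow> H (s, x) = v (s, x)"
    using fill[OF cell_prism[OF cell] Q v' vQ] by metis
  show thesis
  proof (rule that[OF H(1)])
    show "H (s, 0, x) = P0 (s, x)" if "s \<in> ?I" "x \<in> K" for s x
      using that H(3)[of s "(0,x)"] v(2) u(2) by (simp add: prism_bdry_def)
    show "H (s, 1, x) = P1 (s, x)" if "s \<in> ?I" "x \<in> K" for s x
      using that H(3)[of s "(1,x)"] v(2) u(3) by (simp add: prism_bdry_def)
    show "H (0, t, x) = Q (t, x)" if "t \<in> ?I" "x \<in> K" for t x
      using that H(2)[of "(t,x)"] by simp
    show "H (s, t, x) = R (s, t, x)" if "s \<in> ?I" "t \<in> ?I" "x \<in> dK" for s t x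
      using that H(3)[of s "(t,x)"] v(3)[of "(s,t,x)"] by (simp add: prism_bdry_def)
  qed
qed

lemma cell_homeomorphic:
  assumes cell: "cell K dK" and e: "continuous_on K e" "e ` K = L" and e': "continuous_on L e'"
    and inv: "\<And>x. x \<in> K \<Longrightarrow> e' (e x) = x" and "dL = e ` dK" "closed L"
  shows "cell L dL"
proof -
  obtain m \<sigma> where cm: "continuous_on K m" and m01: "\<And>x. x \<in> K \<Longrightarrow> 0 \<le> m x \<and> m x \<le> (1::real)"
    and dK: "dK = {x \<in> K. m x = 1}"
    and cs: "continuous_on {(M, x). x \<in> K \<and> 1/2 \<le> M \<and> M \<le> 1 \<and> m x \<le> M} (\<lambda>(M, x). \<sigma> M x)"
    and s: "\<And>x M. x \<in> K \<Longrightarrow> 1/2 \<le> M \<Longrightarrow> M \<le> 1 \<Longrightarrow> m x \<le> M \<Longrightarrow> \<sigma> M x \<in> K \<and> m (\<sigma> M x) = m x / M"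
    and s1: "\<And>x. x \<in> K \<Longrightarrow> \<sigma> 1 x = x"
    using cell unfolding cell_def by auto
  define m' where "m' = (\<lambda>y. m (e' y))"
  define \<sigma>' where "\<sigma>' = (\<lambda>M y. e ((\<lambda>(M, x). \<sigma> M x) (M, e' y)))"
  have e'L: "e' y \<in> K" "e (e' y) = y" if "y \<in> L" for y using that e(2) inv by auto
  have "continuous_on L m'"
    unfolding m'_def using e'L by (intro continuous_on_compose2[OF cm e']) auto
  moreover have "\<forall>y\<in>L. 0 \<le> m' y \<and> m' y \<le> 1" using e'L m01 by (auto simp: m'_def)
  moreover have "dL = {y \<in> L. m' y = 1}" using assms dK e'L by (force simp: m'_def)
  moreover have "continuous_on {(M, y). y \<in> L \<and> 1/2 \<le> M \<and> M \<le> 1 \<and> m' y \<le> M} (\<lambda>(M, y). \<sigma>' M y)"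
    unfolding \<sigma>'_def case_prod_unfold
    by (intro continuous_intros continuous_on_compose2[OF e(1)]
        continuous_on_compose2[OF cs[unfolded case_prod_unfold]] continuous_on_compose2[OF e'])
      (use e'L s in \<open>auto simp: m'_def\<close>)
  moreover have "\<forall>y\<in>L. \<forall>M. 1/2 \<le> M \<and> M \<le> 1 \<and> m' y \<le> M \<longrightarrow> \<sigma>' M y \<in> L \<and> m' (\<sigma>' M y) = m' y / M"
    using e'L s e(2) inv by (auto simp: m'_def \<sigma>'_def)
  moreover have "\<forall>y\<in>L. \<sigma>' 1 y = y" using e'L s1 by (auto simp: \<sigma>'_def)
  ultimately show ?thesis
    using \<open>closed L\<close> unfolding cell_def by (auto intro!: exI[of _ m'] exI[of _ \<sigma>'])
qed

section \<open>The cube as an iterated prism\<close>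

definition cube_join :: "nat \<Rightarrow> real \<times> (nat \<Rightarrow> real) \<Rightarrow> nat \<Rightarrow> real" where
  "cube_join n z = (snd z)(n := fst z)"

definition cube_split :: "nat \<Rightarrow> (nat \<Rightarrow> real) \<Rightarrow> real \<times> (nat \<Rightarrow> real)" where
  "cube_split n y = (y n, y(n := 0))"

lemma continuous_cube_join: "continuous_on S (cube_join n)"
proof (rule continuous_on_coordinatewise_then_product)
  fix i
  have "continuous_on S (\<lambda>z. snd z i)"
    by (rule continuous_on_product_then_coordinatewise[OF continuous_on_snd[OF continuous_on_id]])
  then show "continuous_on S (\<lambda>z. cube_join n z i)"
    by (cases "i = n") (simp_all add: cube_join_def continuous_on_fst)
qed

lemma continuous_cube_split: "continuous_on S (cube_split n)"
proof -
  have c: "continuous_on S (\<lambda>y. y i)" for i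
    by (rule continuous_on_product_then_coordinatewise[OF continuous_on_id])
  have "continuous_on S (\<lambda>y. y(n := 0))"
  proof (rule continuous_on_coordinatewise_then_product)
    show "continuous_on S (\<lambda>y. (y(n := 0)) i)" for i
      by (cases "i = n") (simp_all add: c)
  qed
  then have "continuous_on S (\<lambda>y. (y n, y(n := 0)))"
    by (intro continuous_on_Pair c)
  then show ?thesis by (simp add: cube_split_def[abs_def])
qed

lemma cube_split_join: "x \<in> unit_cube n \<Longrightarrow> cube_split n (cube_join n (t, x)) = (t, x)"
  by (auto simp: cube_split_def cube_join_def unit_cube_def fun_eq_iff)

lemma cube_join_split [simp]: "cube_join n (cube_split n y) = y"
  by (simp add: cube_split_def cube_join_def)

lemma cube_join_in: "t \<in> {0..1} \<Longrightarrow> x \<in> unit_cube n \<Longrightarrow> cube_join n (t, x) \<in> unit_cube (Suc n)"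
  by (auto simp: cube_join_def unit_cube_def)

lemma cube_split_in: "y \<in> unit_cube (Suc n) \<Longrightarrow> cube_split n y \<in> {0..1} \<times> unit_cube n"
  by (auto simp: cube_split_def unit_cube_def le_Suc_eq)

lemma cube_join_bdry_iff:
  assumes "t \<in> {0..1}" "x \<in> unit_cube n"
  shows "cube_join n (t, x) \<in> cube_boundary (Suc n) \<longleftrightarrow> (t, x) \<in> prism_bdry (unit_cube n) (cube_boundary n)"
  using assms cube_join_in[OF assms]
  by (auto simp: cube_join_def cube_boundary_def prism_bdry_def less_Suc_eq)

lemma unit_cube_image: "cube_join n ` ({0..1} \<times> unit_cube n) = unit_cube (Suc n)"
proof
  show "unit_cube (Suc n) \<subseteq> cube_join n ` ({0..1} \<times> unit_cube n)"
    using cube_split_in by (metis cube_join_split imageI subsetI)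
qed (auto simp: cube_join_in)

lemma cube_boundary_image:
  "cube_boundary (Suc n) = cube_join n ` prism_bdry (unit_cube n) (cube_boundary n)"
proof (intro equalityI subsetI)
  fix y assume y: "y \<in> cube_boundary (Suc n)"
  then have "cube_split n y \<in> {0..1} \<times> unit_cube n"
    by (auto simp: cube_boundary_def intro: cube_split_in)
  then show "y \<in> cube_join n ` prism_bdry (unit_cube n) (cube_boundary n)"
    using y cube_join_bdry_iff by (metis cube_join_split imageI mem_Sigma_iff prod.collapse)
next
  fix y assume "y \<in> cube_join n ` prism_bdry (unit_cube n) (cube_boundary n)"
  then obtain t x where "y = cube_join n (t, x)" "(t, x) \<in> prism_bdry (unit_cube n) (cube_boundary n)" by auto
  moreover from this have "t \<in> {0..1}" "x \<in> unit_cube n"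
    by (auto simp: prism_bdry_def cube_boundary_def)
  ultimately show "y \<in> cube_boundary (Suc n)" using cube_join_bdry_iff by auto
qed

lemma cube_boundary_0 [simp]: "cube_boundary 0 = {}"
  by (simp add: cube_boundary_def)

lemma unit_cube_0 [simp]: "unit_cube 0 = {\<lambda>_. 0}"
  by (auto simp: unit_cube_def)

lemma zero_in_unit_cube [simp]: "(\<lambda>_. 0) \<in> unit_cube n"
  by (auto simp: unit_cube_def)

lemma zero_in_cube_boundary: "n \<ge> 1 \<Longrightarrow> (\<lambda>_. 0) \<in> cube_boundary n"
  by (auto simp: cube_boundary_def intro!: exI[of _ 0])

lemma cube_boundary_subset: "cube_boundary n \<subseteq> unit_cube n"
  by (auto simp: cube_boundary_def)

lemma closed_unit_cube: "closed (unit_cube n)"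
proof -
  let ?S = "\<lambda>i. if i < n then {0..1::real} else {0}"
  have "closed ((\<lambda>t. t i) -` ?S i)" for i
    by (rule closed_vimage[OF _ continuous_on_product_then_coordinatewise[OF continuous_on_id]]) simp
  then have "closed (\<Inter>i. (\<lambda>t. t i) -` ?S i)" by blast
  moreover have "(\<Inter>i. (\<lambda>t. t i) -` ?S i) = unit_cube n"
  proof -
    have "t i \<in> ?S i \<longleftrightarrow> 0 \<le> t i \<and> t i \<le> 1 \<and> (n \<le> i \<longrightarrow> t i = 0)" for t i by auto
    then show ?thesis by (auto simp: unit_cube_def simp del: if_split)
  qed
  ultimately show ?thesis by simp
qed

text \<open>Induction over prisms. It starts at a point, whose boundary has to be empty, so the norm
  there is 0.\<close>

lemma cell_unit_cube: "cell (unit_cube n) (cube_boundary n)"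
proof (induction n)
  case 0
  have "closed {\<lambda>_::nat. 0::real}" by simp
  then show ?case
    by (auto simp: cell_def intro!: exI[of _ "\<lambda>_. 0"] exI[of _ "\<lambda>M x _. 0"] simp: case_prod_unfold)
next
  case (Suc n)
  show ?case
    by (rule cell_homeomorphic[OF cell_prism[OF Suc] continuous_cube_join unit_cube_image
          continuous_cube_split[of _ n] _ cube_boundary_image closed_unit_cube])
       (auto simp: cube_split_join)
qed

section \<open>Elementary properties of weak equivalences\<close>

lemma quotient_map_class:
  assumes "equiv A R" "equiv B S" and F: "\<And>a. a \<in> A \<Longrightarrow> F a \<in> B"
    and resp: "\<And>a a'. (a, a') \<in> R \<Longrightarrow> (F a, F a') \<in> S" and a: "a \<in> A"
  shows "S `` (F ` (R `` {a})) = S `` {F a}"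
proof -
  have "S `` {F a'} = S `` {F a}" if "(a, a') \<in> R" for a'
    using equiv_class_eq[OF assms(2) resp[OF that]] by simp
  then have "(\<Union>a'\<in>R``{a}. S `` {F a'}) = (\<Union>a'\<in>R``{a}. S `` {F a})"
    by (intro SUP_cong) auto
  also have "\<dots> = S `` {F a}" using equiv_class_self[OF assms(1) a] by auto
  finally show ?thesis unfolding Image_eq_UN[of S "F ` _"] by (simp add: image_image)
qed

text \<open>Reduces bijectivity between quotients to representatives. It serves path components,
  homotopy groups and bouquet classes alike, since all their induced maps send a class to the
  saturation of its image.\<close>

lemma bij_betw_quotient_map_iff:
  assumes R: "equiv A R" and S: "equiv B S" and F: "\<And>a. a \<in> A \<Longrightarrow> F a \<in> B"
    and resp: "\<And>a a'. (a, a') \<in> R \<Longrightarrow> (F a, F a') \<in> S"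
  shows "bij_betw (\<lambda>c. S `` (F ` c)) (A // R) (B // S) \<longleftrightarrow>
    (\<forall>a\<in>A. \<forall>a'\<in>A. (F a, F a') \<in> S \<longrightarrow> (a, a') \<in> R) \<and> (\<forall>b\<in>B. \<exists>a\<in>A. (F a, b) \<in> S)"
proof -
  note cls = quotient_map_class[OF assms]
  have "inj_on (\<lambda>c. S `` (F ` c)) (A // R) \<longleftrightarrow> (\<forall>a\<in>A. \<forall>a'\<in>A. (F a, F a') \<in> S \<longrightarrow> (a, a') \<in> R)"
    unfolding inj_on_def quotient_def
    by (auto simp: cls eq_equiv_class_iff[OF R] eq_equiv_class_iff[OF S] F)
  moreover have "(\<lambda>c. S `` (F ` c)) ` (A // R) = B // S \<longleftrightarrow> (\<forall>b\<in>B. \<exists>a\<in>A. (F a, b) \<in> S)"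
  proof -
    have im: "(\<lambda>c. S `` (F ` c)) ` (A // R) = (\<lambda>a. S `` {F a}) ` A"
      by (auto simp: quotient_def image_UN cls)
    have "B // S = (\<lambda>b. S `` {b}) ` B" by (auto simp: quotient_def)
    then have "(\<lambda>c. S `` (F ` c)) ` (A // R) = B // S \<longleftrightarrow> (\<forall>b\<in>B. \<exists>a\<in>A. S `` {F a} = S `` {b})"
      unfolding im using F by (auto simp: image_iff set_eq_iff[of "_ ` A"]) metis+
    then show ?thesis using F by (simp add: eq_equiv_class_iff[OF S] cong: ball_cong bex_cong)
  qed
  ultimately show ?thesis by (auto simp: bij_betw_def)
qed

lemma spheroid_rel_iff:
  "(\<gamma>, \<delta>) \<in> spheroid_rel n X x \<longleftrightarrow>
    (\<exists>H. cmap ({0..1::real} \<times> unit_cube n) X H \<and> (\<forall>y\<in>unit_cube n. H (0, y) = \<gamma> y) \<and>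
      (\<forall>y\<in>unit_cube n. H (1, y) = \<delta> y) \<and> (\<forall>s\<in>{0..1}. \<forall>y\<in>cube_boundary n. H (s, y) = x))"
proof -
  have "h ` cube_boundary n \<subseteq> {x} \<longleftrightarrow> k ` cube_boundary n \<subseteq> {x}"
    if "\<And>y. y \<in> topspace (top_of_set (unit_cube n)) \<Longrightarrow> h y = k y" for h k
    using that cube_boundary_subset[of n] by (auto simp: image_subset_iff) (metis subsetD)+
  note * = homotopic_with[OF this]
  show ?thesis
    unfolding spheroid_rel_def mem_Collect_eq case_prod_conv
    by (subst *) (auto simp: image_subset_iff)
qed

lemma spheroidsD:
  assumes "\<gamma> \<in> spheroids n X x"
  shows "cmap (unit_cube n) X \<gamma>" "\<And>y. y \<in> cube_boundary n \<Longrightarrow> \<gamma> y = x"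
  using assms by (auto simp: spheroids_def image_subset_iff)

lemma spheroidsI:
  "\<lbrakk>cmap (unit_cube n) X \<gamma>; \<And>y. y \<in> cube_boundary n \<Longrightarrow> \<gamma> y = x\<rbrakk> \<Longrightarrow> \<gamma> \<in> spheroids n X x"
  by (auto simp: spheroids_def)

lemma equiv_homotopic_with:
  "equiv {f. continuous_map X Y f \<and> P f} {(f, g). homotopic_with P X Y f g}"
  by (intro equivI refl_onI symI transI)
    (auto dest: homotopic_with_imp_continuous_maps homotopic_with_imp_property homotopic_with_symD homotopic_with_trans)

lemma equiv_spheroids: "equiv (spheroids n X x) (spheroid_rel n X x)"
  using equiv_homotopic_with by (simp add: spheroids_def spheroid_rel_def)

lemma spheroids_compose:
  "continuous_map X Y f \<Longrightarrow> \<gamma> \<in> spheroids n X x \<Longrightarrow> f \<circ> \<gamma> \<in> spheroids n Y (f x)"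
  by (auto simp: spheroids_def image_subset_iff intro: continuous_map_compose)

lemma spheroid_rel_compose:
  "continuous_map X Y f \<Longrightarrow> (\<gamma>, \<delta>) \<in> spheroid_rel n X x \<Longrightarrow> (f \<circ> \<gamma>, f \<circ> \<delta>) \<in> spheroid_rel n Y (f x)"
  by (auto simp: spheroid_rel_def image_subset_iff intro: homotopic_with_compose_continuous_map_left)

lemma equiv_path_component: "equiv (topspace X) {(x, y). path_component_of X x y}"
  by (intro equivI refl_onI symI transI)
    (auto simp: path_component_of_refl dest: path_component_in_topspace path_component_of_sym path_component_of_trans)

lemma path_component_of_map:
  "continuous_map X Y f \<Longrightarrow> path_component_of X x y \<Longrightarrow> path_component_of Y (f x) (f y)"
  unfolding path_component_of_def using pathin_compose by fastforce

lemma weak_equivalence_iff: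
  "weak_equivalence X Y f \<longleftrightarrow> continuous_map X Y f \<and>
    (\<forall>x\<in>topspace X. \<forall>x'\<in>topspace X. path_component_of Y (f x) (f x') \<longrightarrow> path_component_of X x x') \<and>
    (\<forall>y\<in>topspace Y. \<exists>x\<in>topspace X. path_component_of Y (f x) y) \<and>
    (\<forall>n\<ge>1. \<forall>x\<in>topspace X.
      (\<forall>\<gamma>\<in>spheroids n X x. \<forall>\<gamma>'\<in>spheroids n X x.
         (f \<circ> \<gamma>, f \<circ> \<gamma>') \<in> spheroid_rel n Y (f x) \<longrightarrow> (\<gamma>, \<gamma>') \<in> spheroid_rel n X x) \<and>
      (\<forall>\<delta>\<in>spheroids n Y (f x). \<exists>\<gamma>\<in>spheroids n X x. (f \<circ> \<gamma>, \<delta>) \<in> spheroid_rel n Y (f x)))"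
proof (cases "continuous_map X Y f")
  case f: True
  have pc: "path_components_of Z = topspace Z // {(x, y). path_component_of Z x y}" for Z :: "'z topology"
    by (auto simp: path_components_of_def quotient_def)
  have pm: "path_components_map Y f = (\<lambda>c. {(x, y). path_component_of Y x y} `` (f ` c))"
    by (auto simp: path_components_map_def fun_eq_iff)
  have "bij_betw (path_components_map Y f) (path_components_of X) (path_components_of Y) \<longleftrightarrow>
     (\<forall>x\<in>topspace X. \<forall>x'\<in>topspace X. path_component_of Y (f x) (f x') \<longrightarrow> path_component_of X x x') \<and>
    (\<forall>y\<in>topspace Y. \<exists>x\<in>topspace X. path_component_of Y (f x) y)"
    unfolding pc pm
    by (subst bij_betw_quotient_map_iff[OF equiv_path_component equiv_path_component])
      (use f in \<open>auto simp: path_component_of_map continuous_map_def\<close>)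
  moreover have "bij_betw (homotopy_group_map n Y f x) (homotopy_group n X x) (homotopy_group n Y (f x)) \<longleftrightarrow>
      (\<forall>\<gamma>\<in>spheroids n X x. \<forall>\<gamma>'\<in>spheroids n X x.
         (f \<circ> \<gamma>, f \<circ> \<gamma>') \<in> spheroid_rel n Y (f x) \<longrightarrow> (\<gamma>, \<gamma>') \<in> spheroid_rel n X x) \<and>
      (\<forall>\<delta>\<in>spheroids n Y (f x). \<exists>\<gamma>\<in>spheroids n X x. (f \<circ> \<gamma>, \<delta>) \<in> spheroid_rel n Y (f x))" for n x
    unfolding homotopy_group_def homotopy_group_map_def[abs_def]
    by (rule bij_betw_quotient_map_iff[OF equiv_spheroids equiv_spheroids])
      (use f in \<open>auto intro: spheroids_compose spheroid_rel_compose\<close>)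
  ultimately show ?thesis using f by (simp add: weak_equivalence_def)
qed (simp add: weak_equivalence_def)

lemma weak_equivalence_continuous: "weak_equivalence X Y f \<Longrightarrow> continuous_map X Y f"
  by (simp add: weak_equivalence_def)

lemma weak_equivalence_cong:
  assumes f: "weak_equivalence X Y f" and eq: "\<And>x. x \<in> topspace X \<Longrightarrow> f x = g x"
  shows "weak_equivalence X Y g"
proof -
  have rel: "(g \<circ> \<gamma>, \<delta>) \<in> spheroid_rel n Y y \<longleftrightarrow> (f \<circ> \<gamma>, \<delta>) \<in> spheroid_rel n Y y"
    "(\<delta>, g \<circ> \<gamma>) \<in> spheroid_rel n Y y \<longleftrightarrow> (\<delta>, f \<circ> \<gamma>) \<in> spheroid_rel n Y y"
    if "\<gamma> \<in> spheroids n X x" for n x y \<gamma> \<delta>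
    using cmap_in[OF spheroidsD(1)[OF that]] eq by (simp_all add: spheroid_rel_iff)
  show ?thesis
    using f continuous_map_eq[OF _ eq, of X Y] unfolding weak_equivalence_iff
    by (auto simp: rel eq[symmetric])
qed

lemma weak_equivalence_compose:
  assumes f: "weak_equivalence X Y f" and g: "weak_equivalence Y Z g"
  shows "weak_equivalence X Z (g \<circ> f)"
proof -
  note f' = f[unfolded weak_equivalence_iff] and g' = g[unfolded weak_equivalence_iff]
  have cf: "continuous_map X Y f" and cg: "continuous_map Y Z g"
    using f g by (auto simp: weak_equivalence_continuous)
  have fx: "f x \<in> topspace Y" if "x \<in> topspace X" for x using cf that by (auto simp: continuous_map_def)
  show ?thesis unfolding weak_equivalence_iff
  proof (intro conjI ballI allI impI)
    show "continuous_map X Z (g \<circ> f)" using cf cg by (rule continuous_map_compose)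
    show "path_component_of X x x'" if "x \<in> topspace X" "x' \<in> topspace X"
      "path_component_of Z ((g \<circ> f) x) ((g \<circ> f) x')" for x x'
      using that f' g' fx by auto
    show "\<exists>x\<in>topspace X. path_component_of Z ((g \<circ> f) x) z" if z: "z \<in> topspace Z" for z
    proof -
      obtain y where "y \<in> topspace Y" "path_component_of Z (g y) z" using g' z by blast
      moreover then obtain x where "x \<in> topspace X" "path_component_of Y (f x) y" using f' by blast
      ultimately show ?thesis
        using path_component_of_map[OF cg] path_component_of_trans by (metis comp_apply)
    qed
  next
    fix n x \<gamma> \<gamma>'
    assume "1 \<le> n" "x \<in> topspace X" "\<gamma> \<in> spheroids n X x" "\<gamma>' \<in> spheroids n X x"
      "(g \<circ> f \<circ> \<gamma>, g \<circ> f \<circ> \<gamma>') \<in> spheroid_rel n Z ((g \<circ> f) x)"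
    then show "(\<gamma>, \<gamma>') \<in> spheroid_rel n X x"
      using f' g' fx spheroids_compose[OF cf] by (auto simp: comp_assoc)
  next
    fix n x \<delta>
    assume n: "1 \<le> n" and x: "x \<in> topspace X" and d: "\<delta> \<in> spheroids n Z ((g \<circ> f) x)"
    have "\<forall>\<delta>\<in>spheroids n Z (g (f x)). \<exists>\<eta>\<in>spheroids n Y (f x). (g \<circ> \<eta>, \<delta>) \<in> spheroid_rel n Z (g (f x))"
      using g' n fx[OF x] by blast
    then obtain \<eta> where \<eta>: "\<eta> \<in> spheroids n Y (f x)" "(g \<circ> \<eta>, \<delta>) \<in> spheroid_rel n Z (g (f x))"
      using d unfolding comp_apply by blast
    then obtain \<gamma> where \<gamma>: "\<gamma> \<in> spheroids n X x" "(f \<circ> \<gamma>, \<eta>) \<in> spheroid_rel n Y (f x)"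
      using f' n x by blast
    then have "(g \<circ> (f \<circ> \<gamma>), \<delta>) \<in> spheroid_rel n Z (g (f x))"
      using spheroid_rel_compose[OF cg \<gamma>(2)] \<eta>(2) equiv_spheroids by (meson equivE transE)
    then show "\<exists>\<gamma>\<in>spheroids n X x. (g \<circ> f \<circ> \<gamma>, \<delta>) \<in> spheroid_rel n Z ((g \<circ> f) x)"
      using \<gamma>(1) by (auto simp: comp_assoc)
  qed
qed

text \<open>Of the two cancellation cases this is the one without a change of base point: the
  homotopy groups of \<open>Y\<close> are taken at points \<open>f x\<close>, where both
  \<open>g\<close> and \<open>g \<circ> f\<close> give bijections.\<close>

lemma weak_equivalence_cancel:
  assumes f: "continuous_map X Y f" and g: "weak_equivalence Y Z g" and gf: "weak_equivalence X Z (g \<circ> f)"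
  shows "weak_equivalence X Y f"
proof -
  note g' = g[unfolded weak_equivalence_iff] and gf' = gf[unfolded weak_equivalence_iff]
  have cg: "continuous_map Y Z g" using g by (rule weak_equivalence_continuous)
  have fx: "f x \<in> topspace Y" if "x \<in> topspace X" for x using f that by (auto simp: continuous_map_def)
  have gy: "g y \<in> topspace Z" if "y \<in> topspace Y" for y using cg that by (auto simp: continuous_map_def)
  show ?thesis unfolding weak_equivalence_iff
  proof (intro conjI ballI allI impI)
    show "continuous_map X Y f" by (rule f)
    show "path_component_of X x x'" if "x \<in> topspace X" "x' \<in> topspace X"
      "path_component_of Y (f x) (f x')" for x x'
      using that gf' path_component_of_map[OF cg that(3)] by auto
    show "\<exists>x\<in>topspace X. path_component_of Y (f x) y" if y: "y \<in> topspace Y" for y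
    proof -
      obtain x where "x \<in> topspace X" "path_component_of Z (g (f x)) (g y)"
        using gf' gy[OF y] by auto
      then show ?thesis using g' y fx by blast
    qed
  next
    fix n x \<gamma> \<gamma>'
    assume n: "1 \<le> n" "x \<in> topspace X" "\<gamma> \<in> spheroids n X x" "\<gamma>' \<in> spheroids n X x"
      and rel: "(f \<circ> \<gamma>, f \<circ> \<gamma>') \<in> spheroid_rel n Y (f x)"
    then show "(\<gamma>, \<gamma>') \<in> spheroid_rel n X x"
      using gf' spheroid_rel_compose[OF cg rel] by (simp add: comp_assoc)
  next
    fix n x \<delta>
    assume n: "1 \<le> n" and x: "x \<in> topspace X" and d: "\<delta> \<in> spheroids n Y (f x)"
    have "\<forall>\<delta>\<in>spheroids n Z (g (f x)). \<exists>\<gamma>\<in>spheroids n X x. (g \<circ> f \<circ> \<gamma>, \<delta>) \<in> spheroid_rel n Z (g (f x))"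
      using gf' n x unfolding comp_apply by blast
    then obtain \<gamma> where \<gamma>: "\<gamma> \<in> spheroids n X x" "(g \<circ> f \<circ> \<gamma>, g \<circ> \<delta>) \<in> spheroid_rel n Z (g (f x))"
      using spheroids_compose[OF cg d] by blast
    then have "(f \<circ> \<gamma>, \<delta>) \<in> spheroid_rel n Y (f x)"
      using g' n fx[OF x] spheroids_compose[OF f \<gamma>(1)] d by (simp add: comp_assoc)
    then show "\<exists>\<gamma>\<in>spheroids n X x. (f \<circ> \<gamma>, \<delta>) \<in> spheroid_rel n Y (f x)"
      using \<gamma>(1) by blast
  qed
qed

lemma weak_equivalence_homeomorphic_maps:
  assumes "homeomorphic_maps X Y f g" shows "weak_equivalence X Y f"
proof -
  have f: "continuous_map X Y f" and g: "continuous_map Y X g"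
    and gf: "\<And>x. x \<in> topspace X \<Longrightarrow> g (f x) = x" and fg: "\<And>y. y \<in> topspace Y \<Longrightarrow> f (g y) = y"
    using assms by (auto simp: homeomorphic_maps_def)
  have gy: "g y \<in> topspace X" if "y \<in> topspace Y" for y using g that by (auto simp: continuous_map_def)
  show ?thesis unfolding weak_equivalence_iff
  proof (intro conjI ballI allI impI)
    show "path_component_of X x x'" if "x \<in> topspace X" "x' \<in> topspace X"
      "path_component_of Y (f x) (f x')" for x x'
      using that path_component_of_map[OF g that(3)] gf by simp
    show "\<exists>x\<in>topspace X. path_component_of Y (f x) y" if y: "y \<in> topspace Y" for y
      using gy[OF y] fg[OF y] y by (auto simp: path_component_of_refl intro!: bexI[of _ "g y"])
  next
    fix n x \<gamma> \<gamma>'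
    assume x: "x \<in> topspace X" and s: "\<gamma> \<in> spheroids n X x" "\<gamma>' \<in> spheroids n X x"
      and rel: "(f \<circ> \<gamma>, f \<circ> \<gamma>') \<in> spheroid_rel n Y (f x)"
    then show "(\<gamma>, \<gamma>') \<in> spheroid_rel n X x"
      using spheroid_rel_compose[OF g rel] cmap_in[OF spheroidsD(1)[OF s(1)]] cmap_in[OF spheroidsD(1)[OF s(2)]]
      by (simp add: spheroid_rel_iff gf)
  next
    fix n x \<delta>
    assume x: "x \<in> topspace X" and d: "\<delta> \<in> spheroids n Y (f x)"
    have "g \<circ> \<delta> \<in> spheroids n X x" using spheroids_compose[OF g d] gf[OF x] by simp
    moreover have "(\<delta>, \<delta>) \<in> spheroid_rel n Y (f x)"
      using equiv_class_self[OF equiv_spheroids d] by simp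
    then have "(f \<circ> (g \<circ> \<delta>), \<delta>) \<in> spheroid_rel n Y (f x)"
      using cmap_in[OF spheroidsD(1)[OF d]] by (simp add: spheroid_rel_iff fg)
    ultimately show "\<exists>\<gamma>\<in>spheroids n X x. (f \<circ> \<gamma>, \<delta>) \<in> spheroid_rel n Y (f x)" by blast
  qed (rule f)
qed

section \<open>Lifting along weak equivalences\<close>

text \<open>Unlike \<open>continuous_intros\<close>, these rules do not descend into the coordinates of \<open>nat \<Rightarrow> real\<close>.\<close>

lemmas prod_continuous_intros = continuous_on_Pair continuous_on_diff continuous_on_const
  continuous_on_fst continuous_on_snd continuous_on_id

text \<open>Injectivity on homotopy groups, or on path components if \<open>m = 0\<close>. The null
  homotopy \<open>A\<close> need not lie over \<open>B\<close>, not even up to homotopy;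
  \<open>normalized_prism_lift\<close> repairs the difference one dimension higher.\<close>

lemma weak_equivalence_spheroid_null:
  assumes k: "weak_equivalence C D k" and c0: "c0 \<in> topspace C"
    and \<zeta>: "cmap (unit_cube m) C \<zeta>" "\<And>x. x \<in> cube_boundary m \<Longrightarrow> \<zeta> x = c0"
    and B: "cmap ({0..1::real} \<times> unit_cube m) D B" "\<And>x. x \<in> unit_cube m \<Longrightarrow> B (0, x) = k c0"
      "\<And>x. x \<in> unit_cube m \<Longrightarrow> B (1, x) = k (\<zeta> x)"
      "\<And>p x. p \<in> {0..1} \<Longrightarrow> x \<in> cube_boundary m \<Longrightarrow> B (p, x) = k c0"
  obtains A where "cmap ({0..1::real} \<times> unit_cube m) C A" "\<And>x. x \<in> unit_cube m \<Longrightarrow> A (0, x) = c0"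
      "\<And>x. x \<in> unit_cube m \<Longrightarrow> A (1, x) = \<zeta> x"
      "\<And>p x. p \<in> {0..1} \<Longrightarrow> x \<in> cube_boundary m \<Longrightarrow> A (p, x) = c0"
proof (cases "m = 0")
  case True
  let ?o = "\<lambda>_::nat. 0::real"
  have "cmap {0..1::real} D (\<lambda>p. B (p, ?o))"
    by (rule cmap_compose[OF B(1)]) (auto intro!: prod_continuous_intros)
  then have "path_component_of D (k c0) (k (\<zeta> ?o))"
    using B(2,3)[of ?o] unfolding path_component_of_def pathin_def
    by (intro exI[of _ "\<lambda>p. B (p, ?o)"]) simp
  moreover have "\<zeta> ?o \<in> topspace C" using cmap_in[OF \<zeta>(1), of ?o] by simp
  ultimately have "path_component_of C c0 (\<zeta> ?o)"
    using k c0 unfolding weak_equivalence_iff by blast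
  then obtain g where g: "cmap {0..1::real} C g" "g 0 = c0" "g 1 = \<zeta> ?o"
    unfolding path_component_of_def pathin_def by blast
  have "cmap ({0..1} \<times> unit_cube m) C (\<lambda>z. g (fst z))"
    by (rule cmap_compose[OF g(1)]) (auto intro: prod_continuous_intros)
  then show ?thesis
    using g True by (intro that[of "\<lambda>z. g (fst z)"]) auto
next
  case False
  let ?c = "\<lambda>_::nat \<Rightarrow> real. c0"
  have "?c \<in> spheroids m C c0" "\<zeta> \<in> spheroids m C c0"
    using c0 \<zeta> by (auto intro!: spheroidsI)
  moreover have "(k \<circ> ?c, k \<circ> \<zeta>) \<in> spheroid_rel m D (k c0)"
    unfolding spheroid_rel_iff using B by (intro exI[of _ B]) auto
  ultimately have "(?c, \<zeta>) \<in> spheroid_rel m C c0"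
    using k c0 False unfolding weak_equivalence_iff by auto
  then show ?thesis unfolding spheroid_rel_iff using that by blast
qed

text \<open>Surjectivity on homotopy groups in dimension \<open>Suc m\<close>, rewritten from cube
  to prism coordinates. The homotopy is reversed so that it starts at \<delta>, the direction used
  in \<open>lift_prop\<close>.\<close>

lemma weak_equivalence_prism_spheroid_lift:
  assumes k: "weak_equivalence C D k" and c0: "c0 \<in> topspace C"
    and \<delta>: "cmap ({0..1::real} \<times> unit_cube m) D \<delta>"
      "\<And>z. z \<in> prism_bdry (unit_cube m) (cube_boundary m) \<Longrightarrow> \<delta> z = k c0"
  obtains \<gamma> G where "cmap ({0..1::real} \<times> unit_cube m) C \<gamma>"
      "\<And>z. z \<in> prism_bdry (unit_cube m) (cube_boundary m) \<Longrightarrow> \<gamma> z = c0"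
      "cmap ({0..1::real} \<times> {0..1::real} \<times> unit_cube m) D G"
      "\<And>z. z \<in> {0..1} \<times> unit_cube m \<Longrightarrow> G (0, z) = \<delta> z"
      "\<And>z. z \<in> {0..1} \<times> unit_cube m \<Longrightarrow> G (1, z) = k (\<gamma> z)"
      "\<And>u z. u \<in> {0..1} \<Longrightarrow> z \<in> prism_bdry (unit_cube m) (cube_boundary m) \<Longrightarrow> G (u, z) = k c0"
proof -
  let ?L = "{0..1::real} \<times> unit_cube m"
  have join: "cube_join m z \<in> unit_cube (Suc m)" "cube_split m (cube_join m z) = z" if "z \<in> ?L" for z
    using that by (cases z; simp add: cube_join_in cube_split_join)+
  have join_b: "cube_join m z \<in> cube_boundary (Suc m)" "z \<in> ?L"
    if "z \<in> prism_bdry (unit_cube m) (cube_boundary m)" for z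
    using that cube_boundary_subset[of m] by (auto simp: cube_boundary_image prism_bdry_def)
  have "cmap (unit_cube (Suc m)) D (\<lambda>y. \<delta> (cube_split m y))"
    by (rule cmap_compose[OF \<delta>(1) continuous_cube_split]) (auto dest: cube_split_in)
  moreover have "\<delta> (cube_split m y) = k c0" if "y \<in> cube_boundary (Suc m)" for y
    using that join(2) join_b \<delta>(2) unfolding cube_boundary_image by auto
  ultimately have "(\<lambda>y. \<delta> (cube_split m y)) \<in> spheroids (Suc m) D (k c0)"
    by (rule spheroidsI)
  moreover have "\<forall>\<delta>\<in>spheroids (Suc m) D (k c0). \<exists>\<gamma>\<in>spheroids (Suc m) C c0. (k \<circ> \<gamma>, \<delta>) \<in> spheroid_rel (Suc m) D (k c0)"
    using k c0 unfolding weak_equivalence_iff by auto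
  ultimately obtain \<gamma> where \<gamma>: "\<gamma> \<in> spheroids (Suc m) C c0"
    "(k \<circ> \<gamma>, \<lambda>y. \<delta> (cube_split m y)) \<in> spheroid_rel (Suc m) D (k c0)" by blast
  then obtain H where H: "cmap ({0..1::real} \<times> unit_cube (Suc m)) D H"
     "\<And>y. y \<in> unit_cube (Suc m) \<Longrightarrow> H (0, y) = k (\<gamma> y)" "\<And>y. y \<in> unit_cube (Suc m) \<Longrightarrow> H (1, y) = \<delta> (cube_split m y)"
     "\<And>s y. s \<in> {0..1} \<Longrightarrow> y \<in> cube_boundary (Suc m) \<Longrightarrow> H (s, y) = k c0"
    unfolding spheroid_rel_iff by auto
  show thesis
  proof (rule that)
    show "cmap ?L C (\<lambda>z. \<gamma> (cube_join m z))"
      by (rule cmap_compose[OF spheroidsD(1)[OF \<gamma>(1)] continuous_cube_join]) (use join in auto)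
    show "\<gamma> (cube_join m z) = c0" if "z \<in> prism_bdry (unit_cube m) (cube_boundary m)" for z
      using spheroidsD(2)[OF \<gamma>(1)] join_b that by blast
    show "cmap ({0..1} \<times> ?L) D (\<lambda>z. H (1 - fst z, cube_join m (snd z)))"
      by (rule cmap_compose[OF H(1)])
        (use join in \<open>auto intro!: prod_continuous_intros continuous_on_compose2[OF continuous_cube_join[of UNIV]]\<close>)
  qed (use H join join_b in auto)
qed

text \<open>The homotopy extension and lifting property (HELP). The boundary data \<alpha> and
  \<open>H\<close> are extended strictly, whereas the new lift lies over \<beta> only up to the
  homotopy \<open>H'\<close>.\<close>

definition lift_prop :: "'b::topological_space set \<Rightarrow> 'b set \<Rightarrow> 'c topology \<Rightarrow> 'd topology \<Rightarrow> ('c \<Rightarrow> 'd) \<Rightarrow> bool" where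
  "lift_prop K dK C D k \<longleftrightarrow>
    (\<forall>\<alpha> \<beta> H. cmap dK C \<alpha> \<and> cmap K D \<beta> \<and> cmap ({0..1::real} \<times> dK) D H \<and>
       (\<forall>x\<in>dK. H (0, x) = \<beta> x \<and> H (1, x) = k (\<alpha> x)) \<longrightarrow>
       (\<exists>\<alpha>' H'. cmap K C \<alpha>' \<and> (\<forall>x\<in>dK. \<alpha>' x = \<alpha> x) \<and> cmap ({0..1::real} \<times> K) D H' \<and>
          (\<forall>x\<in>K. H' (0, x) = \<beta> x \<and> H' (1, x) = k (\<alpha>' x)) \<and>
          (\<forall>s\<in>{0..1}. \<forall>x\<in>dK. H' (s, x) = H (s, x))))"

lemma lift_propD:
  assumes "lift_prop K dK C D k" "cmap dK C \<alpha>" "cmap K D \<beta>" "cmap ({0..1::real} \<times> dK) D H"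
    "\<And>x. x \<in> dK \<Longrightarrow> H (0, x) = \<beta> x" "\<And>x. x \<in> dK \<Longrightarrow> H (1, x) = k (\<alpha> x)"
  obtains \<alpha>' H' where "cmap K C \<alpha>'" "\<And>x. x \<in> dK \<Longrightarrow> \<alpha>' x = \<alpha> x" "cmap ({0..1::real} \<times> K) D H'"
    "\<And>x. x \<in> K \<Longrightarrow> H' (0, x) = \<beta> x" "\<And>x. x \<in> K \<Longrightarrow> H' (1, x) = k (\<alpha>' x)"
    "\<And>s x. s \<in> {0..1} \<Longrightarrow> x \<in> dK \<Longrightarrow> H' (s, x) = H (s, x)"
proof -
  have "\<exists>\<alpha>' H'. cmap K C \<alpha>' \<and> (\<forall>x\<in>dK. \<alpha>' x = \<alpha> x) \<and> cmap ({0..1::real} \<times> K) D H' \<and>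
          (\<forall>x\<in>K. H' (0, x) = \<beta> x \<and> H' (1, x) = k (\<alpha>' x)) \<and>
          (\<forall>s\<in>{0..1}. \<forall>x\<in>dK. H' (s, x) = H (s, x))"
    using assms unfolding lift_prop_def by simp
  then show thesis using that by metis
qed

text \<open>The prescribed lift is constant on all faces except the top. Injectivity gives a null
  homotopy \<open>A\<close> of \<zeta>; \<open>k \<circ> A\<close> and \<beta> differ by a spheroid
  of dimension \<open>Suc m\<close>, which surjectivity lifts to \<gamma>; correcting
  \<open>A\<close> by \<gamma> gives the lift.\<close>

lemma normalized_prism_lift:
  assumes k: "weak_equivalence C D k" and c0: "c0 \<in> topspace C"
    and \<zeta>: "cmap (unit_cube m) C \<zeta>" "\<And>x. x \<in> cube_boundary m \<Longrightarrow> \<zeta> x = c0"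
    and \<beta>: "cmap ({0..1::real} \<times> unit_cube m) D \<beta>" "\<And>x. x \<in> unit_cube m \<Longrightarrow> \<beta> (0, x) = k c0"
      "\<And>x. x \<in> unit_cube m \<Longrightarrow> \<beta> (1, x) = k (\<zeta> x)"
      "\<And>p x. p \<in> {0..1} \<Longrightarrow> x \<in> cube_boundary m \<Longrightarrow> \<beta> (p, x) = k c0"
  obtains \<alpha> E where "cmap ({0..1::real} \<times> unit_cube m) C \<alpha>"
    "\<And>x. x \<in> unit_cube m \<Longrightarrow> \<alpha> (0, x) = c0" "\<And>x. x \<in> unit_cube m \<Longrightarrow> \<alpha> (1, x) = \<zeta> x"
    "\<And>p x. p \<in> {0..1} \<Longrightarrow> x \<in> cube_boundary m \<Longrightarrow> \<alpha> (p, x) = c0"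
    "cmap ({0..1::real} \<times> {0..1::real} \<times> unit_cube m) D E"
    "\<And>z. z \<in> {0..1} \<times> unit_cube m \<Longrightarrow> E (0, z) = \<beta> z"
    "\<And>z. z \<in> {0..1} \<times> unit_cube m \<Longrightarrow> E (1, z) = k (\<alpha> z)"
    "\<And>t z. t \<in> {0..1} \<Longrightarrow> z \<in> prism_bdry (unit_cube m) (cube_boundary m) \<Longrightarrow> E (t, z) = \<beta> z"
proof -
  let ?I = "{0..1::real}" and ?K = "unit_cube m" and ?dK = "cube_boundary m"
  let ?bL = "prism_bdry ?K ?dK"
  note cell = cell_unit_cube[of m]
  have ck: "continuous_map C D k" using k by (rule weak_equivalence_continuous)
  have kc0: "k c0 \<in> topspace D" using ck c0 by (auto simp: continuous_map_def)
  have dK: "x \<in> ?K" if "x \<in> ?dK" for x using that cube_boundary_subset by blast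
  obtain A where A: "cmap (?I \<times> ?K) C A" "\<And>x. x \<in> ?K \<Longrightarrow> A (0, x) = c0" "\<And>x. x \<in> ?K \<Longrightarrow> A (1, x) = \<zeta> x"
      "\<And>p x. p \<in> ?I \<Longrightarrow> x \<in> ?dK \<Longrightarrow> A (p, x) = c0"
    using weak_equivalence_spheroid_null[OF k c0 \<zeta> \<beta>] by metis
  note kA = cmap_post[OF A(1) ck] and k\<zeta> = cmap_post[OF \<zeta>(1) ck]
  have rev: "cmap (?I \<times> ?K) D (\<lambda>z. f (1 - fst z, snd z))" if "cmap (?I \<times> ?K) D f" for f
    by (rule cmap_compose[OF that]) (auto intro!: prod_continuous_intros)
  have k\<zeta>': "cmap (?I \<times> ?K) D (\<lambda>z. k (\<zeta> (snd z)))"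
    by (rule cmap_compose[OF k\<zeta>]) (auto intro!: prod_continuous_intros)
  have const: "cmap (?I \<times> ?I \<times> ?dK) D (\<lambda>_. k c0)" "cmap (?I \<times> ?I \<times> ?dK) C (\<lambda>_. c0)"
    using c0 kc0 by auto
  \<comment> \<open>The face s = 1 of \<Delta> is the difference of \<open>k \<circ> A\<close> and
    \<beta>, glued along their common top \<open>k \<circ> \<zeta>\<close>. It is constant on its
    own boundary because both maps are \<open>k c0\<close> on the bottom and the sides.\<close>
  obtain \<Delta> where \<Delta>: "cmap (?I \<times> ?I \<times> ?K) D \<Delta>"
    "\<And>s x. s \<in> ?I \<Longrightarrow> x \<in> ?K \<Longrightarrow> \<Delta> (s, 0, x) = k (A (1 - s, x))"
    "\<And>s x. s \<in> ?I \<Longrightarrow> x \<in> ?K \<Longrightarrow> \<Delta> (s, 1, x) = \<beta> (1 - s, x)"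
    "\<And>t x. t \<in> ?I \<Longrightarrow> x \<in> ?K \<Longrightarrow> \<Delta> (0, t, x) = k (\<zeta> x)"
    "\<And>s t x. s \<in> ?I \<Longrightarrow> t \<in> ?I \<Longrightarrow> x \<in> ?dK \<Longrightarrow> \<Delta> (s, t, x) = k c0"
  proof (rule fill_square[OF cell rev[OF kA] rev[OF \<beta>(1)] k\<zeta>' const(1)], goal_cases)
    case (6 H) then show thesis by (intro that[of H]) simp_all
  qed (auto simp: A \<beta> \<zeta> dK)
  have \<Delta>1: "cmap (?I \<times> ?K) D (\<lambda>z. \<Delta> (1, z))"
    by (rule cmap_compose[OF \<Delta>(1)]) (auto intro!: prod_continuous_intros)
  have \<Delta>1b: "\<Delta> (1, z) = k c0" if "z \<in> ?bL" for z
    using that \<Delta> A \<beta> by (auto simp: prism_bdry_def)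
  obtain \<gamma> G where \<gamma>: "cmap (?I \<times> ?K) C \<gamma>" "\<And>z. z \<in> ?bL \<Longrightarrow> \<gamma> z = c0"
    and G: "cmap (?I \<times> ?I \<times> ?K) D G" "\<And>z. z \<in> ?I \<times> ?K \<Longrightarrow> G (0, z) = \<Delta> (1, z)"
      "\<And>z. z \<in> ?I \<times> ?K \<Longrightarrow> G (1, z) = k (\<gamma> z)" "\<And>u z. u \<in> ?I \<Longrightarrow> z \<in> ?bL \<Longrightarrow> G (u, z) = k c0"
  proof (rule weak_equivalence_prism_spheroid_lift[OF k c0 \<Delta>1 \<Delta>1b], goal_cases)
    case (2 \<gamma> G) show thesis by (rule 2(1)[OF 2(2-)])
  qed
  have \<gamma>b: "\<gamma> (0, x) = c0" "\<gamma> (1, x) = c0" if "x \<in> ?K" for x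
    using \<gamma>(2) that by (auto simp: prism_bdry_def)
  have \<gamma>d: "\<gamma> (s, x) = c0" if "s \<in> ?I" "x \<in> ?dK" for s x
    using \<gamma>(2) that by (auto simp: prism_bdry_def)
  have \<zeta>': "cmap (?I \<times> ?K) C (\<lambda>z. \<zeta> (snd z))"
    by (rule cmap_compose[OF \<zeta>(1)]) (auto intro!: prod_continuous_intros)
  \<comment> \<open>The face s = 1 of \<Theta> is \<open>A\<close> altered by \<gamma>: it starts at
    \<gamma> (1, x) = c0 and ends at \<zeta>, as required of the lift.\<close>
  obtain \<Theta> where \<Theta>: "cmap (?I \<times> ?I \<times> ?K) C \<Theta>"
    "\<And>s x. s \<in> ?I \<Longrightarrow> x \<in> ?K \<Longrightarrow> \<Theta> (s, 0, x) = \<gamma> (s, x)"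
    "\<And>s x. s \<in> ?I \<Longrightarrow> x \<in> ?K \<Longrightarrow> \<Theta> (s, 1, x) = \<zeta> x"
    "\<And>t x. t \<in> ?I \<Longrightarrow> x \<in> ?K \<Longrightarrow> \<Theta> (0, t, x) = A (t, x)"
    "\<And>s t x. s \<in> ?I \<Longrightarrow> t \<in> ?I \<Longrightarrow> x \<in> ?dK \<Longrightarrow> \<Theta> (s, t, x) = c0"
  proof (rule fill_square[OF cell \<gamma>(1) \<zeta>' A(1) const(2)], goal_cases)
    case (6 H) then show thesis by (intro that[of H]) simp_all
  qed (auto simp: A \<zeta> dK \<gamma>b \<gamma>d)
  \<comment> \<open>Walls for the last filling, with s as its direction, t as the homotopy parameter
    and (p, x) in the prism. \<open>G\<close> enters over p = 0, where it joins the difference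
    spheroid to \<open>k \<circ> \<gamma>\<close>. The open face s = 1 then runs from \<beta> to the
    image of the corrected map.\<close>
  define R where "R = (\<lambda>(s, t, p::real, x). if p = 0 then G (t, s, x) else if p = 1 then k (\<zeta> x) else k c0)"
  have cl: "closed ?K" "closed ?dK" using cell cell_closed cell_closed_bdry by blast+
  have "cmap (?I \<times> ?I \<times> {0::real} \<times> ?K) D R"
  proof (rule cmap_cong)
    show "cmap (?I \<times> ?I \<times> {0::real} \<times> ?K) D (\<lambda>z. G (fst (snd z), fst z, snd (snd (snd z))))"
      by (rule cmap_compose[OF G(1)]) (auto intro!: prod_continuous_intros)
  qed (auto simp: R_def)
  moreover have "cmap (?I \<times> ?I \<times> {1::real} \<times> ?K) D R"
  proof (rule cmap_cong)
    show "cmap (?I \<times> ?I \<times> {1::real} \<times> ?K) D (\<lambda>z. k (\<zeta> (snd (snd (snd z)))))"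
      by (rule cmap_compose[OF k\<zeta>]) (auto intro!: prod_continuous_intros)
  qed (auto simp: R_def)
  moreover have "cmap (?I \<times> ?I \<times> ?I \<times> ?dK) D R"
  proof (rule cmap_cong)
    show "cmap (?I \<times> ?I \<times> ?I \<times> ?dK) D (\<lambda>_. k c0)" using kc0 by simp
  qed (auto simp: R_def \<zeta> G(4) prism_bdry_def)
  ultimately have "cmap ((?I \<times> ?I \<times> {0::real} \<times> ?K \<union> ?I \<times> ?I \<times> {1::real} \<times> ?K) \<union> ?I \<times> ?I \<times> ?I \<times> ?dK) D R"
    by (intro cmap_Un) (auto intro!: closed_Times closed_Un cl)
  moreover have "(?I \<times> ?I \<times> {0::real} \<times> ?K \<union> ?I \<times> ?I \<times> {1::real} \<times> ?K) \<union> ?I \<times> ?I \<times> ?I \<times> ?dK = ?I \<times> ?I \<times> ?bL"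
    by (auto simp: prism_bdry_def)
  ultimately have R: "cmap (?I \<times> ?I \<times> ?bL) D R" by simp
  have P0: "cmap (?I \<times> ?I \<times> ?K) D (\<lambda>(s, p, x). \<Delta> (1 - p, s, x))"
    unfolding case_prod_unfold by (rule cmap_compose[OF \<Delta>(1)]) (auto intro!: prod_continuous_intros)
  have Q: "cmap (?I \<times> ?I \<times> ?K) D (\<lambda>(t, z). k (A z))"
    unfolding case_prod_unfold by (rule cmap_compose[OF kA]) (auto intro!: prod_continuous_intros)
  obtain E where E: "cmap (?I \<times> ?I \<times> ?I \<times> ?K) D E"
    "\<And>s z. s \<in> ?I \<Longrightarrow> z \<in> ?I \<times> ?K \<Longrightarrow> E (s, 0, z) = (\<lambda>(s, p, x). \<Delta> (1 - p, s, x)) (s, z)"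
    "\<And>s z. s \<in> ?I \<Longrightarrow> z \<in> ?I \<times> ?K \<Longrightarrow> E (s, 1, z) = k (\<Theta> (s, z))"
    "\<And>t z. t \<in> ?I \<Longrightarrow> z \<in> ?I \<times> ?K \<Longrightarrow> E (0, t, z) = (\<lambda>(t, z). k (A z)) (t, z)"
    "\<And>s t z. s \<in> ?I \<Longrightarrow> t \<in> ?I \<Longrightarrow> z \<in> ?bL \<Longrightarrow> E (s, t, z) = R (s, t, z)"
  proof (rule fill_square[OF cell_prism[OF cell] P0 cmap_post[OF \<Theta>(1) ck] Q R])
    show "(\<lambda>(t, z). k (A z)) (0, z) = (\<lambda>(s, p, x). \<Delta> (1 - p, s, x)) (0, z)" if "z \<in> ?I \<times> ?K" for z
      using that \<Delta>(2) by (auto simp: case_prod_unfold)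
    show "(\<lambda>(t, z). k (A z)) (1, z) = k (\<Theta> (0, z))" if "z \<in> ?I \<times> ?K" for z
      using that \<Theta>(4) by auto
    show "R (s, 0, z) = (\<lambda>(s, p, x). \<Delta> (1 - p, s, x)) (s, z)" if "s \<in> ?I" "z \<in> ?bL" for s z
      using that G(2) \<Delta>(4,5) dK by (auto simp: R_def prism_bdry_def \<zeta>)
    show "R (s, 1, z) = k (\<Theta> (s, z))" if "s \<in> ?I" "z \<in> ?bL" for s z
      using that G(3) \<Theta>(2,3,5) dK \<gamma>d by (auto simp: R_def prism_bdry_def \<zeta>)
    show "R (0, t, z) = (\<lambda>(t, z). k (A z)) (t, z)" if "t \<in> ?I" "z \<in> ?bL" for t z
      using that G(4) A dK by (auto simp: R_def prism_bdry_def \<zeta>)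
  next
    fix H assume "cmap (?I \<times> ?I \<times> ?I \<times> ?K) D H"
      "\<And>s z. s \<in> ?I \<Longrightarrow> z \<in> ?I \<times> ?K \<Longrightarrow> H (s, 0, z) = (\<lambda>(s, p, x). \<Delta> (1 - p, s, x)) (s, z)"
      "\<And>s z. s \<in> ?I \<Longrightarrow> z \<in> ?I \<times> ?K \<Longrightarrow> H (s, 1, z) = k (\<Theta> (s, z))"
      "\<And>t z. t \<in> ?I \<Longrightarrow> z \<in> ?I \<times> ?K \<Longrightarrow> H (0, t, z) = (\<lambda>(t, z). k (A z)) (t, z)"
      "\<And>s t z. s \<in> ?I \<Longrightarrow> t \<in> ?I \<Longrightarrow> z \<in> ?bL \<Longrightarrow> H (s, t, z) = R (s, t, z)"
    then show thesis by (rule that)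
  qed
  show thesis
  proof (rule that)
    show "cmap (?I \<times> ?K) C (\<lambda>z. \<Theta> (1, z))"
      by (rule cmap_compose[OF \<Theta>(1)]) (auto intro!: prod_continuous_intros)
    show "cmap (?I \<times> ?I \<times> ?K) D (\<lambda>z. E (1, z))"
      by (rule cmap_compose[OF E(1)]) (auto intro!: prod_continuous_intros)
    show "E (1, 0, z) = \<beta> z" if "z \<in> ?I \<times> ?K" for z
      using E(2)[of 1 z] that \<Delta>(3) by auto
    show "E (1, t, z) = \<beta> z" if "t \<in> ?I" "z \<in> ?bL" for t z
      using that E(5)[of 1 t z] G(4) \<beta> dK by (auto simp: R_def prism_bdry_def \<zeta>)
  qed (use \<Theta> \<gamma>b E(3) in auto)
qed

lemma continuous_on_scale_cube:
  "continuous_on S f \<Longrightarrow> continuous_on S g \<Longrightarrow> continuous_on S (\<lambda>z. \<lambda>i::nat. f z * (g z i :: real))"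
  by (intro continuous_on_coordinatewise_then_product continuous_on_mult)
    (auto intro: continuous_on_product_then_coordinatewise)

lemma scale_unit_cube: "s \<in> {0..1} \<Longrightarrow> x \<in> unit_cube n \<Longrightarrow> (\<lambda>i. s * x i) \<in> unit_cube n"
  by (auto simp: unit_cube_def mult_le_one)

text \<open>First the map on the boundary of the prism is deformed to one that is constant except on the
  top face, which reduces the problem to \<open>normalized_prism_lift\<close>; then the deformation is undone.\<close>

lemma lift_prop_prism:
  assumes k: "weak_equivalence C D k"
  shows "lift_prop ({0..1} \<times> unit_cube m) (prism_bdry (unit_cube m) (cube_boundary m)) C D k"
  unfolding lift_prop_def
proof (intro allI impI, elim conjE)
  let ?I = "{0..1::real}" and ?K = "unit_cube m" and ?dK = "cube_boundary m"
  let ?L = "?I \<times> ?K" and ?bL = "prism_bdry ?K ?dK"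
  fix \<alpha> \<beta> H
  assume \<alpha>: "cmap ?bL C \<alpha>" and \<beta>: "cmap ?L D \<beta>" and H: "cmap (?I \<times> ?bL) D H"
    and H01: "\<forall>z\<in>?bL. H (0, z) = \<beta> z \<and> H (1, z) = k (\<alpha> z)"
  note cell = cell_unit_cube[of m] and cellL = cell_prism[OF cell_unit_cube[of m]]
  have cl: "closed ?K" "closed ?dK" using cell cell_closed cell_closed_bdry by blast+
  have ck: "continuous_map C D k" using k by (rule weak_equivalence_continuous)
  have dK: "x \<in> ?K" if "x \<in> ?dK" for x using that cube_boundary_subset by blast
  have bL: "z \<in> ?L" if "z \<in> ?bL" for z using that dK by (auto simp: prism_bdry_def)
  have bL_simps: "(0, x) \<in> ?bL" "(1, x) \<in> ?bL" if "x \<in> ?K" for x using that by (auto simp: prism_bdry_def)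
  have bL_side: "(p, x) \<in> ?bL" if "p \<in> ?I" "x \<in> ?dK" for p x using that by (auto simp: prism_bdry_def)
  have H0: "H (0, z) = \<beta> z" and H1: "H (1, z) = k (\<alpha> z)" if "z \<in> ?bL" for z using H01 that by auto
  \<comment> \<open>Extends the boundary homotopy over the prism. The end of \<open>B0\<close> lies
    strictly over \<alpha> on the boundary, so from here on it replaces \<beta>.\<close>
  obtain B0 where B0: "cmap (?I \<times> ?L) D B0" "\<And>z. z \<in> ?L \<Longrightarrow> B0 (0, z) = \<beta> z"
    "\<And>s z. s \<in> ?I \<Longrightarrow> z \<in> ?bL \<Longrightarrow> B0 (s, z) = H (s, z)"
  proof (rule fill[OF cellL \<beta> H H0], goal_cases)
    case (2 B) show thesis by (rule 2(1)[OF 2(2-)])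
  qed
  have \<alpha>0: "cmap ?K C (\<lambda>x. \<alpha> (0, x))" and \<alpha>1: "cmap ?K C (\<lambda>x. \<alpha> (1, x))"
    by (rule cmap_compose[OF \<alpha>]; auto intro!: prod_continuous_intros simp: bL_simps)+
  have \<alpha>s: "cmap (?I \<times> ?dK) C \<alpha>" using bL_side by (intro cmap_subset[OF \<alpha>]) auto
  \<comment> \<open>Extends \<alpha> from the bottom and the sides over the whole prism,
    disregarding its values on the top face, so that it can be contracted by scaling.\<close>
  obtain a where a: "cmap ?L C a" "\<And>x. x \<in> ?K \<Longrightarrow> a (0, x) = \<alpha> (0, x)"
     "\<And>p x. p \<in> ?I \<Longrightarrow> x \<in> ?dK \<Longrightarrow> a (p, x) = \<alpha> (p, x)"
  proof (rule fill[OF cell \<alpha>0 \<alpha>s refl], goal_cases)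
    case (1 B) show thesis by (rule 1(1)[OF 1(2-)])
  qed
  \<comment> \<open>Shrinking the prism to its corner at the origin deforms \<open>a\<close> to the
    constant \<open>c0\<close>. On the top face, where \<open>a\<close> and \<alpha> may disagree,
    \<open>A1\<close> extends this deformation from the rim.\<close>
  let ?h = "\<lambda>s p x. a ((1 - s) * p, \<lambda>i. (1 - s) * x i)"
  define c0 where "c0 = a (0, \<lambda>_. 0)"
  have c0: "c0 \<in> topspace C" unfolding c0_def by (rule cmap_in[OF a(1)]) auto
  have h_in: "((1 - s) * p, \<lambda>i. (1 - s) * x i) \<in> ?L" if "s \<in> ?I" "p \<in> ?I" "x \<in> ?K" for s p x
    using that scale_unit_cube[of "1 - s" x m] by (auto simp: mult_le_one)
  have h: "cmap (?I \<times> ?L) C (\<lambda>(s, p, x). ?h s p x)"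
    unfolding case_prod_unfold
    by (rule cmap_compose[OF a(1)])
      (use h_in in \<open>auto intro!: prod_continuous_intros continuous_on_mult continuous_on_scale_cube\<close>)
  have "cmap (?I \<times> ?dK) C (\<lambda>z. (\<lambda>(s, p, x). ?h s p x) (fst z, 1, snd z))"
    by (rule cmap_compose[OF h]) (use dK in \<open>auto intro!: prod_continuous_intros\<close>)
  then have h': "cmap (?I \<times> ?dK) C (\<lambda>(s, x). ?h s 1 x)"
    by (simp add: case_prod_unfold)
  obtain A1 where A1: "cmap (?I \<times> ?K) C A1" "\<And>x. x \<in> ?K \<Longrightarrow> A1 (0, x) = \<alpha> (1, x)"
    "\<And>s x. s \<in> ?I \<Longrightarrow> x \<in> ?dK \<Longrightarrow> A1 (s, x) = (\<lambda>(s, x). ?h s 1 x) (s, x)"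
  proof (rule fill[OF cell \<alpha>1 h'], goal_cases)
    case (2 B) show thesis by (rule 2(1)[OF 2(2-)])
  qed (simp add: a(3))
  define A where "A = (\<lambda>(s, p, x). if p = 1 then A1 (s, x) else ?h s p x)"
  have "cmap (?I \<times> {0::real} \<times> ?K) C A"
  proof (rule cmap_cong)
    show "cmap (?I \<times> {0::real} \<times> ?K) C (\<lambda>(s, p, x). ?h s p x)" by (rule cmap_subset[OF h]) auto
  qed (auto simp: A_def)
  moreover have "cmap (?I \<times> {1::real} \<times> ?K) C A"
  proof (rule cmap_cong)
    show "cmap (?I \<times> {1::real} \<times> ?K) C (\<lambda>z. A1 (fst z, snd (snd z)))"
      by (rule cmap_compose[OF A1(1)]) (auto intro!: prod_continuous_intros)
  qed (auto simp: A_def)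
  moreover have "cmap (?I \<times> ?I \<times> ?dK) C A"
  proof (rule cmap_cong)
    show "cmap (?I \<times> ?I \<times> ?dK) C (\<lambda>(s, p, x). ?h s p x)" by (rule cmap_subset[OF h]) (auto simp: dK)
  qed (auto simp: A_def A1(3))
  ultimately have "cmap ((?I \<times> {0::real} \<times> ?K \<union> ?I \<times> {1::real} \<times> ?K) \<union> ?I \<times> ?I \<times> ?dK) C A"
    by (intro cmap_Un) (auto intro!: closed_Times closed_Un cl)
  moreover have "(?I \<times> {0::real} \<times> ?K \<union> ?I \<times> {1::real} \<times> ?K) \<union> ?I \<times> ?I \<times> ?dK = ?I \<times> ?bL"
    by (auto simp: prism_bdry_def)
  ultimately have A: "cmap (?I \<times> ?bL) C A" by simp
  have A0: "A (0, z) = \<alpha> z" if "z \<in> ?bL" for z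
    using that a(2,3) A1(2) dK by (auto simp: A_def prism_bdry_def)
  note kA = cmap_post[OF A ck]
  have B0_end: "cmap ?L D (\<lambda>z. B0 (1, z))"
    by (rule cmap_compose[OF B0(1)]) (auto intro!: prod_continuous_intros)
  obtain B where B: "cmap (?I \<times> ?L) D B" "\<And>z. z \<in> ?L \<Longrightarrow> B (0, z) = B0 (1, z)"
    "\<And>s z. s \<in> ?I \<Longrightarrow> z \<in> ?bL \<Longrightarrow> B (s, z) = k (A (s, z))"
  proof (rule fill[OF cellL B0_end kA], goal_cases)
    case (2 B) show thesis by (rule 2(1)[OF 2(2-)])
  qed (simp add: A0 B0(3) H1)
  have \<zeta>: "cmap ?K C (\<lambda>x. A1 (1, x))"
    by (rule cmap_compose[OF A1(1)]) (auto intro!: prod_continuous_intros)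
  have \<zeta>b: "A1 (1, x) = c0" if "x \<in> ?dK" for x
    using that A1(3)[of 1 x] by (simp add: c0_def)
  have B1: "cmap ?L D (\<lambda>z. B (1, z))"
    by (rule cmap_compose[OF B(1)]) (auto intro!: prod_continuous_intros)
  have B1_0: "B (1, 0, x) = k c0" if "x \<in> ?K" for x
    using B(3)[of 1 "(0, x)"] bL_simps that by (simp add: A_def c0_def)
  have B1_1: "B (1, 1, x) = k (A1 (1, x))" if "x \<in> ?K" for x
    using B(3)[of 1 "(1, x)"] bL_simps that by (simp add: A_def)
  have B1_s: "B (1, p, x) = k c0" if "p \<in> ?I" "x \<in> ?dK" for p x
    using B(3)[of 1 "(p, x)"] bL_side that \<zeta>b by (simp add: A_def c0_def)
  obtain \<alpha>2 E where \<alpha>2: "cmap ?L C \<alpha>2"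
    "\<And>x. x \<in> ?K \<Longrightarrow> \<alpha>2 (0, x) = c0" "\<And>x. x \<in> ?K \<Longrightarrow> \<alpha>2 (1, x) = A1 (1, x)"
    "\<And>p x. p \<in> ?I \<Longrightarrow> x \<in> ?dK \<Longrightarrow> \<alpha>2 (p, x) = c0"
    and E: "cmap (?I \<times> ?L) D E"
    "\<And>z. z \<in> ?L \<Longrightarrow> E (0, z) = B (1, z)"
    "\<And>z. z \<in> ?L \<Longrightarrow> E (1, z) = k (\<alpha>2 z)"
    "\<And>t z. t \<in> ?I \<Longrightarrow> z \<in> ?bL \<Longrightarrow> E (t, z) = B (1, z)"
  proof (rule normalized_prism_lift[OF k c0 \<zeta> \<zeta>b B1 B1_0 B1_1 B1_s], goal_cases)
    case (6 a E) show thesis by (rule 6(1)[OF 6(2-)])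
  qed
  have \<alpha>2A: "A (1, z) = \<alpha>2 z" if "z \<in> ?bL" for z
    using that \<alpha>2 \<zeta>b dK by (auto simp: A_def prism_bdry_def c0_def)
  have rA: "cmap (?I \<times> ?bL) C (\<lambda>z. A (1 - fst z, snd z))"
    by (rule cmap_compose[OF A]) (auto intro!: prod_continuous_intros)
  \<comment> \<open>Runs the deformation of the boundary values backwards, starting at the lift of
    the normalized problem, so that the end \<open>A' (1, z)\<close> agrees with \<alpha> on the
    boundary.\<close>
  obtain A' where A': "cmap (?I \<times> ?L) C A'" "\<And>z. z \<in> ?L \<Longrightarrow> A' (0, z) = \<alpha>2 z"
    "\<And>s z. s \<in> ?I \<Longrightarrow> z \<in> ?bL \<Longrightarrow> A' (s, z) = A (1 - s, z)"
  proof (rule fill[OF cellL \<alpha>2(1) rA], goal_cases)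
    case (2 B) then show thesis by (intro 2(1)[of B]) simp_all
  qed (simp add: \<alpha>2A)
  have rB: "cmap (?I \<times> ?L) D (\<lambda>z. B (1 - fst z, snd z))"
    by (rule cmap_compose[OF B(1)]) (auto intro!: prod_continuous_intros)
  have rkA: "cmap (?I \<times> ?I \<times> ?bL) D (\<lambda>z. k (A (1 - fst z, snd (snd z))))"
    by (rule cmap_compose[OF kA]) (auto intro!: prod_continuous_intros)
  obtain F where F: "cmap (?I \<times> ?I \<times> ?L) D F"
    "\<And>s z. s \<in> ?I \<Longrightarrow> z \<in> ?L \<Longrightarrow> F (s, 0, z) = B (1 - s, z)"
    "\<And>s z. s \<in> ?I \<Longrightarrow> z \<in> ?L \<Longrightarrow> F (s, 1, z) = k (A' (s, z))"
    "\<And>t z. t \<in> ?I \<Longrightarrow> z \<in> ?L \<Longrightarrow> F (0, t, z) = E (t, z)"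
    "\<And>s t z. s \<in> ?I \<Longrightarrow> t \<in> ?I \<Longrightarrow> z \<in> ?bL \<Longrightarrow> F (s, t, z) = k (A (1 - s, z))"
  proof (rule fill_square[OF cellL rB cmap_post[OF A'(1) ck] E(1) rkA], goal_cases)
    case (6 B) then show thesis by (intro 6(1)[of B]) simp_all
  qed (simp_all add: E A' B bL)
  have P0: "cmap (?I \<times> ?L) D (\<lambda>z. B0 (1 - fst z, snd z))"
    by (rule cmap_compose[OF B0(1)]) (auto intro!: prod_continuous_intros)
  have P1: "cmap (?I \<times> ?L) D (\<lambda>z. k (A' (1, snd z)))"
    by (rule cmap_compose[OF cmap_post[OF A'(1) ck]]) (auto intro!: prod_continuous_intros)
  have Q: "cmap (?I \<times> ?L) D (\<lambda>z. F (1, z))"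
    by (rule cmap_compose[OF F(1)]) (auto intro!: prod_continuous_intros)
  \<comment> \<open>The homotopy \<open>F (1, t, z)\<close> runs from the end of \<open>B0\<close>
    to the lift and is stationary over the boundary. Composing it with \<open>B0\<close> would
    follow \<open>H\<close> and then pause there; the maximum interpolates between the pause at s =
    0 and \<open>H\<close> itself at s = 1.\<close>
  have R: "cmap (?I \<times> ?I \<times> ?bL) D (\<lambda>z. H (max (1 - fst z) (fst (snd z)), snd (snd z)))"
    by (rule cmap_compose[OF H]) (auto intro!: prod_continuous_intros continuous_on_max)
  obtain W where W: "cmap (?I \<times> ?I \<times> ?L) D W"
    "\<And>s z. s \<in> ?I \<Longrightarrow> z \<in> ?L \<Longrightarrow> W (s, 0, z) = B0 (1 - s, z)"
    "\<And>s z. s \<in> ?I \<Longrightarrow> z \<in> ?L \<Longrightarrow> W (s, 1, z) = k (A' (1, z))"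
    "\<And>t z. t \<in> ?I \<Longrightarrow> z \<in> ?L \<Longrightarrow> W (0, t, z) = F (1, t, z)"
    "\<And>s t z. s \<in> ?I \<Longrightarrow> t \<in> ?I \<Longrightarrow> z \<in> ?bL \<Longrightarrow> W (s, t, z) = H (max (1 - s) t, z)"
  proof (rule fill_square[OF cellL P0 P1 Q R], goal_cases)
    case (6 B) then show thesis by (intro 6(1)[of B]) simp_all
  qed (auto simp: F B B0 bL A' A0 H1 max_def)
  show "\<exists>\<alpha>' H'. cmap ?L C \<alpha>' \<and> (\<forall>x\<in>?bL. \<alpha>' x = \<alpha> x) \<and> cmap (?I \<times> ?L) D H' \<and>
          (\<forall>x\<in>?L. H' (0, x) = \<beta> x \<and> H' (1, x) = k (\<alpha>' x)) \<and>
          (\<forall>s\<in>?I. \<forall>x\<in>?bL. H' (s, x) = H (s, x))"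
  proof (intro exI[of _ "\<lambda>z. A' (1, z)"] exI[of _ "\<lambda>z. W (1, z)"] conjI ballI)
    show "cmap ?L C (\<lambda>z. A' (1, z))"
      by (rule cmap_compose[OF A'(1)]) (auto intro!: prod_continuous_intros)
    show "cmap (?I \<times> ?L) D (\<lambda>z. W (1, z))"
      by (rule cmap_compose[OF W(1)]) (auto intro!: prod_continuous_intros)
  qed (simp_all add: A' A0 W B0 max_def)
qed

lemma lift_prop_homeomorphic:
  assumes lp: "lift_prop K dK C D k" and e: "continuous_on K e" "e ` K = L" and e': "continuous_on L e'"
    and inv: "\<And>x. x \<in> K \<Longrightarrow> e' (e x) = x" and dL: "dL = e ` dK" and dK: "dK \<subseteq> K"
  shows "lift_prop L dL C D k"
  unfolding lift_prop_def
proof (intro allI impI, elim conjE)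
  let ?I = "{0..1::real}"
  fix \<alpha> \<beta> H
  assume \<alpha>: "cmap dL C \<alpha>" and \<beta>: "cmap L D \<beta>" and H: "cmap (?I \<times> dL) D H"
    and H01: "\<forall>z\<in>dL. H (0, z) = \<beta> z \<and> H (1, z) = k (\<alpha> z)"
  have e'L: "e' y \<in> K" "e (e' y) = y" if "y \<in> L" for y using that e(2) inv by auto
  have ed: "e x \<in> dL" if "x \<in> dK" for x using that dL by auto
  have e'd: "e' y \<in> dK" if "y \<in> dL" for y using that dL dK inv by auto
  have dLL: "y \<in> L" if "y \<in> dL" for y using that dL e dK by auto
  have c1: "cmap dK C (\<lambda>x. \<alpha> (e x))"
    by (rule cmap_compose[OF \<alpha> continuous_on_subset[OF e(1) dK]]) (use ed in auto)
  have c2: "cmap K D (\<lambda>x. \<beta> (e x))"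
    by (rule cmap_compose[OF \<beta> e(1)]) (use e in auto)
  have c3: "cmap (?I \<times> dK) D (\<lambda>z. H (fst z, e (snd z)))"
    by (rule cmap_compose[OF H])
      (use ed dK in \<open>auto intro!: prod_continuous_intros continuous_on_compose2[OF e(1)]\<close>)
  obtain \<alpha>' H' where *: "cmap K C \<alpha>'" "\<And>x. x \<in> dK \<Longrightarrow> \<alpha>' x = \<alpha> (e x)" "cmap (?I \<times> K) D H'"
    "\<And>x. x \<in> K \<Longrightarrow> H' (0, x) = \<beta> (e x)" "\<And>x. x \<in> K \<Longrightarrow> H' (1, x) = k (\<alpha>' x)"
    "\<And>s x. s \<in> ?I \<Longrightarrow> x \<in> dK \<Longrightarrow> H' (s, x) = H (s, e x)"
  proof (rule lift_propD[OF lp c1 c2 c3], goal_cases)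
    case (3 a B) then show thesis by (intro 3(1)[of a B]) simp_all
  qed (use H01 ed in auto)
  show "\<exists>\<alpha>' H'. cmap L C \<alpha>' \<and> (\<forall>x\<in>dL. \<alpha>' x = \<alpha> x) \<and> cmap (?I \<times> L) D H' \<and>
          (\<forall>x\<in>L. H' (0, x) = \<beta> x \<and> H' (1, x) = k (\<alpha>' x)) \<and>
          (\<forall>s\<in>?I. \<forall>x\<in>dL. H' (s, x) = H (s, x))"
  proof (intro exI[of _ "\<lambda>y. \<alpha>' (e' y)"] exI[of _ "\<lambda>z. H' (fst z, e' (snd z))"] conjI ballI)
    show "cmap L C (\<lambda>y. \<alpha>' (e' y))"
      by (rule cmap_compose[OF *(1) e']) (use e'L in auto)
    show "cmap (?I \<times> L) D (\<lambda>z. H' (fst z, e' (snd z)))"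
      by (rule cmap_compose[OF *(3)])
        (use e'L in \<open>auto intro!: prod_continuous_intros continuous_on_compose2[OF e']\<close>)
  qed (use * e'L e'd dLL in auto)
qed

text \<open>In positive dimension a cube is a prism over a smaller cube. In dimension 0 the boundary
  is empty and the property is surjectivity on path components.\<close>

lemma lift_prop_cube:
  assumes k: "weak_equivalence C D k"
  shows "lift_prop (unit_cube n) (cube_boundary n) C D k"
proof (cases n)
  case (Suc m)
  have "prism_bdry (unit_cube m) (cube_boundary m) \<subseteq> {0..1} \<times> unit_cube m"
    using cube_boundary_subset[of m] by (auto simp: prism_bdry_def)
  then show ?thesis unfolding Suc
    by (intro lift_prop_homeomorphic[OF lift_prop_prism[OF k] continuous_cube_join unit_cube_image
          continuous_cube_split[of _ m] _ cube_boundary_image]) (auto simp: cube_split_join)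
next
  case 0
  let ?o = "\<lambda>_::nat. 0::real" and ?I = "{0..1::real}"
  show ?thesis unfolding 0 lift_prop_def cube_boundary_0 unit_cube_0
  proof (intro allI impI, elim conjE)
    fix \<alpha> \<beta> H assume "cmap {?o} D \<beta>"
    then have "\<beta> ?o \<in> topspace D" by (auto dest: cmap_in)
    then obtain c where c: "c \<in> topspace C" "path_component_of D (\<beta> ?o) (k c)"
      using k path_component_of_sym unfolding weak_equivalence_iff by metis
    then obtain g where g: "cmap ?I D g" "g 0 = \<beta> ?o" "g 1 = k c"
      unfolding path_component_of_def pathin_def by blast
    have "cmap (?I \<times> {?o}) D (\<lambda>z. g (fst z))"
      by (rule cmap_compose[OF g(1)]) (auto intro!: prod_continuous_intros)
    then show "\<exists>\<alpha>' H'. cmap {?o} C \<alpha>' \<and> (\<forall>x\<in>{}. \<alpha>' x = \<alpha> x) \<and> cmap (?I \<times> {?o}) D H' \<and>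
          (\<forall>x\<in>{?o}. H' (0, x) = \<beta> x \<and> H' (1, x) = k (\<alpha>' x)) \<and>
          (\<forall>s\<in>?I. \<forall>x\<in>{}. H' (s, x) = H (s, x))"
      using g c by (intro exI[of _ "\<lambda>_. c"] exI[of _ "\<lambda>z. g (fst z)"]) auto
  qed
qed

text \<open>The right lifting property that, for cubes and their boundaries, characterises acyclic
  Serre fibrations. Unlike in \<open>lift_prop\<close>, the lift lies over \<beta> exactly.\<close>

definition strict_lift_prop :: "'b::topological_space set \<Rightarrow> 'b set \<Rightarrow> 'c topology \<Rightarrow> 'd topology \<Rightarrow> ('c \<Rightarrow> 'd) \<Rightarrow> bool" where
  "strict_lift_prop K dK X Y q \<longleftrightarrow>
    (\<forall>\<alpha> \<beta>. cmap dK X \<alpha> \<and> cmap K Y \<beta> \<and> (\<forall>x\<in>dK. \<beta> x = q (\<alpha> x)) \<longrightarrow>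
       (\<exists>\<alpha>'. cmap K X \<alpha>' \<and> (\<forall>x\<in>dK. \<alpha>' x = \<alpha> x) \<and> (\<forall>x\<in>K. q (\<alpha>' x) = \<beta> x)))"

lemma strict_lift_propD:
  assumes "strict_lift_prop K dK X Y q" "cmap dK X \<alpha>" "cmap K Y \<beta>" "\<And>x. x \<in> dK \<Longrightarrow> \<beta> x = q (\<alpha> x)"
  obtains \<alpha>' where "cmap K X \<alpha>'" "\<And>x. x \<in> dK \<Longrightarrow> \<alpha>' x = \<alpha> x" "\<And>x. x \<in> K \<Longrightarrow> q (\<alpha>' x) = \<beta> x"
  using assms unfolding strict_lift_prop_def by metis

text \<open>Lifting over cubes gives surjectivity on path components and homotopy groups. Lifting
  over prisms gives injectivity: a homotopy between the images of two spheroids is lifted with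
  prescribed ends and sides.\<close>

lemma weak_equivalence_strict_lift_prop:
  assumes q: "continuous_map X Y q"
    and cube: "\<And>n. strict_lift_prop (unit_cube n) (cube_boundary n) X Y q"
    and prism: "\<And>n. strict_lift_prop ({0..1} \<times> unit_cube n) (prism_bdry (unit_cube n) (cube_boundary n)) X Y q"
  shows "weak_equivalence X Y q"
  unfolding weak_equivalence_iff
proof (intro conjI ballI allI impI)
  let ?I = "{0..1::real}" and ?o = "\<lambda>_::nat. 0::real"
  show "continuous_map X Y q" by (rule q)
  have hom: "\<exists>H. cmap (?I \<times> unit_cube n) X H \<and> (\<forall>y\<in>unit_cube n. H (0, y) = \<gamma> y) \<and>
      (\<forall>y\<in>unit_cube n. H (1, y) = \<gamma>' y) \<and> (\<forall>s\<in>?I. \<forall>y\<in>cube_boundary n. H (s, y) = x)"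
    if \<gamma>: "cmap (unit_cube n) X \<gamma>" "\<And>y. y \<in> cube_boundary n \<Longrightarrow> \<gamma> y = x"
    and \<gamma>': "cmap (unit_cube n) X \<gamma>'" "\<And>y. y \<in> cube_boundary n \<Longrightarrow> \<gamma>' y = x" and x: "x \<in> topspace X"
    and G: "cmap (?I \<times> unit_cube n) Y G" "\<And>y. y \<in> unit_cube n \<Longrightarrow> G (0, y) = q (\<gamma> y)"
      "\<And>y. y \<in> unit_cube n \<Longrightarrow> G (1, y) = q (\<gamma>' y)"
      "\<And>s y. s \<in> ?I \<Longrightarrow> y \<in> cube_boundary n \<Longrightarrow> G (s, y) = q x"
    for n \<gamma> \<gamma>' x G
  proof -
    define \<alpha> where "\<alpha> = (\<lambda>(s::real, y). if s = 0 then \<gamma> y else if s = 1 then \<gamma>' y else x)"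
    have "cmap (prism_bdry (unit_cube n) (cube_boundary n)) X \<alpha>"
    proof (rule cmap_prism_bdry)
      show "cmap (unit_cube n) X (\<lambda>y. \<alpha> (0, y))" "cmap (unit_cube n) X (\<lambda>y. \<alpha> (1, y))"
        using \<gamma> \<gamma>' by (simp_all add: \<alpha>_def)
      show "cmap (?I \<times> cube_boundary n) X \<alpha>"
        by (rule cmap_cong[of _ _ "\<lambda>_. x"]) (use x \<gamma> \<gamma>' in \<open>auto simp: \<alpha>_def\<close>)
    qed (use cell_closed[OF cell_unit_cube] cell_closed_bdry[OF cell_unit_cube] in blast)+
    moreover have "G z = q (\<alpha> z)" if "z \<in> prism_bdry (unit_cube n) (cube_boundary n)" for z
      using that G \<gamma> \<gamma>' cube_boundary_subset[of n] by (auto simp: \<alpha>_def prism_bdry_def)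
    ultimately obtain H where H: "cmap (?I \<times> unit_cube n) X H"
      "\<And>z. z \<in> prism_bdry (unit_cube n) (cube_boundary n) \<Longrightarrow> H z = \<alpha> z"
      using strict_lift_propD[OF prism _ G(1)] by metis
    show ?thesis
      using H \<gamma> \<gamma>' by (intro exI[of _ H]) (auto simp: \<alpha>_def prism_bdry_def)
  qed
  show "path_component_of X x x'" if x: "x \<in> topspace X" "x' \<in> topspace X" "path_component_of Y (q x) (q x')" for x x'
  proof -
    obtain g where g: "cmap ?I Y g" "g 0 = q x" "g 1 = q x'"
      using x(3) unfolding path_component_of_def pathin_def by blast
    have "cmap (?I \<times> unit_cube 0) Y (\<lambda>z. g (fst z))"
      by (rule cmap_compose[OF g(1)]) (auto intro!: prod_continuous_intros)
    from hom[of 0 "\<lambda>_. x" x "\<lambda>_. x'", OF _ _ _ _ _ this] x g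
    obtain H where H: "cmap (?I \<times> unit_cube 0) X H" "H (0, ?o) = x" "H (1, ?o) = x'" by auto
    have "cmap ?I X (\<lambda>s. H (s, ?o))"
      by (rule cmap_compose[OF H(1)]) (auto intro!: prod_continuous_intros)
    then show ?thesis using H unfolding path_component_of_def pathin_def by blast
  qed
  show "\<exists>x\<in>topspace X. path_component_of Y (q x) y" if y: "y \<in> topspace Y" for y
  proof -
    obtain \<alpha> where "cmap (unit_cube 0) X \<alpha>" "\<And>z. z \<in> unit_cube 0 \<Longrightarrow> q (\<alpha> z) = y"
      using strict_lift_propD[OF cube[of 0], of "\<lambda>_. undefined" "\<lambda>_. y"] y by auto
    then show ?thesis
      using y by (intro bexI[of _ "\<alpha> ?o"]) (auto simp: path_component_of_refl dest: cmap_in)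
  qed
  show "(\<gamma>, \<gamma>') \<in> spheroid_rel n X x"
    if x: "x \<in> topspace X" and s: "\<gamma> \<in> spheroids n X x" "\<gamma>' \<in> spheroids n X x"
      and rel: "(q \<circ> \<gamma>, q \<circ> \<gamma>') \<in> spheroid_rel n Y (q x)" for n x \<gamma> \<gamma>'
  proof -
    obtain G where "cmap (?I \<times> unit_cube n) Y G" "\<And>y. y \<in> unit_cube n \<Longrightarrow> G (0, y) = q (\<gamma> y)"
      "\<And>y. y \<in> unit_cube n \<Longrightarrow> G (1, y) = q (\<gamma>' y)"
      "\<And>s y. s \<in> ?I \<Longrightarrow> y \<in> cube_boundary n \<Longrightarrow> G (s, y) = q x"
      using rel unfolding spheroid_rel_iff by auto
    from hom[OF spheroidsD[OF s(1)] spheroidsD[OF s(2)] x this]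
    show ?thesis unfolding spheroid_rel_iff by simp
  qed
next
  fix n x \<delta>
  assume x: "x \<in> topspace X" and \<delta>: "\<delta> \<in> spheroids n Y (q x)"
  obtain \<gamma> where \<gamma>: "cmap (unit_cube n) X \<gamma>" "\<And>z. z \<in> cube_boundary n \<Longrightarrow> \<gamma> z = x"
    "\<And>z. z \<in> unit_cube n \<Longrightarrow> q (\<gamma> z) = \<delta> z"
    using strict_lift_propD[OF cube[of n], of "\<lambda>_. x" \<delta>] x spheroidsD[OF \<delta>] by auto
  have "(\<delta>, \<delta>) \<in> spheroid_rel n Y (q x)"
    using equiv_class_self[OF equiv_spheroids \<delta>] by simp
  then have "(q \<circ> \<gamma>, \<delta>) \<in> spheroid_rel n Y (q x)"
    using \<gamma>(3) by (simp add: spheroid_rel_iff)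
  then show "\<exists>\<gamma>\<in>spheroids n X x. (q \<circ> \<gamma>, \<delta>) \<in> spheroid_rel n Y (q x)"
    using spheroidsI[OF \<gamma>(1,2)] by blast
qed

section \<open>Homotopy pullbacks\<close>

lemma topspace_compact_open:
  "topspace (compact_open K X) = {\<phi> \<in> extensional (topspace K). continuous_map K X \<phi>}"
proof -
  have "\<phi> \<in> topspace (compact_open K X)" if \<phi>: "\<phi> \<in> extensional (topspace K)" "continuous_map K X \<phi>" for \<phi>
    unfolding compact_open_def topology_generated_by_topspace
  proof (rule UnionI)
    \<comment> \<open>The subbasic set of the empty compact set and the empty open set imposes no
      condition, so it already contains every continuous map.\<close>
    show "{\<phi>. \<phi> \<in> extensional (topspace K) \<and> continuous_map K X \<phi> \<and> \<phi> ` {} \<subseteq> {}} \<in>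
       {{\<phi>. \<phi> \<in> extensional (topspace K) \<and> continuous_map K X \<phi> \<and> \<phi> ` C \<subseteq> U} |C U. compactin K C \<and> openin X U}"
      by (rule CollectI, rule exI[of _ "{}"], rule exI[of _ "{}"]) auto
  qed (use \<phi> in auto)
  then show ?thesis by (auto simp: compact_open_def)
qed

lemma openin_compact_open:
  assumes "compactin K C" "openin X U"
  shows "openin (compact_open K X) {\<phi>. \<phi> \<in> extensional (topspace K) \<and> continuous_map K X \<phi> \<and> \<phi> ` C \<subseteq> U}"
  unfolding compact_open_def by (rule topology_generated_by_Basis) (use assms in blast)

text \<open>Currying. The points z whose slice maps \<open>C\<close> into \<open>U\<close> form an
  open set by the tube lemma, here in the form that projection along a compact space is a closed
  map.\<close>

lemma continuous_map_into_compact_open: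
  assumes H: "continuous_map (prod_topology K Z) X H"
  shows "continuous_map Z (compact_open K X) (\<lambda>z. \<lambda>t\<in>topspace K. H (t, z))"
proof -
  let ?f = "\<lambda>z. \<lambda>t\<in>topspace K. H (t, z)"
  have f: "?f z \<in> extensional (topspace K)" "continuous_map K X (?f z)" if z: "z \<in> topspace Z" for z
  proof -
    have "continuous_map K X (\<lambda>t. H (t, z))"
      using continuous_map_compose[OF _ H, of K "\<lambda>t. (t, z)"] z
      by (simp add: o_def continuous_map_pairwise)
    then show "continuous_map K X (?f z)" by (rule continuous_map_eq) simp
  qed auto
  show ?thesis
    unfolding compact_open_def
  proof (rule continuous_on_generated_topo)
    fix G assume "G \<in> {{\<phi>. \<phi> \<in> extensional (topspace K) \<and> continuous_map K X \<phi> \<and> \<phi> ` C \<subseteq> U} |C U.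
        compactin K C \<and> openin X U}"
    then obtain C U where G: "G = {\<phi>. \<phi> \<in> extensional (topspace K) \<and> continuous_map K X \<phi> \<and> \<phi> ` C \<subseteq> U}"
      and C: "compactin K C" and U: "openin X U" by blast
    have CK: "C \<subseteq> topspace K" using C by (rule compactin_subset_topspace)
    let ?P = "prod_topology (subtopology K C) Z"
    have "continuous_map ?P X H"
      using continuous_map_from_subtopology[OF H, of "C \<times> topspace Z"]
      by (simp add: prod_topology_subtopology)
    then have "closedin ?P {w \<in> topspace ?P. H w \<in> topspace X - U}"
      using U by (intro closedin_continuous_map_preimage) auto
    moreover have "closed_map ?P Z snd"
      using C by (intro closed_map_snd) (simp add: compact_space_subtopology)
    ultimately have "closedin Z (snd ` {w \<in> topspace ?P. H w \<in> topspace X - U})"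
      by (auto simp: closed_map_def)
    then have "openin Z (topspace Z - snd ` {w \<in> topspace ?P. H w \<in> topspace X - U})" by blast
    moreover have "topspace Z - snd ` {w \<in> topspace ?P. H w \<in> topspace X - U} = ?f -` G \<inter> topspace Z"
    proof -
      have "H (t, z) \<in> topspace X" if "t \<in> C" "z \<in> topspace Z" for t z
        using H that CK by (auto simp: continuous_map_def)
      then show ?thesis
        using f CK unfolding G by (auto simp: image_iff image_subset_iff)
    qed
    ultimately show "openin Z (?f -` G \<inter> topspace Z)" by simp
  next
    have "?f ` topspace Z \<subseteq> topspace (compact_open K X)"
      unfolding topspace_compact_open using f by blast
    then show "?f ` topspace Z \<subseteq> \<Union> {{\<phi>. \<phi> \<in> extensional (topspace K) \<and> continuous_map K X \<phi> \<and> \<phi> ` C \<subseteq> U} |C U.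
        compactin K C \<and> openin X U}"
      by (simp only: compact_open_def topology_generated_by_topspace)
  qed
qed

text \<open>This uses that the interval is locally compact.\<close>

lemma continuous_map_compact_open_eval:
  fixes e :: "real \<Rightarrow> 'k::t2_space"
  assumes e: "continuous_on {0..1} e" "e ` {0..1} \<subseteq> S"
    and \<phi>: "continuous_map Z (compact_open (top_of_set S) X) \<phi>"
  shows "continuous_map (prod_topology (top_of_set {0..1}) Z) X (\<lambda>(s, z). \<phi> z (e s))"
  unfolding continuous_map_alt
proof (intro conjI allI impI)
  have \<phi>z: "cmap S X (\<phi> z)" if "z \<in> topspace Z" for z
    using \<phi> that by (auto simp: continuous_map_def[of Z] topspace_compact_open)
  show "(\<lambda>(s, z). \<phi> z (e s)) \<in> topspace (prod_topology (top_of_set {0..1}) Z) \<rightarrow> topspace X"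
    using cmap_in[OF \<phi>z] e by auto
  fix U assume U: "openin X U"
  show "openin (prod_topology (top_of_set {0..1}) Z)
     ((\<lambda>(s, z). \<phi> z (e s)) -` U \<inter> topspace (prod_topology (top_of_set {0..1}) Z))"
    unfolding openin_prod_topology_alt
  proof (intro allI impI)
    fix s0 z0
    assume "(s0, z0) \<in> (\<lambda>(s, z). \<phi> z (e s)) -` U \<inter> topspace (prod_topology (top_of_set {0..1}) Z)"
    then have s0: "s0 \<in> {0..1}" and z0: "z0 \<in> topspace Z" and U0: "\<phi> z0 (e s0) \<in> U" by auto
    have "cmap {0..1} X (\<lambda>s. \<phi> z0 (e s))" by (rule cmap_compose[OF \<phi>z[OF z0] e])
    then have "openin (top_of_set {0..1}) {s \<in> {0..1}. \<phi> z0 (e s) \<in> U}"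
      using U by (auto simp: continuous_map_def)
    then obtain \<epsilon> where \<epsilon>: "\<epsilon> > 0" "ball s0 \<epsilon> \<inter> {0..1} \<subseteq> {s \<in> {0..1}. \<phi> z0 (e s) \<in> U}"
      using s0 U0 by (auto simp: openin_contains_ball)
    let ?C = "cball s0 (\<epsilon> / 2) \<inter> {0..1}"
    have C: "?C \<subseteq> ball s0 \<epsilon> \<inter> {0..1}" using \<epsilon>(1) by auto
    have "compact (e ` ?C)"
      by (intro compact_continuous_image continuous_on_subset[OF e(1)] compact_Int) auto
    then have "compactin (top_of_set S) (e ` ?C)"
      using e by (auto simp: compactin_subtopology)
    from openin_compact_open[OF this U] \<phi>
    have V: "openin Z {z \<in> topspace Z. \<phi> z \<in> {\<phi>. \<phi> \<in> extensional (topspace (top_of_set S)) \<and> cmap S X \<phi> \<and> \<phi> ` (e ` ?C) \<subseteq> U}}"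
      (is "openin Z ?V") by (auto simp: continuous_map_def)
    have "z0 \<in> ?V"
      using z0 C \<epsilon>(2) \<phi> \<phi>z by (auto simp: continuous_map_def[of Z] topspace_compact_open)
    moreover have "openin (top_of_set {0..1}) (ball s0 (\<epsilon> / 2) \<inter> {0..1})"
      by (metis Int_commute open_ball openin_open_Int)
    moreover have "s0 \<in> ball s0 (\<epsilon> / 2) \<inter> {0..1}" using s0 \<epsilon>(1) by simp
    moreover have "(ball s0 (\<epsilon> / 2) \<inter> {0..1}) \<times> ?V \<subseteq>
       (\<lambda>(s, z). \<phi> z (e s)) -` U \<inter> topspace (prod_topology (top_of_set {0..1}) Z)"
      by (auto simp: image_subset_iff)
    ultimately show "\<exists>Ua V. openin (top_of_set {0..1}) Ua \<and> openin Z V \<and> s0 \<in> Ua \<and> z0 \<in> V \<and>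
      Ua \<times> V \<subseteq> (\<lambda>(s, z). \<phi> z (e s)) -` U \<inter> topspace (prod_topology (top_of_set {0..1}) Z)"
      using V by blast
  qed
qed

lemma continuous_map_compact_open_eval_point:
  fixes t :: "'k::t2_space"
  assumes t: "t \<in> S" and \<phi>: "continuous_map Z (compact_open (top_of_set S) X) \<phi>"
  shows "continuous_map Z X (\<lambda>z. \<phi> z t)"
proof -
  have "continuous_map Z (prod_topology (top_of_set {0..1}) Z) (\<lambda>z. (0::real, z))"
    by (simp add: continuous_map_pairwise o_def)
  from continuous_map_compose[OF this continuous_map_compact_open_eval[of "\<lambda>_. t" S Z X \<phi>]]
  show ?thesis using t \<phi> by (simp add: o_def image_subset_iff)
qed

section \<open>Explicit coordinates on the homotopy pullback\<close>

definition edge_pt :: "real \<Rightarrow> nat \<Rightarrow> real" where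
  "edge_pt s = (\<lambda>i. if i = 0 then 1 - s else if i = 1 then s else 0)"

lemma edge_pt_1 [simp]: "edge_pt s (Suc 0) = s"
  by (simp add: edge_pt_def)

lemma continuous_edge_pt: "continuous_on S edge_pt"
proof (rule continuous_on_coordinatewise_then_product)
  show "continuous_on S (\<lambda>s. edge_pt s i)" for i
    by (cases "i = 0"; cases "i = 1") (auto simp: edge_pt_def intro!: continuous_intros)
qed

lemma simplex_on_singleton: "simplex_on {i} = {\<lambda>j. if j = i then 1 else 0}"
  by (auto simp: simplex_on_def fun_eq_iff)

lemma simplex_on_0: "simplex_on {0} = {edge_pt 0}"
  by (auto simp: simplex_on_singleton edge_pt_def fun_eq_iff)

lemma simplex_on_1: "simplex_on {Suc 0} = {edge_pt 1}"
  by (auto simp: simplex_on_singleton edge_pt_def fun_eq_iff)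

lemma simplex_on_01: "simplex_on {0, Suc 0} = edge_pt ` {0..1}"
proof
  show "edge_pt ` {0..1} \<subseteq> simplex_on {0, Suc 0}"
    by (auto simp: simplex_on_def edge_pt_def)
  show "simplex_on {0, Suc 0} \<subseteq> edge_pt ` {0..1}"
  proof
    fix t assume t: "t \<in> simplex_on {0, Suc 0}"
    then have s: "t 0 + t (Suc 0) = 1" "0 \<le> t 0" "0 \<le> t (Suc 0)" by (auto simp: simplex_on_def)
    have "t = edge_pt (t (Suc 0))"
      using t s by (auto simp: simplex_on_def edge_pt_def fun_eq_iff)
    then show "t \<in> edge_pt ` {0..1}" using s by auto
  qed
qed

lemma punctured_1: "punctured (Suc 0) = {{0}}"
  by (auto simp: punctured_def)

lemma punctured_2: "punctured 2 = {{0}, {Suc 0}, {0, Suc 0}}"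
proof -
  have "{..<2::nat} = {0, Suc 0}" by auto
  then show ?thesis unfolding punctured_def by auto
qed

text \<open>The Bousfield-Kan form of a triple (b, c, l). The path is parametrised by the
  barycentric coordinate of the vertex 1, so it starts over b and ends over c; the triple lies in
  the limit only if these ends are \<open>h b\<close> and \<open>k c\<close>.\<close>

definition holim_pt :: "'a \<Rightarrow> 'a \<Rightarrow> (real \<Rightarrow> 'a) \<Rightarrow> nat set \<Rightarrow> (nat \<Rightarrow> real) \<Rightarrow> 'a" where
  "holim_pt b c l = (\<lambda>S\<in>punctured 2. \<lambda>t\<in>simplex_on S. if S = {0} then b else if S = {Suc 0} then c else l (t (Suc 0)))"

lemma holim_pt_cong:
  "(\<And>s. s \<in> {0..1} \<Longrightarrow> l s = l' s) \<Longrightarrow> holim_pt b c l = holim_pt b c l'"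
  by (auto simp: holim_pt_def fun_eq_iff punctured_2 simplex_on_01)

locale square_diagram =
  fixes \<X> :: "'a cube" and B C D f g h k
  assumes cube: "is_cube 2 \<X>"
    and B_def: "B = vertex \<X> {0}" and C_def: "C = vertex \<X> {Suc 0}" and D_def: "D = vertex \<X> {0, Suc 0}"
    and f_def: "f = edge \<X> {} {0}" and g_def: "g = edge \<X> {} {Suc 0}"
    and h_def: "h = edge \<X> {0} {0, Suc 0}" and k_def: "k = edge \<X> {Suc 0} {0, Suc 0}"
begin

abbreviation "A \<equiv> vertex \<X> {}"
abbreviation "P \<equiv> punctured_holim 2 \<X>"

lemma edge_continuous: "S \<subseteq> T \<Longrightarrow> T \<subseteq> {0, Suc 0} \<Longrightarrow> continuous_map (vertex \<X> S) (vertex \<X> T) (edge \<X> S T)"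
proof -
  have "{..<2::nat} = {0, Suc 0}" by auto
  then show "S \<subseteq> T \<Longrightarrow> T \<subseteq> {0, Suc 0} \<Longrightarrow> continuous_map (vertex \<X> S) (vertex \<X> T) (edge \<X> S T)"
    using cube unfolding is_cube_def by auto
qed

lemma edge_id: "S \<subseteq> {0, Suc 0} \<Longrightarrow> x \<in> topspace (vertex \<X> S) \<Longrightarrow> edge \<X> S S x = x"
proof -
  have "{..<2::nat} = {0, Suc 0}" by auto
  then show "S \<subseteq> {0, Suc 0} \<Longrightarrow> x \<in> topspace (vertex \<X> S) \<Longrightarrow> edge \<X> S S x = x"
    using cube unfolding is_cube_def by auto
qed

lemma edge_trans: "R \<subseteq> S \<Longrightarrow> S \<subseteq> T \<Longrightarrow> T \<subseteq> {0, Suc 0} \<Longrightarrow> x \<in> topspace (vertex \<X> R) \<Longrightarrow>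
   edge \<X> R T x = edge \<X> S T (edge \<X> R S x)"
proof -
  have "{..<2::nat} = {0, Suc 0}" by auto
  then show "R \<subseteq> S \<Longrightarrow> S \<subseteq> T \<Longrightarrow> T \<subseteq> {0, Suc 0} \<Longrightarrow> x \<in> topspace (vertex \<X> R) \<Longrightarrow>
   edge \<X> R T x = edge \<X> S T (edge \<X> R S x)"
    using cube unfolding is_cube_def by auto
qed

lemma continuous: "continuous_map A B f" "continuous_map A C g" "continuous_map B D h" "continuous_map C D k"
  unfolding B_def C_def D_def f_def g_def h_def k_def by (rule edge_continuous; auto)+

lemma commutes: "a \<in> topspace A \<Longrightarrow> h (f a) = k (g a)"
  unfolding f_def g_def h_def k_def
  using edge_trans[of "{}" "{0}" "{0, Suc 0}" a] edge_trans[of "{}" "{Suc 0}" "{0, Suc 0}" a] by auto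

lemma to_holim_eq: "a \<in> topspace A \<Longrightarrow> to_holim 2 \<X> a = holim_pt (f a) (g a) (\<lambda>_. h (f a))"
  using edge_trans[of "{}" "{0}" "{0, Suc 0}" a]
  by (auto simp: to_holim_def holim_pt_def punctured_2 f_def g_def h_def fun_eq_iff)

text \<open>The universal property of the homotopy pullback; \<open>holim_components\<close> is the
  converse direction. Together they allow later arguments to speak of points and paths instead of
  families of maps on simplices.\<close>

lemma continuous_map_holim_pt:
  assumes b: "continuous_map Z B b" and c: "continuous_map Z C c"
    and H: "continuous_map (prod_topology (top_of_set {0..1}) Z) D H"
    and H0: "\<And>z. z \<in> topspace Z \<Longrightarrow> H (0, z) = h (b z)" and H1: "\<And>z. z \<in> topspace Z \<Longrightarrow> H (1, z) = k (c z)"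
  shows "continuous_map Z P (\<lambda>z. holim_pt (b z) (c z) (\<lambda>s. H (s, z)))"
proof -
  let ?\<phi> = "\<lambda>z. holim_pt (b z) (c z) (\<lambda>s. H (s, z))"
  have const: "continuous_map (prod_topology (top_of_set (simplex_on S)) Z) Y (\<lambda>w. u (snd w))"
    if "continuous_map Z Y u" for S u and Y :: "'a topology"
    using continuous_map_compose[OF continuous_map_snd that, of "top_of_set (simplex_on S)"] by (simp add: o_def)
  have c1: "continuous_map Z (compact_open (top_of_set (simplex_on S)) (vertex \<X> S)) (\<lambda>z. ?\<phi> z S)"
    if "S \<in> punctured 2" for S
  proof -
    consider "S = {0}" | "S = {Suc 0}" | "S = {0, Suc 0}" using \<open>S \<in> punctured 2\<close> punctured_2 by auto
    then show ?thesis
    proof cases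
      case 1
      then show ?thesis
        using continuous_map_into_compact_open[OF const[OF b], of S] that
        by (simp add: holim_pt_def B_def punctured_2)
    next
      case 2
      then show ?thesis
        using continuous_map_into_compact_open[OF const[OF c], of S] that
        by (simp add: holim_pt_def C_def punctured_2)
    next
      case 3
      have "continuous_on (simplex_on S) (\<lambda>t. t (Suc 0))"
        by (rule continuous_on_product_then_coordinatewise[OF continuous_on_id])
      then have "continuous_map (top_of_set (simplex_on S)) (top_of_set {0..1}) (\<lambda>t. t (Suc 0))"
        using 3 by (auto simp: simplex_on_01)
      from continuous_map_compose[OF continuous_map_fst this, of Z]
      have "continuous_map (prod_topology (top_of_set (simplex_on S)) Z) (prod_topology (top_of_set {0..1}) Z)
         (\<lambda>w. (fst w (Suc 0), snd w))"
        unfolding continuous_map_pairwise o_def fst_conv snd_conv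
        by (intro conjI continuous_map_snd)
      from continuous_map_into_compact_open[OF continuous_map_compose[OF this H]]
      show ?thesis using 3 that by (simp add: holim_pt_def D_def punctured_2 o_def doubleton_eq_iff)
    qed
  qed
  have c2: "?\<phi> z T t = edge \<X> S T (?\<phi> z S t)"
    if z: "z \<in> topspace Z" and ST: "S \<in> punctured 2" "T \<in> punctured 2" "S \<subseteq> T" "t \<in> simplex_on S" for z S T t
  proof -
    have bz: "b z \<in> topspace B" and cz: "c z \<in> topspace C"
      using b c z by (auto simp: continuous_map_def)
    have Hz: "H (s, z) \<in> topspace D" if "s \<in> {0..1}" for s
      using H z that by (auto simp: continuous_map_def)
    have "S \<noteq> T \<Longrightarrow> T = {0, Suc 0} \<and> (S = {0} \<or> S = {Suc 0})"
      using ST punctured_2 by auto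
    then consider "S = T" "S = {0}" | "S = T" "S = {Suc 0}" | "S = T" "S = {0, Suc 0}"
      | "S = {0}" "T = {0, Suc 0}" | "S = {Suc 0}" "T = {0, Suc 0}"
      using ST(1) punctured_2 by blast
    then show ?thesis
    proof cases
      case 4
      then have "t = edge_pt 0" "edge_pt 0 \<in> simplex_on {0, Suc 0}" using ST by (auto simp: simplex_on_0 simplex_on_01)
      then show ?thesis using 4 H0[OF z] by (simp add: holim_pt_def punctured_2 h_def doubleton_eq_iff simplex_on_0)
    next
      case 5
      then have "t = edge_pt 1" "edge_pt 1 \<in> simplex_on {0, Suc 0}" using ST by (auto simp: simplex_on_1 simplex_on_01)
      then show ?thesis using 5 H1[OF z] by (simp add: holim_pt_def punctured_2 k_def doubleton_eq_iff simplex_on_1)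
    qed (use ST bz cz Hz in \<open>auto simp: holim_pt_def punctured_2 B_def C_def D_def edge_id simplex_on_01\<close>)
  qed
  have c3: "?\<phi> z \<in> extensional (punctured 2)" for z by (simp add: holim_pt_def)
  have "continuous_map Z (product_topology (\<lambda>S. compact_open (top_of_set (simplex_on S)) (vertex \<X> S)) (punctured 2)) ?\<phi>"
    unfolding continuous_map_componentwise using c1 c3 by blast
  then show ?thesis
    unfolding punctured_holim_def continuous_map_in_subtopology using c2 by blast
qed

lemma holim_components:
  "continuous_map P B (\<lambda>\<phi>. \<phi> {0} (edge_pt 0))" "continuous_map P C (\<lambda>\<phi>. \<phi> {Suc 0} (edge_pt 1))"
  "continuous_map (prod_topology (top_of_set {0..1}) P) D (\<lambda>(s, \<phi>). \<phi> {0, Suc 0} (edge_pt s))"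
proof -
  have "continuous_map P (compact_open (top_of_set (simplex_on S)) (vertex \<X> S)) (\<lambda>\<phi>. \<phi> S)" if "S \<in> punctured 2" for S
    unfolding punctured_holim_def using that
    by (intro continuous_map_from_subtopology continuous_map_product_projection)
  then have "continuous_map P (compact_open (top_of_set (simplex_on {0})) B) (\<lambda>\<phi>. \<phi> {0})"
    "continuous_map P (compact_open (top_of_set (simplex_on {Suc 0})) C) (\<lambda>\<phi>. \<phi> {Suc 0})"
    "continuous_map P (compact_open (top_of_set (simplex_on {0, Suc 0})) D) (\<lambda>\<phi>. \<phi> {0, Suc 0})"
    by (auto simp: B_def C_def D_def punctured_2)
  note this[THEN continuous_map_compact_open_eval_point[rotated]] continuous_map_compact_open_eval[OF _ _ this(3)]
  then show "continuous_map P B (\<lambda>\<phi>. \<phi> {0} (edge_pt 0))" "continuous_map P C (\<lambda>\<phi>. \<phi> {Suc 0} (edge_pt 1))"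
  "continuous_map (prod_topology (top_of_set {0..1}) P) D (\<lambda>(s, \<phi>). \<phi> {0, Suc 0} (edge_pt s))"
    by (auto simp: simplex_on_0 simplex_on_1 simplex_on_01 continuous_edge_pt)
qed

lemma holim_ends:
  assumes "\<phi> \<in> topspace P"
  shows "\<phi> {0, Suc 0} (edge_pt 0) = h (\<phi> {0} (edge_pt 0))" "\<phi> {0, Suc 0} (edge_pt 1) = k (\<phi> {Suc 0} (edge_pt 1))"
  using assms by (auto simp: punctured_holim_def punctured_2 h_def k_def simplex_on_0 simplex_on_1)

lemma holim_pt_eta:
  assumes "\<phi> \<in> topspace P"
  shows "holim_pt (\<phi> {0} (edge_pt 0)) (\<phi> {Suc 0} (edge_pt 1)) (\<lambda>s. \<phi> {0, Suc 0} (edge_pt s)) = \<phi>"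
proof (rule ext)
  fix S
  have ext: "\<phi> \<in> extensional (punctured 2)" "\<And>S. S \<in> punctured 2 \<Longrightarrow> \<phi> S \<in> extensional (simplex_on S)"
    using assms by (auto simp: punctured_holim_def topspace_compact_open PiE_def)
  show "holim_pt (\<phi> {0} (edge_pt 0)) (\<phi> {Suc 0} (edge_pt 1)) (\<lambda>s. \<phi> {0, Suc 0} (edge_pt s)) S = \<phi> S"
  proof (cases "S \<in> punctured 2")
    case False then show ?thesis using ext(1) by (simp add: holim_pt_def extensional_def)
  next
    case True
    show ?thesis
    proof (rule extensionalityI[OF _ ext(2)[OF True]])
      show "holim_pt (\<phi> {0} (edge_pt 0)) (\<phi> {Suc 0} (edge_pt 1)) (\<lambda>s. \<phi> {0, Suc 0} (edge_pt s)) S t = \<phi> S t"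
        if "t \<in> simplex_on S" for t
        using True that
        by (auto simp: holim_pt_def punctured_2 simplex_on_0 simplex_on_1 simplex_on_01 doubleton_eq_iff)
    qed (simp add: holim_pt_def True)
  qed
qed

lemma holim_pt_proj [simp]:
  "holim_pt b c l {0} (edge_pt 0) = b" "holim_pt b c l {Suc 0} (edge_pt 1) = c"
  "s \<in> {0..1} \<Longrightarrow> holim_pt b c l {0, Suc 0} (edge_pt s) = l s"
  by (auto simp: holim_pt_def punctured_2 simplex_on_0 simplex_on_1 simplex_on_01 doubleton_eq_iff)

end

section \<open>Cartesian squares with a pair of opposite weak equivalences\<close>

context square_diagram
begin

text \<open>A lift of \<beta> consists of a map to \<open>C\<close> and a homotopy in
  \<open>D\<close> from \<open>h \<circ> \<beta>\<close> to its image under \<open>k\<close>, both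
  prescribed over the boundary. This is exactly what \<open>lift_prop\<close> for \<open>k\<close>
  provides; the homotopy becomes part of the point, which is why the lift is strict.\<close>

lemma proj1_strict_lift_prop:
  assumes lp: "lift_prop K dK C D k"
  shows "strict_lift_prop K dK P B (\<lambda>\<phi>. \<phi> {0} (edge_pt 0))"
  unfolding strict_lift_prop_def
proof (intro allI impI, elim conjE)
  fix \<alpha> \<beta> assume \<alpha>: "cmap dK P \<alpha>" and \<beta>: "cmap K B \<beta>" and \<alpha>\<beta>: "\<forall>x\<in>dK. \<beta> x = \<alpha> x {0} (edge_pt 0)"
  have c: "cmap dK C (\<lambda>x. \<alpha> x {Suc 0} (edge_pt 1))"
    by (rule cmap_post[OF \<alpha> holim_components(2)])
  have "continuous_map (prod_topology (top_of_set {0..1}) (top_of_set dK)) (prod_topology (top_of_set {0..1}) P)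
      (\<lambda>z. (fst z, \<alpha> (snd z)))"
    unfolding continuous_map_pairwise o_def fst_conv snd_conv
    by (intro conjI continuous_map_fst continuous_map_compose[OF continuous_map_snd \<alpha>, unfolded o_def])
  from continuous_map_compose[OF this holim_components(3)]
  have H: "cmap ({0..1} \<times> dK) D (\<lambda>z. \<alpha> (snd z) {0, Suc 0} (edge_pt (fst z)))"
    by (simp add: o_def case_prod_unfold)
  have \<alpha>P: "\<alpha> x \<in> topspace P" if "x \<in> dK" for x using \<alpha> that by (rule cmap_in)
  obtain c' H' where *: "cmap K C c'" "\<And>x. x \<in> dK \<Longrightarrow> c' x = \<alpha> x {Suc 0} (edge_pt 1)"
    "cmap ({0..1::real} \<times> K) D H'" "\<And>x. x \<in> K \<Longrightarrow> H' (0, x) = h (\<beta> x)" "\<And>x. x \<in> K \<Longrightarrow> H' (1, x) = k (c' x)"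
    "\<And>s x. s \<in> {0..1} \<Longrightarrow> x \<in> dK \<Longrightarrow> H' (s, x) = \<alpha> x {0, Suc 0} (edge_pt s)"
  proof (rule lift_propD[OF lp c cmap_post[OF \<beta> continuous(3)] H], goal_cases)
    case (3 a B) then show thesis by (intro 3(1)[of a B]) simp_all
  qed (use \<alpha>\<beta> holim_ends[OF \<alpha>P] in auto)
  let ?\<alpha>' = "\<lambda>x. holim_pt (\<beta> x) (c' x) (\<lambda>s. H' (s, x))"
  show "\<exists>\<alpha>'. cmap K P \<alpha>' \<and> (\<forall>x\<in>dK. \<alpha>' x = \<alpha> x) \<and> (\<forall>x\<in>K. \<alpha>' x {0} (edge_pt 0) = \<beta> x)"
  proof (intro exI[of _ ?\<alpha>'] conjI ballI)
    show "cmap K P ?\<alpha>'"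
      by (rule continuous_map_holim_pt) (use \<beta> * in simp_all)
    show "?\<alpha>' x = \<alpha> x" if x: "x \<in> dK" for x
    proof -
      have "?\<alpha>' x = holim_pt (\<beta> x) (c' x) (\<lambda>s. \<alpha> x {0, Suc 0} (edge_pt s))"
        by (rule holim_pt_cong) (use * x in simp)
      then show ?thesis using holim_pt_eta[OF \<alpha>P[OF x]] x \<alpha>\<beta> * by simp
    qed
  qed simp
qed

text \<open>Mirror image of the case of \<open>k\<close>. Paths in the homotopy pullback run from
  the \<open>h\<close> end to the \<open>k\<close> end, so they are reversed before and after
  \<open>lift_prop\<close> is applied to \<open>h\<close>.\<close>

lemma proj2_strict_lift_prop:
  assumes lp: "lift_prop K dK B D h"
  shows "strict_lift_prop K dK P C (\<lambda>\<phi>. \<phi> {Suc 0} (edge_pt 1))"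
  unfolding strict_lift_prop_def
proof (intro allI impI, elim conjE)
  fix \<alpha> \<beta> assume \<alpha>: "cmap dK P \<alpha>" and \<beta>: "cmap K C \<beta>" and \<alpha>\<beta>: "\<forall>x\<in>dK. \<beta> x = \<alpha> x {Suc 0} (edge_pt 1)"
  have b: "cmap dK B (\<lambda>x. \<alpha> x {0} (edge_pt 0))"
    by (rule cmap_post[OF \<alpha> holim_components(1)])
  have "cmap ({0..1::real} \<times> dK) (top_of_set {0..1}) (\<lambda>z. 1 - fst z)"
    by (auto intro!: prod_continuous_intros)
  then have "continuous_map (prod_topology (top_of_set {0..1::real}) (top_of_set dK)) (prod_topology (top_of_set {0..1::real}) P)
      (\<lambda>z. (1 - fst z, \<alpha> (snd z)))"
    unfolding continuous_map_pairwise o_def fst_conv snd_conv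
    by (intro conjI continuous_map_compose[OF continuous_map_snd \<alpha>, unfolded o_def]) simp
  from continuous_map_compose[OF this holim_components(3)]
  have H: "cmap ({0..1} \<times> dK) D (\<lambda>z. \<alpha> (snd z) {0, Suc 0} (edge_pt (1 - fst z)))"
    by (simp add: o_def case_prod_unfold)
  have \<alpha>P: "\<alpha> x \<in> topspace P" if "x \<in> dK" for x using \<alpha> that by (rule cmap_in)
  obtain b' H' where *: "cmap K B b'" "\<And>x. x \<in> dK \<Longrightarrow> b' x = \<alpha> x {0} (edge_pt 0)"
    "cmap ({0..1::real} \<times> K) D H'" "\<And>x. x \<in> K \<Longrightarrow> H' (0, x) = k (\<beta> x)" "\<And>x. x \<in> K \<Longrightarrow> H' (1, x) = h (b' x)"
    "\<And>s x. s \<in> {0..1} \<Longrightarrow> x \<in> dK \<Longrightarrow> H' (s, x) = \<alpha> x {0, Suc 0} (edge_pt (1 - s))"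
  proof (rule lift_propD[OF lp b cmap_post[OF \<beta> continuous(4)] H], goal_cases)
    case (3 a B) then show thesis by (intro 3(1)[of a B]) simp_all
  qed (use \<alpha>\<beta> holim_ends[OF \<alpha>P] in auto)
  have H'r: "cmap ({0..1} \<times> K) D (\<lambda>z. H' (1 - fst z, snd z))"
    by (rule cmap_compose[OF *(3)]) (auto intro!: prod_continuous_intros)
  let ?\<alpha>' = "\<lambda>x. holim_pt (b' x) (\<beta> x) (\<lambda>s. H' (1 - s, x))"
  show "\<exists>\<alpha>'. cmap K P \<alpha>' \<and> (\<forall>x\<in>dK. \<alpha>' x = \<alpha> x) \<and> (\<forall>x\<in>K. \<alpha>' x {Suc 0} (edge_pt 1) = \<beta> x)"
  proof (intro exI[of _ ?\<alpha>'] conjI ballI)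
    show "cmap K P ?\<alpha>'"
      using continuous_map_holim_pt[of "top_of_set K" b' \<beta> "\<lambda>z. H' (1 - fst z, snd z)"] \<beta> * H'r by simp
    show "?\<alpha>' x = \<alpha> x" if x: "x \<in> dK" for x
    proof -
      have "?\<alpha>' x = holim_pt (b' x) (\<beta> x) (\<lambda>s. \<alpha> x {0, Suc 0} (edge_pt s))"
        by (rule holim_pt_cong) (use *(6)[of "1 - _"] x in simp)
      then show ?thesis using holim_pt_eta[OF \<alpha>P[OF x]] x \<alpha>\<beta> * by simp
    qed
  qed simp
qed

lemma continuous_to_holim: "continuous_map A P (to_holim 2 \<X>)"
proof (rule continuous_map_eq)
  have "continuous_map (prod_topology (top_of_set {0..1::real}) A) D (\<lambda>z. h (f (snd z)))"
    using continuous_map_compose[OF continuous_map_snd continuous_map_compose[OF continuous(1,3)]] by (simp add: o_def)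
  from continuous_map_holim_pt[OF continuous(1,2) this]
  show "continuous_map A P (\<lambda>a. holim_pt (f a) (g a) (\<lambda>_. h (f a)))"
    by (simp add: commutes)
qed (simp add: to_holim_eq)

text \<open>Two out of three for the comparison map followed by the projection
  \<open>q\<close>.\<close>

lemma cartesian_iff_weak_equivalence:
  assumes q: "weak_equivalence P Y q" and eq: "\<And>a. a \<in> topspace A \<Longrightarrow> (q \<circ> to_holim 2 \<X>) a = u a"
  shows "cartesian 2 \<X> \<longleftrightarrow> weak_equivalence A Y u"
proof
  assume "cartesian 2 \<X>"
  then show "weak_equivalence A Y u"
    using weak_equivalence_cong[OF weak_equivalence_compose[OF _ q] eq] by (simp add: cartesian_def)
next
  assume u: "weak_equivalence A Y u"
  show "cartesian 2 \<X>" unfolding cartesian_def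
    by (rule weak_equivalence_cancel[OF continuous_to_holim q weak_equivalence_cong[OF u eq[symmetric]]])
qed

lemma cartesian_iff_weak_equivalence1:
  assumes "weak_equivalence C D k" shows "cartesian 2 \<X> \<longleftrightarrow> weak_equivalence A B f"
proof (rule cartesian_iff_weak_equivalence)
  show "weak_equivalence P B (\<lambda>\<phi>. \<phi> {0} (edge_pt 0))"
    by (intro weak_equivalence_strict_lift_prop holim_components proj1_strict_lift_prop
        lift_prop_cube[OF assms] lift_prop_prism[OF assms])
qed (simp add: to_holim_eq)

lemma cartesian_iff_weak_equivalence2:
  assumes "weak_equivalence B D h" shows "cartesian 2 \<X> \<longleftrightarrow> weak_equivalence A C g"
proof (rule cartesian_iff_weak_equivalence)
  show "weak_equivalence P C (\<lambda>\<phi>. \<phi> {Suc 0} (edge_pt 1))"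
    by (intro weak_equivalence_strict_lift_prop holim_components proj2_strict_lift_prop
        lift_prop_cube[OF assms] lift_prop_prism[OF assms])
qed (simp add: to_holim_eq)

end

text \<open>The punctured poset has the single element {0}, and its simplex is a point. So the
  homotopy limit is a copy of the target, and evaluation at that point is a homeomorphism.\<close>

lemma cartesian_1_iff:
  assumes cube: "is_cube 1 \<X>"
  shows "cartesian 1 \<X> \<longleftrightarrow> weak_equivalence (vertex \<X> {}) (vertex \<X> {0}) (edge \<X> {} {0})"
proof -
  let ?P = "punctured_holim 1 \<X>" and ?Y = "vertex \<X> {0}" and ?f = "edge \<X> {} {0}"
  let ?e = "\<lambda>y. \<lambda>S\<in>punctured 1. \<lambda>t\<in>simplex_on S. y" and ?p = "\<lambda>\<phi>. \<phi> {0} (edge_pt 0)"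
  let ?T = "product_topology (\<lambda>S. compact_open (top_of_set (simplex_on S)) (vertex \<X> S)) (punctured 1)"
  have id: "edge \<X> {0} {0} x = x" if "x \<in> topspace ?Y" for x
    using cube that unfolding is_cube_def by auto
  have "continuous_map ?Y (compact_open (top_of_set (simplex_on {0})) ?Y) (\<lambda>y. \<lambda>t\<in>simplex_on {0}. y)"
    using continuous_map_into_compact_open[OF continuous_map_snd[of "top_of_set (simplex_on {0})" ?Y]] by simp
  then have "continuous_map ?Y ?T ?e"
    unfolding continuous_map_componentwise by (auto simp: punctured_1)
  moreover have "?e y \<in> {\<phi>. \<forall>S\<in>punctured 1. \<forall>T\<in>punctured 1. S \<subseteq> T \<longrightarrow>
             (\<forall>t\<in>simplex_on S. \<phi> T t = edge \<X> S T (\<phi> S t))}" if "y \<in> topspace ?Y" for y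
    using that by (auto simp: punctured_1 id)
  ultimately have e: "continuous_map ?Y ?P ?e"
    unfolding punctured_holim_def continuous_map_in_subtopology by blast
  have "continuous_map ?P (compact_open (top_of_set (simplex_on {0})) ?Y) (\<lambda>\<phi>. \<phi> {0})"
    unfolding punctured_holim_def
    by (intro continuous_map_from_subtopology continuous_map_product_projection) (simp add: punctured_1)
  then have p: "continuous_map ?P ?Y ?p"
    by (rule continuous_map_compact_open_eval_point[rotated]) (simp add: simplex_on_0)
  have ep: "?e (?p \<phi>) = \<phi>" if "\<phi> \<in> topspace ?P" for \<phi>
  proof (rule ext)
    fix S
    have ext: "\<phi> \<in> extensional (punctured 1)" "\<phi> {0} \<in> extensional (simplex_on {0})"
      using that by (auto simp: punctured_holim_def topspace_compact_open PiE_def punctured_1)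
    show "?e (?p \<phi>) S = \<phi> S"
    proof (cases "S = {0}")
      case True
      have "(\<lambda>t\<in>simplex_on {0}. ?p \<phi>) = \<phi> {0}"
        by (rule extensionalityI[OF _ ext(2)]) (auto simp: simplex_on_0)
      then show ?thesis using True by (simp add: punctured_1)
    qed (use ext(1) in \<open>simp add: punctured_1 extensional_def\<close>)
  qed
  have pe: "?p (?e y) = y" for y by (simp add: punctured_1 simplex_on_0)
  have h: "homeomorphic_maps ?P ?Y ?p ?e"
    unfolding homeomorphic_maps_def by (intro conjI ballI e p ep pe)
  have we: "weak_equivalence ?P ?Y ?p" "weak_equivalence ?Y ?P ?e"
    using weak_equivalence_homeomorphic_maps h homeomorphic_maps_sym by blast+
  have eq: "to_holim 1 \<X> = ?e \<circ> ?f"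
    by (auto simp: to_holim_def punctured_1 fun_eq_iff)
  show ?thesis
  proof
    assume "cartesian 1 \<X>"
    then have "weak_equivalence (vertex \<X> {}) ?Y (?p \<circ> to_holim 1 \<X>)"
      unfolding cartesian_def by (rule weak_equivalence_compose[OF _ we(1)])
    then show "weak_equivalence (vertex \<X> {}) ?Y ?f"
      unfolding eq by (rule weak_equivalence_cong) (simp add: punctured_1 simplex_on_0)
  next
    assume "weak_equivalence (vertex \<X> {}) ?Y ?f"
    then show "cartesian 1 \<X>"
      unfolding cartesian_def eq by (rule weak_equivalence_compose[OF _ we(2)])
  qed
qed

text \<open>Identities and composites in a cube hold only on carriers, while the functor axioms
  speak of the functions \<open>id\<close> and \<open>g \<circ> f\<close>. The invariance of
  \<open>on_map\<close> under agreement on the carrier bridges the two.\<close>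

lemma is_cube_map_cube:
  assumes F: "is_functor F" and X: "is_small_cube n \<X>"
  shows "is_cube n (map_cube F \<X>)"
proof -
  have small: "small_space (vertex \<X> S)" if "S \<subseteq> {..<n}" for S
    using X that by (simp add: is_small_cube_def)
  have cont: "continuous_map (vertex \<X> S) (vertex \<X> T) (edge \<X> S T)" if "S \<subseteq> T" "T \<subseteq> {..<n}" for S T
    using X that by (simp add: is_small_cube_def is_cube_def)
  have Fcong: "on_map F X Y u x = on_map F X Y v x"
    if "small_space X" "small_space Y" "continuous_map X Y u" "continuous_map X Y v"
      "\<forall>x\<in>topspace X. u x = v x" "x \<in> topspace (on_space F X)" for X Y u v x
    using F[unfolded is_functor_def, THEN conjunct2, THEN conjunct2, THEN conjunct1, rule_format, of X Y u v x] that
    by simp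
  have Fid: "on_map F X X id x = x" if "small_space X" "x \<in> topspace (on_space F X)" for X x
    using F that unfolding is_functor_def by simp
  have Fcomp: "on_map F X Z (v \<circ> u) x = on_map F Y Z v (on_map F X Y u x)"
    if "small_space X" "small_space Y" "small_space Z" "continuous_map X Y u" "continuous_map Y Z v"
      "x \<in> topspace (on_space F X)" for X Y Z u v x
    using F[unfolded is_functor_def, THEN conjunct2, THEN conjunct2, THEN conjunct2, THEN conjunct2, rule_format,
        of X Y Z u v x] that
    by simp
  show ?thesis unfolding is_cube_def
  proof (intro conjI allI impI ballI)
    fix S T :: "nat set" assume ST: "S \<subseteq> T \<and> T \<subseteq> {..<n}"
    then have "continuous_map (on_space F (vertex \<X> S)) (on_space F (vertex \<X> T))
        (on_map F (vertex \<X> S) (vertex \<X> T) (edge \<X> S T))"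
      using F small[of S] small[of T] cont[of S T] unfolding is_functor_def by auto
    then show "continuous_map (vertex (map_cube F \<X>) S) (vertex (map_cube F \<X>) T) (edge (map_cube F \<X>) S T)"
      by (simp add: map_cube_def)
  next
    fix S x assume S: "S \<subseteq> {..<n}" and x: "x \<in> topspace (vertex (map_cube F \<X>) S)"
    have "\<forall>y\<in>topspace (vertex \<X> S). edge \<X> S S y = id y"
      using X S unfolding is_small_cube_def is_cube_def by simp
    have cid: "continuous_map (vertex \<X> S) (vertex \<X> S) id" by (simp add: id_def)
    show "edge (map_cube F \<X>) S S x = x"
      using x Fid[OF small[OF S]] Fcong[OF small[OF S] small[OF S] cont[OF order_refl S] cid \<open>\<forall>y\<in>_. _\<close>]
      unfolding map_cube_def cube.simps by metis
  next
    fix R S T x assume RST: "R \<subseteq> S \<and> S \<subseteq> T \<and> T \<subseteq> {..<n}" and x: "x \<in> topspace (vertex (map_cube F \<X>) R)"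
    then have R: "R \<subseteq> T" "R \<subseteq> {..<n}" "S \<subseteq> {..<n}" by auto
    have "\<forall>y\<in>topspace (vertex \<X> R). edge \<X> R T y = (edge \<X> S T \<circ> edge \<X> R S) y"
      using X RST unfolding is_small_cube_def is_cube_def by simp
    note eq = Fcong[OF small small cont continuous_map_compose[OF cont cont] this]
    show "edge (map_cube F \<X>) R T x = edge (map_cube F \<X>) S T (edge (map_cube F \<X>) R S x)"
      using x RST R Fcomp[OF small small small cont cont, of R S T x] eq[of x]
      unfolding map_cube_def cube.simps by (simp del: o_apply add: comp_def)
  qed
qed

section \<open>Arrows and squares as small cubes\<close>

lemma is_small_cube_arrow:
  assumes "small_space X" "small_space Y" "continuous_map X Y f"
  shows "is_small_cube 1 (arrow_cube X Y f)"
proof -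
  have "S = {} \<or> S = {0}" if "S \<subseteq> {..<1::nat}" for S using that by auto
  then show ?thesis
    using assms unfolding is_small_cube_def is_cube_def arrow_cube_def
    by (auto simp: continuous_map_id[unfolded id_def] id_def)
qed

definition id_functor :: "'u top_functor" where
  "id_functor = \<lparr>on_space = (\<lambda>X. X), on_map = (\<lambda>X Y f. f)\<rparr>"

lemma homotopy_functor_id: "homotopy_functor (id_functor :: 'u top_functor)"
  by (simp add: id_functor_def homotopy_functor_def is_functor_def)

lemma absolutely_cartesian_arrow_iff:
  assumes X: "small_space X" "small_space Y" "continuous_map X Y f"
  shows "absolutely_cartesian 1 (arrow_cube X Y f) \<longleftrightarrow> weak_equivalence X Y f"
proof
  assume "absolutely_cartesian 1 (arrow_cube X Y f)"
  then have "cartesian 1 (map_cube id_functor (arrow_cube X Y f))"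
    using homotopy_functor_id[where 'u = 'a] by (simp add: absolutely_cartesian_def)
  moreover have "is_cube 1 (map_cube id_functor (arrow_cube X Y f))"
    using homotopy_functor_id[where 'u = 'a] is_cube_map_cube is_small_cube_arrow[OF X] unfolding homotopy_functor_def by blast
  ultimately show "weak_equivalence X Y f"
    using cartesian_1_iff by (fastforce simp: map_cube_def arrow_cube_def id_functor_def)
next
  assume f: "weak_equivalence X Y f"
  show "absolutely_cartesian 1 (arrow_cube X Y f)"
    unfolding absolutely_cartesian_def
  proof (intro conjI allI impI is_small_cube_arrow X)
    fix F :: "'a top_functor" assume F: "homotopy_functor F"
    then have "is_cube 1 (map_cube F (arrow_cube X Y f))"
      using is_cube_map_cube is_small_cube_arrow[OF X] unfolding homotopy_functor_def by blast
    moreover have "weak_equivalence (on_space F X) (on_space F Y) (on_map F X Y f)"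
      using F f X unfolding homotopy_functor_def by blast
    ultimately show "cartesian 1 (map_cube F (arrow_cube X Y f))"
      by (subst cartesian_1_iff) (simp_all add: map_cube_def arrow_cube_def)
  qed
qed

lemma is_small_cube_square:
  assumes small: "small_space A" "small_space B" "small_space C" "small_space D"
    and cont: "continuous_map A B f" "continuous_map A C g" "continuous_map B D h" "continuous_map C D k"
    and comm: "\<forall>a\<in>topspace A. h (f a) = k (g a)"
  shows "is_small_cube 2 (square_cube A B C D f g h k)"
proof -
  have "{..<2} = {0, Suc 0}" by auto
  then have cases: "S = {} \<or> S = {0} \<or> S = {Suc 0} \<or> S = {0, Suc 0}" if "S \<subseteq> {..<2}" for S using that by auto
  have hf: "continuous_map A D (h \<circ> f)" using cont by (auto intro: continuous_map_compose)
  let ?X = "square_cube A B C D f g h k"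

  have V: "vertex ?X {} = A" "vertex ?X {0} = B" "vertex ?X {Suc 0} = C" "vertex ?X {0, Suc 0} = D"
    by (simp_all add: square_cube_def)
  have E: "edge ?X {} {0} = f" "edge ?X {} {Suc 0} = g" "edge ?X {0} {0, Suc 0} = h"
    "edge ?X {Suc 0} {0, Suc 0} = k" "edge ?X {} {0, Suc 0} = h \<circ> f" "edge ?X S S = (\<lambda>x. x)" for S
    by (auto simp: square_cube_def doubleton_eq_iff id_def)
  show ?thesis
    unfolding is_small_cube_def is_cube_def
  proof (intro conjI allI impI)
    show "small_space (vertex ?X S)" for S
      using small by (simp add: square_cube_def)
    show "continuous_map (vertex ?X S) (vertex ?X T) (edge ?X S T)" if "S \<subseteq> T \<and> T \<subseteq> {..<2}" for S T
    proof -
      have "S \<subseteq> {..<2}" "T \<subseteq> {..<2}" using that by auto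
      then have "S = T \<or> S = {} \<and> T = {0} \<or> S = {} \<and> T = {Suc 0} \<or> S = {} \<and> T = {0, Suc 0} \<or>
          S = {0} \<and> T = {0, Suc 0} \<or> S = {Suc 0} \<and> T = {0, Suc 0}"
        using cases[of S] cases[of T] that by auto
      then show ?thesis using cont hf by (elim disjE conjE) (simp_all add: V E)
    qed
    show "\<forall>x\<in>topspace (vertex ?X S). edge ?X S S x = x" if "S \<subseteq> {..<2}" for S
      by (simp add: E)
    show "\<forall>x\<in>topspace (vertex ?X R). edge ?X R T x = edge ?X S T (edge ?X R S x)"
      if "R \<subseteq> S \<and> S \<subseteq> T \<and> T \<subseteq> {..<2}" for R S T
    proof -
      have "R \<subseteq> {..<2}" "S \<subseteq> {..<2}" "T \<subseteq> {..<2}" using that by auto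
      then have "R = S \<or> S = T \<or> R = {} \<and> T = {0, Suc 0} \<and> (S = {0} \<or> S = {Suc 0})"
        using cases[of R] cases[of S] cases[of T] that by auto
      then show ?thesis using comm by (elim disjE conjE) (simp_all add: V E)
    qed
  qed
qed

lemma square_diagram_map_cube:
  assumes F: "is_functor F"
    and X: "is_small_cube 2 (square_cube A B C D f g h k)"
  shows "square_diagram (map_cube F (square_cube A B C D f g h k)) (on_space F B) (on_space F C) (on_space F D)
     (on_map F A B f) (on_map F A C g) (on_map F B D h) (on_map F C D k)"
  using is_cube_map_cube[OF F X]
  by (simp add: square_diagram_def map_cube_def square_cube_def doubleton_eq_iff)

lemma absolutely_cartesian_square:
  assumes X: "is_small_cube 2 (square_cube A B C D f g h k)"
    and small: "small_space A" "small_space B" "small_space C" "small_space D"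
    and we: "weak_equivalence A B f \<and> weak_equivalence C D k \<or> weak_equivalence A C g \<and> weak_equivalence B D h"
  shows "absolutely_cartesian 2 (square_cube A B C D f g h k)"
  unfolding absolutely_cartesian_def
proof (intro conjI allI impI X)
  fix F :: "'a top_functor" assume F: "homotopy_functor F"
  interpret square_diagram "map_cube F (square_cube A B C D f g h k)" "on_space F B" "on_space F C" "on_space F D"
     "on_map F A B f" "on_map F A C g" "on_map F B D h" "on_map F C D k"
    by (rule square_diagram_map_cube[OF _ X]) (use F in \<open>simp add: homotopy_functor_def\<close>)
  have FA: "vertex (map_cube F (square_cube A B C D f g h k)) {} = on_space F A"
    by (simp add: map_cube_def square_cube_def)
  have Fwe: "weak_equivalence (on_space F X) (on_space F Y) (on_map F X Y u)"
    if "small_space X" "small_space Y" "weak_equivalence X Y u" for X Y u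
    using F that unfolding homotopy_functor_def by blast
  from we show "cartesian 2 (map_cube F (square_cube A B C D f g h k))"
    using cartesian_iff_weak_equivalence1 cartesian_iff_weak_equivalence2 Fwe small unfolding FA by blast
qed

section \<open>Small sets and set-valued homotopy functors\<close>

text \<open>\<open>universe\<close> speaks of power sets of subsets of \<open>'u\<close> only; a set
  over another type is first embedded in \<open>'u\<close>.\<close>

lemma lesspoll_universe_Pow:
  fixes S :: "'b set"
  assumes U: "universe TYPE('u)" and S: "S \<prec> (UNIV :: 'u set)"
  shows "Pow S \<prec> (UNIV :: 'u set)"
proof -
  obtain e :: "'b \<Rightarrow> 'u" where e: "inj_on e S"
    using S by (auto simp: lesspoll_def lepoll_def)
  then have "e ` S \<prec> (UNIV :: 'u set)" using S by simp
  then have "Pow (e ` S) \<prec> (UNIV :: 'u set)" using U by (simp add: universe_def small_set_def)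
  moreover have "inj_on (image e) (Pow S)" using e by (rule inj_on_image_Pow)
  then have "Pow S \<lesssim> Pow (e ` S)" unfolding lepoll_def by (intro exI[of _ "image e"]) auto
  ultimately show ?thesis using lesspoll_trans1 by blast
qed

lemma infinite_universe: "universe TYPE('u) \<Longrightarrow> infinite (UNIV :: 'u set)"
  unfolding universe_def using uncountable_infinite by blast

lemma lepoll_total: "A \<lesssim> B \<or> B \<lesssim> A"
  using ordLeq_total[OF card_of_Well_order card_of_Well_order, of A B]
  unfolding lepoll_def by (simp add: card_of_ordLeq)

text \<open>Both factors are dominated by the larger one, whose square is finite or of the same size
  as itself.\<close>

lemma lesspoll_universe_Times:
  assumes U: "universe TYPE('u)" and S: "S \<prec> (UNIV :: 'u set)" and T: "T \<prec> (UNIV :: 'u set)"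
  shows "S \<times> T \<prec> (UNIV :: 'u set)"
proof -
  have *: "A \<times> A \<prec> (UNIV :: 'u set)" if "A \<prec> (UNIV :: 'u set)" for A :: "'x set"
  proof (cases "finite A")
    case True then show ?thesis using infinite_universe[OF U] by (simp add: finite_lesspoll_infinite)
  next
    case False
    then have "A \<times> A \<approx> A" using card_of_Times_same_infinite by (simp add: eqpoll_iff_card_of_ordIso)
    then show ?thesis using that eq_lesspoll_trans by blast
  qed
  from lepoll_total[of S T] show ?thesis
  proof
    assume "S \<lesssim> T"
    then have "S \<times> T \<lesssim> T \<times> T" by (simp add: times_lepoll_mono)
    then show ?thesis using *[OF T] lesspoll_trans1 by blast
  next
    assume "T \<lesssim> S"
    then have "S \<times> T \<lesssim> S \<times> S" by (simp add: times_lepoll_mono)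
    then show ?thesis using *[OF S] lesspoll_trans1 by blast
  qed
qed

lemma lesspoll_universe_countable:
  assumes U: "universe TYPE('u)" and S: "countable S"
  shows "S \<prec> (UNIV :: 'u set)"
proof -
  have "S \<lesssim> (UNIV :: nat set)" using S by (auto simp: countable_def lepoll_def)
  also have "(UNIV :: nat set) \<lesssim> (UNIV :: 'u set)"
    using infinite_universe[OF U] by (simp add: infinite_le_lepoll)
  finally have "S \<lesssim> (UNIV :: 'u set)" .
  moreover have "\<not> S \<approx> (UNIV :: 'u set)"
    using S U countable_eqpoll eqpoll_sym unfolding universe_def by blast
  ultimately show ?thesis by (simp add: lesspoll_def)
qed

text \<open>Rational cuts embed the reals into the power set of a countable set, and countable sets
  are small because the universe is uncountable.\<close>

lemma lesspoll_universe_real: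
  assumes U: "universe TYPE('u)" shows "(UNIV :: real set) \<prec> (UNIV :: 'u set)"
proof -
  have "inj (\<lambda>x::real. {q::rat. of_rat q < x})"
  proof (rule injI)
    fix x y :: real assume eq: "{q::rat. of_rat q < x} = {q. of_rat q < y}"
    show "x = y"
    proof (rule ccontr)
      assume "x \<noteq> y"
      then have "min x y < max x y" by (auto simp: min_def max_def)
      then obtain q where "min x y < of_rat q" "of_rat q < max x y"
        using of_rat_dense by blast
      moreover have "of_rat q < x \<longleftrightarrow> of_rat q < y" using eq by blast
      ultimately show False by (auto simp: min_def max_def split: if_splits)
    qed
  qed
  then have "(UNIV :: real set) \<lesssim> Pow (UNIV :: rat set)"
    unfolding lepoll_def by (intro exI[of _ "\<lambda>x. {q. of_rat q < x}"]) auto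
  then show ?thesis
    using lesspoll_universe_Pow[OF U lesspoll_universe_countable[OF U, of "UNIV :: rat set"]] lesspoll_trans1 by blast
qed

lemma lesspoll_universe_complex:
  assumes U: "universe TYPE('u)" shows "(UNIV :: complex set) \<prec> (UNIV :: 'u set)"
proof -
  have "inj (\<lambda>z. (Re z, Im z))" by (rule injI) (simp add: complex_eq_iff)
  then have "(UNIV :: complex set) \<lesssim> (UNIV :: real set) \<times> (UNIV :: real set)"
    unfolding lepoll_def by (intro exI[of _ "\<lambda>z. (Re z, Im z)"]) auto
  then show ?thesis
    using lesspoll_universe_Times[OF U lesspoll_universe_real[OF U] lesspoll_universe_real[OF U]]
      lesspoll_trans1 by blast
qed

lemma lesspoll_universe_nat_real:
  assumes U: "universe TYPE('u)" shows "(UNIV :: (nat \<Rightarrow> real) set) \<prec> (UNIV :: 'u set)"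
proof -
  have "inj (\<lambda>f :: nat \<Rightarrow> real. {(n, f n) |n. True})" by (rule injI) (auto simp: set_eq_iff)
  then have "(UNIV :: (nat \<Rightarrow> real) set) \<lesssim> Pow ((UNIV :: nat set) \<times> (UNIV :: real set))"
    unfolding lepoll_def by (intro exI[of _ "\<lambda>f. {(n, f n) |n. True}"]) auto
  moreover have "(UNIV :: nat set) \<times> (UNIV :: real set) \<prec> (UNIV :: 'u set)"
    by (intro lesspoll_universe_Times lesspoll_universe_real lesspoll_universe_countable U) auto
  ultimately show ?thesis using lesspoll_universe_Pow[OF U] lesspoll_trans1 by blast
qed

text \<open>A class is coded by the graph over \<open>Z\<close> of a chosen representative. The maps
  counted here are total functions on a type, so only their classes, not the maps themselves, are
  bounded by the size of \<open>Z\<close> and \<open>T\<close>.\<close>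

lemma lepoll_quotient_functions:
  assumes R: "equiv E R" and E: "\<And>f. f \<in> E \<Longrightarrow> f ` Z \<subseteq> T"
    and eq: "\<And>f g. f \<in> E \<Longrightarrow> g \<in> E \<Longrightarrow> (\<And>z. z \<in> Z \<Longrightarrow> f z = g z) \<Longrightarrow> (f, g) \<in> R"
  shows "E // R \<lesssim> Pow (Z \<times> T)"
proof -
  define rep where "rep c = (SOME f. f \<in> E \<and> c = R `` {f})" for c
  have rep: "rep c \<in> E" "c = R `` {rep c}" if "c \<in> E // R" for c
  proof -
    have "\<exists>f. f \<in> E \<and> c = R `` {f}" using that by (auto elim: quotientE)
    then have "rep c \<in> E \<and> c = R `` {rep c}" unfolding rep_def by (rule someI_ex)
    then show "rep c \<in> E" "c = R `` {rep c}" by auto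
  qed
  define G where "G c = {(z, rep c z) |z. z \<in> Z}" for c
  have "inj_on G (E // R)"
  proof (rule inj_onI)
    fix c c' assume c: "c \<in> E // R" "c' \<in> E // R" "G c = G c'"
    then have "rep c z = rep c' z" if "z \<in> Z" for z using that by (auto simp: G_def set_eq_iff)
    then have "(rep c, rep c') \<in> R" using eq rep c by blast
    then show "c = c'" using rep c equiv_class_eq[OF R] by metis
  qed
  moreover have "G ` (E // R) \<subseteq> Pow (Z \<times> T)"
    using rep E by (fastforce simp: G_def)
  ultimately show ?thesis unfolding lepoll_def by blast
qed

lemma lesspoll_universe_quotient_functions:
  assumes U: "universe TYPE('u)" and "Z \<prec> (UNIV :: 'u set)" "T \<prec> (UNIV :: 'u set)"
    and "equiv E R" "\<And>f. f \<in> E \<Longrightarrow> f ` Z \<subseteq> T"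
     "\<And>f g. f \<in> E \<Longrightarrow> g \<in> E \<Longrightarrow> (\<And>z. z \<in> Z \<Longrightarrow> f z = g z) \<Longrightarrow> (f, g) \<in> R"
  shows "E // R \<prec> (UNIV :: 'u set)"
  using lepoll_quotient_functions[OF assms(4-6)] lesspoll_universe_Pow[OF U lesspoll_universe_Times[OF U assms(2,3)]]
    lesspoll_trans1 by blast

section \<open>Bouquets of spheres and their free homotopy classes\<close>

lemma continuous_map_from_prod_discrete:
  "continuous_map (prod_topology (discrete_topology I) T) X f \<longleftrightarrow> (\<forall>i\<in>I. continuous_map T X (\<lambda>x. f (i, x)))"
proof (intro iffI ballI)
  fix i assume f: "continuous_map (prod_topology (discrete_topology I) T) X f" and i: "i \<in> I"
  have "continuous_map T (prod_topology (discrete_topology I) T) (\<lambda>x. (i, x))"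
    using i by (simp add: continuous_map_pairwise o_def)
  from continuous_map_compose[OF this f] show "continuous_map T X (\<lambda>x. f (i, x))" by (simp add: o_def)
next
  assume f: "\<forall>i\<in>I. continuous_map T X (\<lambda>x. f (i, x))"
  show "continuous_map (prod_topology (discrete_topology I) T) X f"
    unfolding continuous_map
  proof (intro conjI allI impI)
    show "f ` topspace (prod_topology (discrete_topology I) T) \<subseteq> topspace X"
      using f by (auto simp: continuous_map_def)
    fix V assume V: "openin X V"
    have "openin (prod_topology (discrete_topology I) T) ({i} \<times> {x \<in> topspace T. f (i, x) \<in> V})" if "i \<in> I" for i
      unfolding openin_prod_Times_iff using f V that by (auto simp: continuous_map)
    then have "openin (prod_topology (discrete_topology I) T) (\<Union>i\<in>I. {i} \<times> {x \<in> topspace T. f (i, x) \<in> V})"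
      by blast
    moreover have "(\<Union>i\<in>I. {i} \<times> {x \<in> topspace T. f (i, x) \<in> V}) =
       {z \<in> topspace (prod_topology (discrete_topology I) T). f z \<in> V}" by auto
    ultimately show "openin (prod_topology (discrete_topology I) T)
       {z \<in> topspace (prod_topology (discrete_topology I) T). f z \<in> V}" by simp
  qed
qed

lemma continuous_map_from_prod_prod_discrete:
  "continuous_map (prod_topology J (prod_topology (discrete_topology I) T)) X f \<longleftrightarrow>
    (\<forall>i\<in>I. continuous_map (prod_topology J T) X (\<lambda>(s, x). f (s, i, x)))" (is "?l = ?r")
proof -
  let ?P = "prod_topology J (prod_topology (discrete_topology I) T)"
    and ?Q = "prod_topology (discrete_topology I) (prod_topology J T)"
  let ?a = "\<lambda>z. (fst (snd z), fst z, snd (snd z))"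
  have fs: "continuous_map (prod_topology V (prod_topology W Y)) W (\<lambda>z. fst (snd z))"
    "continuous_map (prod_topology V (prod_topology W Y)) Y (\<lambda>z. snd (snd z))" for V :: "'p topology" and W :: "'q topology" and Y :: "'r topology"
    using continuous_map_compose[OF continuous_map_snd continuous_map_fst, of V W Y]
      continuous_map_compose[OF continuous_map_snd continuous_map_snd, of V W Y] by (simp_all add: o_def)
  have a: "continuous_map ?P ?Q ?a" "continuous_map ?Q ?P ?a"
    unfolding continuous_map_pairwise o_def fst_conv snd_conv by (intro conjI continuous_map_fst fs)+
  have "?l \<longleftrightarrow> continuous_map ?Q X (\<lambda>z. f (?a z))"
    using continuous_map_compose[OF a(2), of X f] continuous_map_compose[OF a(1), of X "f \<circ> ?a"]
    by (auto simp: o_def)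
  also have "\<dots> \<longleftrightarrow> ?r"
    unfolding continuous_map_from_prod_discrete by (simp add: case_prod_unfold)
  finally show ?thesis .
qed

text \<open>A pinched map is a map out of the bouquet of \<open>n\<close>-spheres indexed by \<open>I\<close>. The common base
  point may move during a homotopy.\<close>

definition bouquet_dom :: "nat \<Rightarrow> 'i set \<Rightarrow> ('i \<times> (nat \<Rightarrow> real)) topology" where
  "bouquet_dom n I = prod_topology (discrete_topology I) (top_of_set (unit_cube n))"

text \<open>In dimension 0 the boundary is empty and the condition void, so bouquet maps are then
  \<open>I\<close>-indexed families of points. In this way the same functors also cover path
  components.\<close>

definition pinched :: "nat \<Rightarrow> 'i set \<Rightarrow> ('i \<times> (nat \<Rightarrow> real) \<Rightarrow> 'a) \<Rightarrow> bool" where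
  "pinched n I U \<longleftrightarrow> (\<exists>y. U ` (I \<times> cube_boundary n) \<subseteq> {y})"

definition bouquet_maps :: "nat \<Rightarrow> 'i set \<Rightarrow> 'a topology \<Rightarrow> ('i \<times> (nat \<Rightarrow> real) \<Rightarrow> 'a) set" where
  "bouquet_maps n I X = {U. continuous_map (bouquet_dom n I) X U \<and> pinched n I U}"

definition bouquet_rel ::
  "nat \<Rightarrow> 'i set \<Rightarrow> 'a topology \<Rightarrow> (('i \<times> (nat \<Rightarrow> real) \<Rightarrow> 'a) \<times> ('i \<times> (nat \<Rightarrow> real) \<Rightarrow> 'a)) set" where
  "bouquet_rel n I X = {(U, V). homotopic_with (pinched n I) (bouquet_dom n I) X U V}"

definition bouquet_classes where
  "bouquet_classes n I X = bouquet_maps n I X // bouquet_rel n I X"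

definition bouquet_classes_map where
  "bouquet_classes_map n I Y f = (\<lambda>c. bouquet_rel n I Y `` ((\<lambda>U. f \<circ> U) ` c))"

lemma equiv_bouquet: "equiv (bouquet_maps n I X) (bouquet_rel n I X)"
  unfolding bouquet_maps_def bouquet_rel_def by (rule equiv_homotopic_with)

lemma bouquet_maps_iff:
  "U \<in> bouquet_maps n I X \<longleftrightarrow> (\<forall>i\<in>I. cmap (unit_cube n) X (\<lambda>x. U (i, x))) \<and>
     (\<exists>y. \<forall>i\<in>I. \<forall>x\<in>cube_boundary n. U (i, x) = y)"
  unfolding bouquet_maps_def bouquet_dom_def pinched_def
  by (auto simp: continuous_map_from_prod_discrete image_subset_iff)

lemma pinched_cong:
  assumes "\<And>z. z \<in> topspace (bouquet_dom n I) \<Longrightarrow> h z = k z"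
  shows "pinched n I h \<longleftrightarrow> pinched n I k"
proof -
  have "h ` (I \<times> cube_boundary n) = k ` (I \<times> cube_boundary n)"
    using assms cube_boundary_subset[of n] by (intro image_cong) (auto simp: bouquet_dom_def)
  then show ?thesis by (simp add: pinched_def)
qed

lemma bouquet_rel_iff:
  "(U, V) \<in> bouquet_rel n I X \<longleftrightarrow> (\<exists>H. (\<forall>i\<in>I. cmap ({0..1::real} \<times> unit_cube n) X (H i) \<and>
     (\<forall>x\<in>unit_cube n. H i (0, x) = U (i, x) \<and> H i (1, x) = V (i, x))) \<and>
     (\<forall>s\<in>{0..1}. \<exists>y. \<forall>i\<in>I. \<forall>x\<in>cube_boundary n. H i (s, x) = y))" (is "?l \<longleftrightarrow> ?r")
proof -
  have "?l \<longleftrightarrow> (\<exists>h. continuous_map (prod_topology (top_of_set {0..1::real}) (bouquet_dom n I)) X h \<and>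
      (\<forall>z\<in>topspace (bouquet_dom n I). h (0, z) = U z) \<and> (\<forall>z\<in>topspace (bouquet_dom n I). h (1, z) = V z) \<and>
      (\<forall>t\<in>{0..1}. pinched n I (\<lambda>z. h (t, z))))" (is "_ \<longleftrightarrow> (\<exists>h. ?P h)")
    unfolding bouquet_rel_def mem_Collect_eq case_prod_conv by (rule homotopic_with[OF pinched_cong])
  also have "\<dots> \<longleftrightarrow> ?r"
  proof
    assume "\<exists>h. ?P h"
    then obtain h where "?P h" by blast
    then show ?r
      unfolding bouquet_dom_def continuous_map_from_prod_prod_discrete pinched_def
      by (intro exI[of _ "\<lambda>i (s, x). h (s, i, x)"]) (auto simp: image_subset_iff)
  next
    assume ?r
    then obtain H where H: "\<And>i. i \<in> I \<Longrightarrow> cmap ({0..1::real} \<times> unit_cube n) X (H i)"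
     "\<And>i x. i \<in> I \<Longrightarrow> x\<in>unit_cube n \<Longrightarrow> H i (0, x) = U (i, x) \<and> H i (1, x) = V (i, x)"
     "\<forall>s\<in>{0..1}. \<exists>y. \<forall>i\<in>I. \<forall>x\<in>cube_boundary n. H i (s, x) = y" by blast
    have "?P (\<lambda>(s, i, x). H i (s, x))"
      unfolding bouquet_dom_def continuous_map_from_prod_prod_discrete pinched_def
      using H by (auto simp: image_subset_iff)
    then show "\<exists>h. ?P h" by blast
  qed
  finally show ?thesis .
qed

lemma bouquet_maps_compose:
  "continuous_map X Y f \<Longrightarrow> U \<in> bouquet_maps n I X \<Longrightarrow> f \<circ> U \<in> bouquet_maps n I Y"
  unfolding bouquet_maps_def pinched_def by (fastforce intro: continuous_map_compose)

lemma bouquet_rel_compose: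
  "continuous_map X Y f \<Longrightarrow> (U, V) \<in> bouquet_rel n I X \<Longrightarrow> (f \<circ> U, f \<circ> V) \<in> bouquet_rel n I Y"
  unfolding bouquet_rel_def mem_Collect_eq case_prod_conv
  by (erule homotopic_with_compose_continuous_map_left) (auto simp: pinched_def image_subset_iff)

lemma bouquet_relI:
  assumes "U \<in> bouquet_maps n I X" "\<And>i x. i \<in> I \<Longrightarrow> x \<in> unit_cube n \<Longrightarrow> U (i, x) = V (i, x)"
  shows "(U, V) \<in> bouquet_rel n I X"
proof -
  have eq: "U z = V z" if "z \<in> topspace (bouquet_dom n I)" for z
    using that assms(2) by (auto simp: bouquet_dom_def)
  show ?thesis
    using assms(1) pinched_cong[of n I U V, OF eq] eq
    by (simp add: bouquet_rel_def bouquet_maps_def homotopic_with_equal)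
qed

lemma bouquet_classes_map_class:
  assumes f: "continuous_map X Y f" and U: "U \<in> bouquet_maps n I X"
  shows "bouquet_classes_map n I Y f (bouquet_rel n I X `` {U}) = bouquet_rel n I Y `` {f \<circ> U}"
  unfolding bouquet_classes_map_def
  by (rule quotient_map_class[OF equiv_bouquet equiv_bouquet])
    (use f U in \<open>auto intro: bouquet_maps_compose bouquet_rel_compose\<close>)

lemma bij_betw_bouquet_classes_map_iff:
  assumes f: "continuous_map X Y f"
  shows "bij_betw (bouquet_classes_map n I Y f) (bouquet_classes n I X) (bouquet_classes n I Y) \<longleftrightarrow>
    (\<forall>U\<in>bouquet_maps n I X. \<forall>V\<in>bouquet_maps n I X.
       (f \<circ> U, f \<circ> V) \<in> bouquet_rel n I Y \<longrightarrow> (U, V) \<in> bouquet_rel n I X) \<and>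
    (\<forall>W\<in>bouquet_maps n I Y. \<exists>U\<in>bouquet_maps n I X. (f \<circ> U, W) \<in> bouquet_rel n I Y)"
  unfolding bouquet_classes_map_def bouquet_classes_def
  by (rule bij_betw_quotient_map_iff[OF equiv_bouquet equiv_bouquet])
    (use f in \<open>auto intro: bouquet_maps_compose bouquet_rel_compose\<close>)

text \<open>The action on maps needs no source argument, since it is applied to classes over the source.\<close>

definition set_functor ::
  "('u topology \<Rightarrow> 'v set) \<Rightarrow> ('u topology \<Rightarrow> ('u \<Rightarrow> 'u) \<Rightarrow> 'v \<Rightarrow> 'v) \<Rightarrow> bool" where
  "set_functor ob mor \<longleftrightarrow>
    (\<forall>X. small_space X \<longrightarrow> ob X \<prec> (UNIV :: 'u set)) \<and>
    (\<forall>X Y f. continuous_map X Y f \<longrightarrow> mor Y f ` ob X \<subseteq> ob Y) \<and>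
    (\<forall>X Y f g. continuous_map X Y f \<and> continuous_map X Y g \<and> (\<forall>x\<in>topspace X. f x = g x) \<longrightarrow>
       (\<forall>c\<in>ob X. mor Y f c = mor Y g c)) \<and>
    (\<forall>X. \<forall>c\<in>ob X. mor X id c = c) \<and>
    (\<forall>X Y Z f g. continuous_map X Y f \<and> continuous_map Y Z g \<longrightarrow>
       (\<forall>c\<in>ob X. mor Z (g \<circ> f) c = mor Z g (mor Y f c))) \<and>
    (\<forall>X Y f. weak_equivalence X Y f \<longrightarrow> bij_betw (mor Y f) (ob X) (ob Y))"

section \<open>Weak equivalences and bouquets\<close>

lemma cmap_empty [simp]: "cmap {} X f"
  by (simp add: continuous_map_def)

lemma cmap_Times_prism_bdry:
  assumes cl: "closed (J :: 'j::t2_space set)" "closed (K :: 'k::t2_space set)" "closed dK"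
    and 0: "cmap (J \<times> K) X (\<lambda>z. f (fst z, 0, snd z))" and 1: "cmap (J \<times> K) X (\<lambda>z. f (fst z, 1, snd z))"
    and s: "cmap (J \<times> {0..1} \<times> dK) X f"
  shows "cmap (J \<times> prism_bdry K dK) X f"
proof -
  have "cmap (J \<times> {0::real} \<times> K) X (\<lambda>z. (\<lambda>z. f (fst z, 0, snd z)) (fst z, snd (snd z)))"
    by (rule cmap_compose[OF 0]) (auto intro!: prod_continuous_intros)
  then have a: "cmap (J \<times> {0} \<times> K) X f" by (rule cmap_cong) auto
  have "cmap (J \<times> {1::real} \<times> K) X (\<lambda>z. (\<lambda>z. f (fst z, 1, snd z)) (fst z, snd (snd z)))"
    by (rule cmap_compose[OF 1]) (auto intro!: prod_continuous_intros)
  then have b: "cmap (J \<times> {1} \<times> K) X f" by (rule cmap_cong) auto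
  have "cmap ((J \<times> {0} \<times> K \<union> J \<times> {1} \<times> K) \<union> J \<times> {0..1} \<times> dK) X f"
    by (intro cmap_Un a b s closed_Times closed_Un cl) auto
  moreover have "(J \<times> {0} \<times> K \<union> J \<times> {1} \<times> K) \<union> J \<times> {0..1} \<times> dK = J \<times> prism_bdry K dK"
    by (auto simp: prism_bdry_def)
  ultimately show ?thesis by simp
qed

lemma closed_cube_boundary: "closed (cube_boundary n)"
  by (rule cell_closed_bdry[OF cell_unit_cube])

text \<open>The base point comes first: \<open>y\<close> is joined to some \<open>k b\<close> by a
  path \<open>l\<close>. Then each cube is lifted separately with the same boundary data
  \<open>b\<close> and \<open>l\<close>, so that the lifts and the homotopies stay pinched.\<close>

lemma bouquet_surj:
  assumes k: "weak_equivalence B D k" and W: "W \<in> bouquet_maps n I D"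
  shows "\<exists>U\<in>bouquet_maps n I B. (k \<circ> U, W) \<in> bouquet_rel n I D"
proof -
  let ?I = "{0..1::real}" and ?K = "unit_cube n" and ?dK = "cube_boundary n"
  obtain y where Wi: "\<And>i. i \<in> I \<Longrightarrow> cmap ?K D (\<lambda>x. W (i, x))" and y: "\<And>i x. i \<in> I \<Longrightarrow> x \<in> ?dK \<Longrightarrow> W (i, x) = y"
    using W unfolding bouquet_maps_iff by blast
  \<comment> \<open>If there is no index or no boundary point, there is no base point either, and
    the conditions on \<open>b\<close> and \<open>l\<close> are void.\<close>
  obtain b l where b: "\<And>i. i \<in> I \<Longrightarrow> cmap ?dK B (\<lambda>_. b) \<and> cmap (?I \<times> ?dK) D (\<lambda>z. l (fst z)) \<and>
      (\<forall>x\<in>?dK. l 0 = W (i, x) \<and> l 1 = k b)"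
  proof (cases "I \<times> ?dK = {}")
    case True
    then consider "I = {}" | "?dK = {}" by auto
    then show ?thesis
    proof cases
      case 1 then show ?thesis using that by simp
    next
      case 2 then show ?thesis using that by simp
    qed
  next
    case False
    then obtain i x where ix: "i \<in> I" "x \<in> ?dK" by auto
    then have "y \<in> topspace D" using cmap_in[OF Wi, of i x] y cube_boundary_subset by fastforce
    then obtain b where b: "b \<in> topspace B" "path_component_of D (k b) y"
      using k unfolding weak_equivalence_iff by blast
    then obtain g where g: "cmap ?I D g" "g 0 = y" "g 1 = k b"
      using path_component_of_sym[OF b(2)] unfolding path_component_of_def pathin_def by blast
    have "cmap (?I \<times> ?dK) D (\<lambda>z. g (fst z))"
      by (rule cmap_compose[OF g(1)]) (auto intro!: prod_continuous_intros)
    then show ?thesis using that[of b g] b g y by simp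
  qed
  let ?Q = "\<lambda>i \<alpha> H. cmap ?K B \<alpha> \<and> (\<forall>x\<in>?dK. \<alpha> x = b) \<and> cmap (?I \<times> ?K) D H \<and>
          (\<forall>x\<in>?K. H (0, x) = W (i, x) \<and> H (1, x) = k (\<alpha> x)) \<and>
          (\<forall>s\<in>?I. \<forall>x\<in>?dK. H (s, x) = l s)"
  have "\<exists>\<alpha> H. ?Q i \<alpha> H" if i: "i \<in> I" for i
    using lift_prop_cube[OF k, of n, unfolded lift_prop_def, THEN spec[of _ "\<lambda>_. b"],
        THEN spec[of _ "\<lambda>x. W (i, x)"], THEN spec[of _ "\<lambda>z. l (fst z)"], THEN mp] b[OF i] Wi[OF i]
    by simp
  then obtain \<alpha> where "\<forall>i\<in>I. \<exists>H. ?Q i (\<alpha> i) H"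
    using bchoice[of I "\<lambda>i \<alpha>. \<exists>H. ?Q i \<alpha> H"] by blast
  then obtain H where *: "\<forall>i\<in>I. ?Q i (\<alpha> i) (H i)"
    using bchoice[of I "\<lambda>i H. ?Q i (\<alpha> i) H"] by blast
  let ?U = "\<lambda>(i, x). \<alpha> i x"
  have U: "?U \<in> bouquet_maps n I B" unfolding bouquet_maps_iff using * by auto
  have "(W, k \<circ> ?U) \<in> bouquet_rel n I D"
    unfolding bouquet_rel_iff using * by (intro exI[of _ H]) auto
  then have "(k \<circ> ?U, W) \<in> bouquet_rel n I D" using equiv_bouquet by (meson equivE symE)
  then show ?thesis using U by blast
qed

text \<open>\<open>lift_prop_prism\<close> over a point, with constant homotopies at the two ends.
  It is used to move the track of a base point from \<open>D\<close> to \<open>B\<close>.\<close>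

lemma weak_equivalence_path_lift:
  assumes k: "weak_equivalence B D k" and b: "b \<in> topspace B" "b' \<in> topspace B"
    and l: "cmap {0..1::real} D l" "l 0 = k b" "l 1 = k b'"
  obtains \<mu> G where "cmap {0..1::real} B \<mu>" "\<mu> 0 = b" "\<mu> 1 = b'"
    "cmap ({0..1::real} \<times> {0..1::real}) D G" "\<And>s. s \<in> {0..1} \<Longrightarrow> G (0, s) = l s" "\<And>s. s \<in> {0..1} \<Longrightarrow> G (1, s) = k (\<mu> s)"
    "\<And>t. t \<in> {0..1} \<Longrightarrow> G (t, 0) = k b" "\<And>t. t \<in> {0..1} \<Longrightarrow> G (t, 1) = k b'"
proof -
  let ?I = "{0..1::real}" and ?o = "\<lambda>_::nat. 0::real"
  let ?K = "unit_cube 0" and ?dK = "cube_boundary 0"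
  have ck: "continuous_map B D k" using k by (rule weak_equivalence_continuous)
  have kb: "k b \<in> topspace D" "k b' \<in> topspace D" using ck b by (auto simp: continuous_map_def)
  define \<alpha> where "\<alpha> = (\<lambda>z::real \<times> (nat \<Rightarrow> real). if fst z = 0 then b else b')"
  have \<alpha>: "cmap (prism_bdry ?K ?dK) B \<alpha>"
    by (rule cmap_prism_bdry) (use b closed_unit_cube[of 0] in \<open>auto simp: \<alpha>_def\<close>)
  have \<beta>: "cmap (?I \<times> ?K) D (\<lambda>z. l (fst z))"
    by (rule cmap_compose[OF l(1)]) (auto intro!: prod_continuous_intros)
  have H: "cmap (?I \<times> prism_bdry ?K ?dK) D (\<lambda>z. k (\<alpha> (snd z)))"
    by (rule cmap_compose[OF cmap_post[OF \<alpha> ck]]) (auto intro!: prod_continuous_intros)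
  obtain \<alpha>' H' where *: "cmap (?I \<times> ?K) B \<alpha>'" "\<And>z. z \<in> prism_bdry ?K ?dK \<Longrightarrow> \<alpha>' z = \<alpha> z"
    "cmap (?I \<times> ?I \<times> ?K) D H'" "\<And>z. z \<in> ?I \<times> ?K \<Longrightarrow> H' (0, z) = l (fst z)"
    "\<And>z. z \<in> ?I \<times> ?K \<Longrightarrow> H' (1, z) = k (\<alpha>' z)"
    "\<And>s z. s \<in> ?I \<Longrightarrow> z \<in> prism_bdry ?K ?dK \<Longrightarrow> H' (s, z) = k (\<alpha> z)"
  proof (rule lift_propD[OF lift_prop_prism[OF k] \<alpha> \<beta> H], goal_cases)
    case (3 a B) then show thesis by (intro 3(1)[of a B]) simp_all
  qed (use l in \<open>auto simp: \<alpha>_def prism_bdry_def\<close>)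
  show thesis
  proof (rule that)
    show "cmap ?I B (\<lambda>s. \<alpha>' (s, ?o))"
      by (rule cmap_compose[OF *(1)]) (auto intro!: prod_continuous_intros)
    show "cmap (?I \<times> ?I) D (\<lambda>z. H' (fst z, snd z, ?o))"
      by (rule cmap_compose[OF *(3)]) (auto intro!: prod_continuous_intros)
  qed (use * in \<open>auto simp: prism_bdry_def \<alpha>_def\<close>)
qed

text \<open>The track of the base point during the homotopy is common to all cubes, so it is lifted
  once, to \<mu>. Each cube is then lifted over its prism with ends \<open>U\<close>,
  \<open>V\<close> and sides \<mu>, and the results agree along the boundary.\<close>

lemma bouquet_inj:
  assumes k: "weak_equivalence B D k" and U: "U \<in> bouquet_maps n I B" and V: "V \<in> bouquet_maps n I B"
    and UV: "(k \<circ> U, k \<circ> V) \<in> bouquet_rel n I D"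
  shows "(U, V) \<in> bouquet_rel n I B"
proof -
  let ?I = "{0..1::real}" and ?K = "unit_cube n" and ?dK = "cube_boundary n"
  have dK: "x \<in> ?K" if "x \<in> ?dK" for x using that cube_boundary_subset by blast
  have ck: "continuous_map B D k" using k by (rule weak_equivalence_continuous)
  obtain b b' where Ui: "\<And>i. i \<in> I \<Longrightarrow> cmap ?K B (\<lambda>x. U (i, x))" "\<And>i x. i \<in> I \<Longrightarrow> x \<in> ?dK \<Longrightarrow> U (i, x) = b"
    and Vi: "\<And>i. i \<in> I \<Longrightarrow> cmap ?K B (\<lambda>x. V (i, x))" "\<And>i x. i \<in> I \<Longrightarrow> x \<in> ?dK \<Longrightarrow> V (i, x) = b'"
    using U V unfolding bouquet_maps_iff by blast
  obtain H where H: "\<And>i. i \<in> I \<Longrightarrow> cmap (?I \<times> ?K) D (H i)" "\<And>i x. i \<in> I \<Longrightarrow> x \<in> ?K \<Longrightarrow> H i (0, x) = k (U (i, x))"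
     "\<And>i x. i \<in> I \<Longrightarrow> x \<in> ?K \<Longrightarrow> H i (1, x) = k (V (i, x))"
     and Hs: "\<forall>s\<in>?I. \<exists>y. \<forall>i\<in>I. \<forall>x\<in>?dK. H i (s, x) = y"
    using UV unfolding bouquet_rel_iff by auto
  obtain \<mu> G where \<mu>: "\<And>i. i \<in> I \<Longrightarrow> cmap (?I \<times> ?dK) B (\<lambda>z. \<mu> (fst z)) \<and>
      cmap (?I \<times> ?I \<times> ?dK) D (\<lambda>z. G (fst z, fst (snd z)))"
    and \<mu>': "\<And>i x. i \<in> I \<Longrightarrow> x \<in> ?dK \<Longrightarrow> \<mu> 0 = b \<and> \<mu> 1 = b' \<and>
      (\<forall>s\<in>?I. G (0, s) = H i (s, x) \<and> G (1, s) = k (\<mu> s)) \<and> (\<forall>t\<in>?I. G (t, 0) = k b \<and> G (t, 1) = k b')"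
  proof (cases "I \<times> ?dK = {}")
    case True
    then consider "I = {}" | "?dK = {}" by auto
    then show ?thesis
    proof cases
      case 1 then show ?thesis using that by simp
    next
      case 2 then show ?thesis using that by simp
    qed
  next
    case False
    then obtain j a where ja: "j \<in> I" "a \<in> ?dK" by auto
    have bB: "b \<in> topspace B" "b' \<in> topspace B"
      using cmap_in[OF Ui(1)[OF ja(1)] dK[OF ja(2)]] cmap_in[OF Vi(1)[OF ja(1)] dK[OF ja(2)]] Ui(2) Vi(2) ja by auto
    have l: "cmap ?I D (\<lambda>s. H j (s, a))"
      by (rule cmap_compose[OF H(1)[OF ja(1)]]) (use ja dK in \<open>auto intro!: prod_continuous_intros\<close>)
    have l0: "H j (0, a) = k b" "H j (1, a) = k b'" using H(2,3) Ui(2) Vi(2) ja dK by auto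
    have eq: "H i (s, x) = H j (s, a)" if "i \<in> I" "x \<in> ?dK" "s \<in> ?I" for i x s
      using Hs ja that by metis
    obtain \<mu> G where *: "cmap ?I B \<mu>" "\<mu> 0 = b" "\<mu> 1 = b'"
      "cmap (?I \<times> ?I) D G" "\<And>s. s \<in> ?I \<Longrightarrow> G (0, s) = H j (s, a)" "\<And>s. s \<in> ?I \<Longrightarrow> G (1, s) = k (\<mu> s)"
      "\<And>t. t \<in> ?I \<Longrightarrow> G (t, 0) = k b" "\<And>t. t \<in> ?I \<Longrightarrow> G (t, 1) = k b'"
    proof (rule weak_equivalence_path_lift[OF k bB l l0], goal_cases)
      case (1 m g) show thesis by (rule 1(1)[OF 1(2-)])
    qed
    have "cmap (?I \<times> ?dK) B (\<lambda>z. \<mu> (fst z))"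
      by (rule cmap_compose[OF *(1)]) (auto intro!: prod_continuous_intros)
    moreover have "cmap (?I \<times> ?I \<times> ?dK) D (\<lambda>z. G (fst z, fst (snd z)))"
      by (rule cmap_compose[OF *(4)]) (auto intro!: prod_continuous_intros)
    ultimately show ?thesis using that[of \<mu> G] * eq by simp
  qed
  have "\<exists>F. cmap (?I \<times> ?K) B F \<and> (\<forall>x\<in>?K. F (0, x) = U (i, x) \<and> F (1, x) = V (i, x)) \<and>
     (\<forall>s\<in>?I. \<forall>x\<in>?dK. F (s, x) = \<mu> s)" if i: "i \<in> I" for i
  proof -
    define \<alpha> where "\<alpha> = (\<lambda>(s::real, x). if s = 0 then U (i, x) else if s = 1 then V (i, x) else \<mu> s)"
    have \<alpha>: "cmap (prism_bdry ?K ?dK) B \<alpha>"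
    proof (rule cmap_prism_bdry[OF closed_unit_cube closed_cube_boundary])
      show "cmap ?K B (\<lambda>x. \<alpha> (0, x))" "cmap ?K B (\<lambda>x. \<alpha> (1, x))"
        using Ui(1)[OF i] Vi(1)[OF i] by (simp_all add: \<alpha>_def)
      show "cmap (?I \<times> ?dK) B \<alpha>"
        by (rule cmap_cong[OF conjunct1[OF \<mu>[OF i]]]) (use \<mu>' i Ui(2) Vi(2) in \<open>auto simp: \<alpha>_def\<close>)
    qed
    define E where "E = (\<lambda>(t::real, s::real, x). if s = 0 then k (U (i, x)) else if s = 1 then k (V (i, x)) else G (t, s))"
    have E: "cmap (?I \<times> prism_bdry ?K ?dK) D E"
    proof (rule cmap_Times_prism_bdry[OF _ closed_unit_cube closed_cube_boundary])
      show "cmap (?I \<times> ?K) D (\<lambda>z. E (fst z, 0, snd z))"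
        by (simp add: E_def, rule cmap_compose[OF cmap_post[OF Ui(1)[OF i] ck]])
          (auto intro!: prod_continuous_intros)
      show "cmap (?I \<times> ?K) D (\<lambda>z. E (fst z, 1, snd z))"
        by (simp add: E_def, rule cmap_compose[OF cmap_post[OF Vi(1)[OF i] ck]])
          (auto intro!: prod_continuous_intros)
      show "cmap (?I \<times> ?I \<times> ?dK) D E"
        by (rule cmap_cong[OF conjunct2[OF \<mu>[OF i]]]) (use \<mu>' i Ui(2) Vi(2) in \<open>auto simp: E_def\<close>)
    qed simp
    obtain F F' where F: "cmap (?I \<times> ?K) B F" "\<And>z. z \<in> prism_bdry ?K ?dK \<Longrightarrow> F z = \<alpha> z"
      "cmap (?I \<times> ?I \<times> ?K) D F'"
    proof (rule lift_propD[OF lift_prop_prism[OF k] \<alpha> H(1)[OF i] E], goal_cases)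
      case (3 a B) then show thesis by (intro 3(1)[of a B]) simp_all
    qed (use \<mu>' i H Ui(2) Vi(2) dK in \<open>auto simp: \<alpha>_def E_def prism_bdry_def\<close>)
    then show ?thesis
      using \<mu>' i Ui(2) Vi(2) by (intro exI[of _ F]) (auto simp: \<alpha>_def prism_bdry_def)
  qed
  then obtain F where F: "\<And>i. i \<in> I \<Longrightarrow> cmap (?I \<times> ?K) B (F i)"
     "\<And>i x. i \<in> I \<Longrightarrow> x \<in> ?K \<Longrightarrow> F i (0, x) = U (i, x) \<and> F i (1, x) = V (i, x)"
     "\<And>i s x. i \<in> I \<Longrightarrow> s \<in> ?I \<Longrightarrow> x \<in> ?dK \<Longrightarrow> F i (s, x) = \<mu> s" by metis
  then show ?thesis unfolding bouquet_rel_iff by (intro exI[of _ F]) auto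
qed

lemma set_functor_bouquet:
  fixes I :: "'i set"
  assumes U: "universe TYPE('u)" and I: "I \<prec> (UNIV :: 'u set)"
  shows "set_functor (bouquet_classes n I) (bouquet_classes_map n I :: 'u topology \<Rightarrow> _)"
  unfolding set_functor_def
proof (intro conjI allI impI ballI)
  fix X :: "'u topology" assume X: "small_space X"
  have "I \<times> unit_cube n \<prec> (UNIV :: 'u set)"
    using lesspoll_universe_Times[OF U I lesspoll_trans1[OF subset_imp_lepoll lesspoll_universe_nat_real[OF U]]] by blast
  then show "bouquet_classes n I X \<prec> (UNIV :: 'u set)"
    unfolding bouquet_classes_def
  proof (rule lesspoll_universe_quotient_functions[OF U _ _ equiv_bouquet])
    show "topspace X \<prec> (UNIV :: 'u set)" using X by (simp add: small_space_def small_set_def)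
    show "V ` (I \<times> unit_cube n) \<subseteq> topspace X" if "V \<in> bouquet_maps n I X" for V
      using that by (auto simp: bouquet_maps_def bouquet_dom_def continuous_map_def)
  qed (auto intro: bouquet_relI)
next
  fix X Y :: "'u topology" and f assume f: "continuous_map X Y f"
  show "bouquet_classes_map n I Y f ` bouquet_classes n I X \<subseteq> bouquet_classes n I Y"
    using bouquet_classes_map_class[OF f, where n = n and I = I] bouquet_maps_compose[OF f, where n = n and I = I]
    by (auto simp: bouquet_classes_def elim!: quotientE intro!: quotientI)
next
  fix X Y :: "'u topology" and f g c
  assume fg: "continuous_map X Y f \<and> continuous_map X Y g \<and> (\<forall>x\<in>topspace X. f x = g x)"
    and "c \<in> bouquet_classes n I X"
  then obtain V where V: "V \<in> bouquet_maps n I X" "c = bouquet_rel n I X `` {V}"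
    unfolding bouquet_classes_def by (auto elim: quotientE)
  have "(f \<circ> V, g \<circ> V) \<in> bouquet_rel n I Y"
  proof (rule bouquet_relI)
    show "f \<circ> V \<in> bouquet_maps n I Y" using fg V bouquet_maps_compose by blast
    show "(f \<circ> V) (i, x) = (g \<circ> V) (i, x)" if "i \<in> I" "x \<in> unit_cube n" for i x
      using fg V(1) that cmap_in[of "unit_cube n" X "\<lambda>x. V (i, x)" x] by (auto simp: bouquet_maps_iff)
  qed
  then show "bouquet_classes_map n I Y f c = bouquet_classes_map n I Y g c"
    using bouquet_classes_map_class fg V equiv_class_eq[OF equiv_bouquet] by metis
next
  fix X :: "'u topology" and c assume "c \<in> bouquet_classes n I X"
  then obtain V where V: "V \<in> bouquet_maps n I X" "c = bouquet_rel n I X `` {V}"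
    unfolding bouquet_classes_def by (auto elim: quotientE)
  have "continuous_map X X id" by (simp add: id_def)
  from bouquet_classes_map_class[OF this V(1)] show "bouquet_classes_map n I X id c = c"
    using V(2) by simp
next
  fix X Y Z :: "'u topology" and f g c
  assume fg: "continuous_map X Y f \<and> continuous_map Y Z g" and "c \<in> bouquet_classes n I X"
  then obtain V where V: "V \<in> bouquet_maps n I X" "c = bouquet_rel n I X `` {V}"
    unfolding bouquet_classes_def by (auto elim: quotientE)
  have f: "continuous_map X Y f" and g: "continuous_map Y Z g" using fg by auto
  show "bouquet_classes_map n I Z (g \<circ> f) c = bouquet_classes_map n I Z g (bouquet_classes_map n I Y f c)"
    unfolding V(2) bouquet_classes_map_class[OF f V(1)]
      bouquet_classes_map_class[OF continuous_map_compose[OF f g] V(1)]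
      bouquet_classes_map_class[OF g bouquet_maps_compose[OF f V(1)]] by (simp add: comp_assoc)
next
  fix X Y :: "'u topology" and f assume f: "weak_equivalence X Y f"
  show "bij_betw (bouquet_classes_map n I Y f) (bouquet_classes n I X) (bouquet_classes n I Y)"
    unfolding bij_betw_bouquet_classes_map_iff[OF weak_equivalence_continuous[OF f]]
    using bouquet_inj[OF f] bouquet_surj[OF f] by blast
qed

section \<open>Change of base point\<close>

lemma spheroid_transport:
  assumes \<gamma>: "cmap (unit_cube n) X \<gamma>" "\<And>x. x \<in> cube_boundary n \<Longrightarrow> \<gamma> x = l 0" and l: "cmap {0..1::real} X l"
  obtains T where "cmap ({0..1::real} \<times> unit_cube n) X T" "\<And>x. x \<in> unit_cube n \<Longrightarrow> T (0, x) = \<gamma> x"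
    "\<And>s x. s \<in> {0..1} \<Longrightarrow> x \<in> cube_boundary n \<Longrightarrow> T (s, x) = l s"
proof -
  have R: "cmap ({0..1::real} \<times> cube_boundary n) X (\<lambda>z. l (fst z))"
    by (rule cmap_compose[OF l]) (auto intro!: prod_continuous_intros)
  show thesis
  proof (rule fill[OF cell_unit_cube \<gamma>(1) R], goal_cases)
    case (2 T) then show thesis by (intro that[of T]) simp_all
  qed (simp add: \<gamma>)
qed

text \<open>Transport of spheroids along the track \<open>l\<close> is well defined on classes: two
  free homotopies with the same track and a homotopy between their starts bound a prism whose open
  face joins their ends. Along the reversed track this also shows that transport is
  injective.\<close>

lemma spheroid_rel_transport:
  assumes H: "cmap ({0..1::real} \<times> unit_cube n) X H" and H': "cmap ({0..1::real} \<times> unit_cube n) X H'"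
    and l: "\<And>s x. s \<in> {0..1} \<Longrightarrow> x \<in> cube_boundary n \<Longrightarrow> H (s, x) = l s"
      "\<And>s x. s \<in> {0..1} \<Longrightarrow> x \<in> cube_boundary n \<Longrightarrow> H' (s, x) = l s"
    and rel: "(\<lambda>x. H (0, x), \<lambda>x. H' (0, x)) \<in> spheroid_rel n X (l 0)"
  shows "(\<lambda>x. H (1, x), \<lambda>x. H' (1, x)) \<in> spheroid_rel n X (l 1)"
proof -
  let ?I = "{0..1::real}"
  obtain Q where Q: "cmap (?I \<times> unit_cube n) X Q" "\<And>x. x \<in> unit_cube n \<Longrightarrow> Q (0, x) = H (0, x)"
    "\<And>x. x \<in> unit_cube n \<Longrightarrow> Q (1, x) = H' (0, x)" "\<And>s x. s \<in> ?I \<Longrightarrow> x \<in> cube_boundary n \<Longrightarrow> Q (s, x) = l 0"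
    using rel unfolding spheroid_rel_iff by auto
  have R: "cmap (?I \<times> ?I \<times> cube_boundary n) X (\<lambda>z. H (fst z, snd (snd z)))"
    by (rule cmap_compose[OF H]) (use cube_boundary_subset[of n] in \<open>auto intro!: prod_continuous_intros\<close>)
  obtain F where F: "cmap (?I \<times> ?I \<times> unit_cube n) X F"
    "\<And>s x. s \<in> ?I \<Longrightarrow> x \<in> unit_cube n \<Longrightarrow> F (s, 0, x) = H (s, x)"
    "\<And>s x. s \<in> ?I \<Longrightarrow> x \<in> unit_cube n \<Longrightarrow> F (s, 1, x) = H' (s, x)"
    "\<And>s t x. s \<in> ?I \<Longrightarrow> t \<in> ?I \<Longrightarrow> x \<in> cube_boundary n \<Longrightarrow> F (s, t, x) = H (s, x)"
  proof (rule fill_square[OF cell_unit_cube H H' Q(1) R], goal_cases)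
    case (6 B) then show thesis by (intro 6(1)[of B]) simp_all
  qed (use Q l in auto)
  have "cmap (?I \<times> unit_cube n) X (\<lambda>z. F (1, z))"
    by (rule cmap_compose[OF F(1)]) (auto intro!: prod_continuous_intros)
  then show ?thesis
    unfolding spheroid_rel_iff using F l by (intro exI[of _ "\<lambda>z. F (1, z)"]) auto
qed

lemma cmap_reverse:
  assumes "cmap ({0..1::real} \<times> K) X H" shows "cmap ({0..1} \<times> K) X (\<lambda>z. H (1 - fst z, snd z))"
  by (rule cmap_compose[OF assms]) (auto intro!: prod_continuous_intros)

lemma spheroid_rel_transport_back:
  assumes H: "cmap ({0..1::real} \<times> unit_cube n) X H" and H': "cmap ({0..1::real} \<times> unit_cube n) X H'"
    and l: "\<And>s x. s \<in> {0..1} \<Longrightarrow> x \<in> cube_boundary n \<Longrightarrow> H (s, x) = l s"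
      "\<And>s x. s \<in> {0..1} \<Longrightarrow> x \<in> cube_boundary n \<Longrightarrow> H' (s, x) = l s"
    and rel: "(\<lambda>x. H (1, x), \<lambda>x. H' (1, x)) \<in> spheroid_rel n X (l 1)"
  shows "(\<lambda>x. H (0, x), \<lambda>x. H' (0, x)) \<in> spheroid_rel n X (l 0)"
  using spheroid_rel_transport[OF cmap_reverse[OF H] cmap_reverse[OF H'], of "\<lambda>s. l (1 - s)"] l rel by simp

lemma spheroid_rel_cong:
  assumes "(\<gamma>, \<delta>) \<in> spheroid_rel n X x" "\<And>y. y \<in> unit_cube n \<Longrightarrow> \<gamma>' y = \<gamma> y" "\<And>y. y \<in> unit_cube n \<Longrightarrow> \<delta>' y = \<delta> y"
  shows "(\<gamma>', \<delta>') \<in> spheroid_rel n X x"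
  using assms unfolding spheroid_rel_iff by simp

lemma bouquet_relE:
  assumes "(M, N) \<in> bouquet_rel n I X"
  obtains H where "\<And>i. i \<in> I \<Longrightarrow> cmap ({0..1::real} \<times> unit_cube n) X (H i)"
    "\<And>i x. i \<in> I \<Longrightarrow> x \<in> unit_cube n \<Longrightarrow> H i (0, x) = M (i, x)"
    "\<And>i x. i \<in> I \<Longrightarrow> x \<in> unit_cube n \<Longrightarrow> H i (1, x) = N (i, x)"
    "\<And>i j s x y. \<lbrakk>i \<in> I; j \<in> I; s \<in> {0..1}; x \<in> cube_boundary n; y \<in> cube_boundary n\<rbrakk> \<Longrightarrow> H i (s, x) = H j (s, y)"
proof -
  obtain H where H: "\<forall>i\<in>I. cmap ({0..1::real} \<times> unit_cube n) X (H i) \<and>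
     (\<forall>x\<in>unit_cube n. H i (0, x) = M (i, x) \<and> H i (1, x) = N (i, x))"
     "\<forall>s\<in>{0..1}. \<exists>y. \<forall>i\<in>I. \<forall>x\<in>cube_boundary n. H i (s, x) = y"
    using assms unfolding bouquet_rel_iff by (elim exE conjE)
  show thesis
  proof (rule that)
    show "H i (s, x) = H j (s, y)" if "i \<in> I" "j \<in> I" "s \<in> {0..1}" "x \<in> cube_boundary n" "y \<in> cube_boundary n" for i j s x y
      using H(2) that by metis
  qed (use H(1) in auto)
qed

lemma lesspoll_universe_homotopy_group:
  assumes U: "universe TYPE('u)" and X: "small_space (X :: 'u topology)"
  shows "homotopy_group n X x \<prec> (UNIV :: 'u set)"
  unfolding homotopy_group_def
proof (rule lesspoll_universe_quotient_functions[OF U _ _ equiv_spheroids])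
  show "unit_cube n \<prec> (UNIV :: 'u set)"
    using lesspoll_trans1[OF subset_imp_lepoll lesspoll_universe_nat_real[OF U]] by blast
  show "topspace X \<prec> (UNIV :: 'u set)" using X by (simp add: small_space_def small_set_def)
  show "\<gamma> ` unit_cube n \<subseteq> topspace X" if "\<gamma> \<in> spheroids n X x" for \<gamma>
    using cmap_in[OF spheroidsD(1)[OF that]] by auto
  show "(\<gamma>, \<delta>) \<in> spheroid_rel n X x"
    if "\<gamma> \<in> spheroids n X x" "\<And>z. z \<in> unit_cube n \<Longrightarrow> \<gamma> z = \<delta> z" for \<gamma> \<delta>
  proof (rule spheroid_rel_cong[where \<gamma> = \<gamma> and \<delta> = \<gamma>])
    show "(\<gamma>, \<gamma>) \<in> spheroid_rel n X x" using equiv_class_self[OF equiv_spheroids that(1)] by simp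
  qed (simp_all add: that(2))
qed

text \<open>Free homotopy classes of single spheroids do not detect weak equivalences, since they only see
  conjugacy classes. Bouquets do: two spheroids detect injectivity, and the bouquet of all elements
  of a homotopy group of the target detects surjectivity.\<close>

lemma weak_equivalence_if_bouquets:
  fixes k :: "'u \<Rightarrow> 'u"
  assumes U: "universe TYPE('u)" and k: "continuous_map B D k" and D: "small_space D"
    and bij: "\<And>n (I :: ((nat \<Rightarrow> real) \<Rightarrow> 'u) set set). I \<prec> (UNIV :: 'u set) \<Longrightarrow>
       bij_betw (bouquet_classes_map n I D k) (bouquet_classes n I B) (bouquet_classes n I D)"
  shows "weak_equivalence B D k"
proof -
  let ?I = "{0..1::real}" and ?o = "\<lambda>_::nat. 0::real"
  have kB: "k x \<in> topspace D" if "x \<in> topspace B" for x using k that by (auto simp: continuous_map_def)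
  have inj: "(M, N) \<in> bouquet_rel n I B"
    if "I \<prec> (UNIV :: 'u set)" "M \<in> bouquet_maps n I B" "N \<in> bouquet_maps n I B" "(k \<circ> M, k \<circ> N) \<in> bouquet_rel n I D"
    for n and I :: "((nat \<Rightarrow> real) \<Rightarrow> 'u) set set" and M N
    using bij[OF that(1), of n] that unfolding bij_betw_bouquet_classes_map_iff[OF k] by blast
  have surj: "\<exists>M\<in>bouquet_maps n I B. (k \<circ> M, N) \<in> bouquet_rel n I D"
    if "I \<prec> (UNIV :: 'u set)" "N \<in> bouquet_maps n I D"
    for n and I :: "((nat \<Rightarrow> real) \<Rightarrow> 'u) set set" and N
    using bij[OF that(1), of n] that unfolding bij_betw_bouquet_classes_map_iff[OF k] by blast
  have fin: "I \<prec> (UNIV :: 'u set)" if "finite I" for I :: "((nat \<Rightarrow> real) \<Rightarrow> 'u) set set"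
    using that infinite_universe[OF U] by (simp add: finite_lesspoll_infinite)
  have path: "path_component_of B b b'"
    if b: "b \<in> topspace B" "b' \<in> topspace B" and p: "path_component_of D (k b) (k b')" for b b'
  proof -
    \<comment> \<open>One index and dimension 0: a bouquet map is a point and a bouquet homotopy is
      a path.\<close>
    let ?J = "{{}} :: ((nat \<Rightarrow> real) \<Rightarrow> 'u) set set"
    obtain g where g: "cmap ?I D g" "g 0 = k b" "g 1 = k b'"
      using p unfolding path_component_of_def pathin_def by blast
    have "cmap (?I \<times> unit_cube 0) D (\<lambda>z. g (fst z))"
      by (rule cmap_compose[OF g(1)]) (auto intro!: prod_continuous_intros)
    then have "(k \<circ> (\<lambda>_. b), k \<circ> (\<lambda>_. b')) \<in> bouquet_rel 0 ?J D"
      unfolding bouquet_rel_iff using g by (intro exI[of _ "\<lambda>_ z. g (fst z)"]) auto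
    then have "(\<lambda>_. b, \<lambda>_. b') \<in> bouquet_rel 0 ?J B"
      using inj[of ?J "\<lambda>_. b" 0 "\<lambda>_. b'"] fin b by (simp add: bouquet_maps_iff)
    then obtain H where H: "cmap (?I \<times> unit_cube 0) B H" "H (0, ?o) = b" "H (1, ?o) = b'"
      unfolding bouquet_rel_iff by auto
    have "cmap ?I B (\<lambda>s. H (s, ?o))"
      by (rule cmap_compose[OF H(1)]) (auto intro!: prod_continuous_intros)
    then show ?thesis using H unfolding path_component_of_def pathin_def by blast
  qed
  show ?thesis unfolding weak_equivalence_iff
  proof (intro conjI ballI allI impI)
    show "continuous_map B D k" by (rule k)
    show "path_component_of B b b'" if "b \<in> topspace B" "b' \<in> topspace B" "path_component_of D (k b) (k b')" for b b'
      using path that by blast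
    show "\<exists>b\<in>topspace B. path_component_of D (k b) d" if d: "d \<in> topspace D" for d
    proof -
      let ?J = "{{}} :: ((nat \<Rightarrow> real) \<Rightarrow> 'u) set set"
      have "(\<lambda>_. d) \<in> bouquet_maps 0 ?J D" using d by (simp add: bouquet_maps_iff)
      then obtain M where M: "M \<in> bouquet_maps 0 ?J B" "(k \<circ> M, \<lambda>_. d) \<in> bouquet_rel 0 ?J D"
        using surj[of ?J "\<lambda>_. d" 0] fin by blast
      then obtain H where H: "cmap (?I \<times> unit_cube 0) D H" "H (0, ?o) = k (M ({}, ?o))" "H (1, ?o) = d"
        unfolding bouquet_rel_iff by auto
      have "cmap ?I D (\<lambda>s. H (s, ?o))"
        by (rule cmap_compose[OF H(1)]) (auto intro!: prod_continuous_intros)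
      then have "path_component_of D (k (M ({}, ?o))) d"
        using H unfolding path_component_of_def pathin_def by blast
      moreover have "M ({}, ?o) \<in> topspace B"
        using M(1) by (auto simp: bouquet_maps_iff dest: cmap_in)
      ultimately show ?thesis by blast
    qed
  next
    fix n :: nat and b \<gamma> \<gamma>'
    assume n: "1 \<le> n" and b: "b \<in> topspace B" and \<gamma>: "\<gamma> \<in> spheroids n B b" "\<gamma>' \<in> spheroids n B b"
      and rel: "(k \<circ> \<gamma>, k \<circ> \<gamma>') \<in> spheroid_rel n D (k b)"
    \<comment> \<open>The pairs (\<gamma>, \<gamma>') and (\<gamma>, \<gamma>) have homotopic
      images, so they are freely homotopic in \<open>B\<close>. The base point may trace a loop
      \<open>l\<close>, but transport along it takes both \<gamma> and \<gamma>' to \<gamma>, and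
      transport is injective. The indices \<open>{}\<close> and \<open>UNIV\<close> merely serve as
      two distinct sets.\<close>
    let ?J = "{{}, UNIV} :: ((nat \<Rightarrow> real) \<Rightarrow> 'u) set set"
    let ?M = "\<lambda>(i :: ((nat \<Rightarrow> real) \<Rightarrow> 'u) set, x). if i = {} then \<gamma> x else \<gamma>' x" and ?N = "\<lambda>(i, x). \<gamma> x"
    have MN: "?M \<in> bouquet_maps n ?J B" "?N \<in> bouquet_maps n ?J B"
      using spheroidsD[OF \<gamma>(1)] spheroidsD[OF \<gamma>(2)] by (auto simp: bouquet_maps_iff)
    obtain H where H: "cmap (?I \<times> unit_cube n) D H" "\<And>x. x \<in> unit_cube n \<Longrightarrow> H (0, x) = k (\<gamma> x)"
      "\<And>x. x \<in> unit_cube n \<Longrightarrow> H (1, x) = k (\<gamma>' x)"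
      "\<And>s x. s \<in> ?I \<Longrightarrow> x \<in> cube_boundary n \<Longrightarrow> H (s, x) = k b"
      using rel unfolding spheroid_rel_iff by auto
    have k\<gamma>: "cmap (?I \<times> unit_cube n) D (\<lambda>z. k (\<gamma> (snd z)))"
      by (rule cmap_compose[OF cmap_post[OF spheroidsD(1)[OF \<gamma>(1)] k]]) (auto intro!: prod_continuous_intros)
    have "(k \<circ> ?M, k \<circ> ?N) \<in> bouquet_rel n ?J D"
      unfolding bouquet_rel_iff
      by (rule exI[of _ "\<lambda>i. if i = {} then (\<lambda>z. k (\<gamma> (snd z))) else (\<lambda>z. H (1 - fst z, snd z))"])
        (use H k\<gamma> cmap_reverse[OF H(1)] spheroidsD[OF \<gamma>(1)] in \<open>auto intro!: exI[of _ "k b"]\<close>)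
    then have "(?M, ?N) \<in> bouquet_rel n ?J B" using inj[OF fin MN] by simp
    then obtain F where F: "\<And>i. i \<in> ?J \<Longrightarrow> cmap (?I \<times> unit_cube n) B (F i)"
      "\<And>i x. i \<in> ?J \<Longrightarrow> x \<in> unit_cube n \<Longrightarrow> F i (0, x) = ?M (i, x)"
      "\<And>i x. i \<in> ?J \<Longrightarrow> x \<in> unit_cube n \<Longrightarrow> F i (1, x) = ?N (i, x)"
      "\<And>i j s x y. \<lbrakk>i \<in> ?J; j \<in> ?J; s \<in> ?I; x \<in> cube_boundary n; y \<in> cube_boundary n\<rbrakk> \<Longrightarrow> F i (s, x) = F j (s, y)"
    proof (rule bouquet_relE, goal_cases)
      case (1 F) show thesis by (rule 1(1)[OF 1(2-)])
    qed
    define l where "l s = F {} (s, ?o)" for s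
    have o: "?o \<in> cube_boundary n" using n by (rule zero_in_cube_boundary)
    have l: "F i (s, x) = l s" if "i \<in> ?J" "s \<in> ?I" "x \<in> cube_boundary n" for i s x
      unfolding l_def by (rule F(4)) (use that o in auto)
    have "(\<lambda>x. F {} (1, x), \<lambda>x. F UNIV (1, x)) \<in> spheroid_rel n B (l 1)"
      by (rule spheroid_rel_cong[where \<gamma> = \<gamma> and \<delta> = \<gamma>])
        (use F(3)[of "{}"] F(3)[of UNIV] o cube_boundary_subset[of n] spheroidsD[OF \<gamma>(1)] equiv_class_self[OF equiv_spheroids \<gamma>(1)]
          in \<open>auto simp: l_def\<close>)
    then have "(\<lambda>x. F {} (0, x), \<lambda>x. F UNIV (0, x)) \<in> spheroid_rel n B (l 0)"
      by (intro spheroid_rel_transport_back) (use F(1) l in auto)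
    moreover have "l 0 = b" using F(2)[of "{}" ?o] spheroidsD(2)[OF \<gamma>(1) o] by (simp add: l_def)
    ultimately have "(\<lambda>x. F {} (0, x), \<lambda>x. F UNIV (0, x)) \<in> spheroid_rel n B b" by simp
    then show "(\<gamma>, \<gamma>') \<in> spheroid_rel n B b"
      by (rule spheroid_rel_cong) (use F(2)[of "{}"] F(2)[of UNIV] in auto)
  next
    fix n :: nat and b \<delta>
    assume n: "1 \<le> n" and b: "b \<in> topspace B" and \<delta>: "\<delta> \<in> spheroids n D (k b)"
    let ?K = "unit_cube n" and ?dK = "cube_boundary n"
    have o: "?o \<in> ?dK" "?o \<in> ?K" using n by (auto intro: zero_in_cube_boundary)
    define J where "J = homotopy_group n D (k b)"
    define rep where "rep c = (SOME \<gamma>. \<gamma> \<in> spheroids n D (k b) \<and> c = spheroid_rel n D (k b) `` {\<gamma>})" for c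
    have rep: "rep c \<in> spheroids n D (k b)" "c = spheroid_rel n D (k b) `` {rep c}" if "c \<in> J" for c
    proof -
      have "\<exists>\<gamma>. \<gamma> \<in> spheroids n D (k b) \<and> c = spheroid_rel n D (k b) `` {\<gamma>}"
        using that by (auto simp: J_def homotopy_group_def elim: quotientE)
      then have "rep c \<in> spheroids n D (k b) \<and> c = spheroid_rel n D (k b) `` {rep c}"
        unfolding rep_def by (rule someI_ex)
      then show "rep c \<in> spheroids n D (k b)" "c = spheroid_rel n D (k b) `` {rep c}" by auto
    qed
    have J: "J \<prec> (UNIV :: 'u set)"
      unfolding J_def by (rule lesspoll_universe_homotopy_group[OF U D])
    have N: "(\<lambda>(c, x). rep c x) \<in> bouquet_maps n J D"
      unfolding bouquet_maps_iff using spheroidsD[OF rep(1)] by auto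
    obtain M where M: "M \<in> bouquet_maps n J B" "(k \<circ> M, \<lambda>(c, x). rep c x) \<in> bouquet_rel n J D"
      using surj[OF J N] by blast
    obtain F where F': "\<And>c. c \<in> J \<Longrightarrow> cmap (?I \<times> ?K) D (F c)"
      "\<And>c x. c \<in> J \<Longrightarrow> x \<in> ?K \<Longrightarrow> F c (0, x) = (k \<circ> M) (c, x)"
      "\<And>c x. c \<in> J \<Longrightarrow> x \<in> ?K \<Longrightarrow> F c (1, x) = (\<lambda>(c, x). rep c x) (c, x)"
      "\<And>i j s x y. \<lbrakk>i \<in> J; j \<in> J; s \<in> ?I; x \<in> ?dK; y \<in> ?dK\<rbrakk> \<Longrightarrow> F i (s, x) = F j (s, y)"
    proof (rule bouquet_relE[OF M(2)], goal_cases)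
      case (1 F) show thesis by (rule 1(1)[OF 1(2-)])
    qed
    note F = F'[unfolded comp_apply case_prod_conv]
    obtain b' where M': "\<And>c. c \<in> J \<Longrightarrow> cmap ?K B (\<lambda>x. M (c, x))" "\<And>c x. c \<in> J \<Longrightarrow> x \<in> ?dK \<Longrightarrow> M (c, x) = b'"
      using M(1) unfolding bouquet_maps_iff by blast
    define c0 where "c0 = spheroid_rel n D (k b) `` {\<delta>}"
    have c0: "c0 \<in> J" unfolding c0_def J_def homotopy_group_def using \<delta> by (rule quotientI)
    define l where "l s = F c0 (s, ?o)" for s
    have l: "F c (s, x) = l s" if "c \<in> J" "s \<in> ?I" "x \<in> ?dK" for c s x
      unfolding l_def by (rule F(4)) (use that o c0 in auto)
    have lc: "cmap ?I D l"
      unfolding l_def by (rule cmap_compose[OF F(1)[OF c0]]) (use o in \<open>auto intro!: prod_continuous_intros\<close>)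
    have l01: "l 0 = k b'" "l 1 = k b"
      using F(2)[OF c0 o(2)] F(3)[OF c0 o(2)] M'(2)[OF c0 o(1)] spheroidsD(2)[OF rep(1)[OF c0] o(1)] by (simp_all add: l_def)
    have b': "b' \<in> topspace B" using cmap_in[OF M'(1)[OF c0] o(2)] M'(2)[OF c0 o(1)] by simp
    have "path_component_of D (k b') (k b)"
      unfolding path_component_of_def pathin_def using lc l01 by blast
    then have "path_component_of B b' b" using path b b' by blast
    then obtain p where p: "cmap ?I B p" "p 0 = b'" "p 1 = b"
      unfolding path_component_of_def pathin_def by blast
    \<comment> \<open>Move \<open>\<delta>\<close> from \<open>k b\<close> to \<open>k b'\<close> along \<open>k \<circ> p\<close> and back to \<open>k b\<close> along \<open>l\<close>; the class of the
      result is hit, and undoing the two moves gives a preimage of the class of \<open>\<delta>\<close>.\<close>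
    have kp: "cmap ?I D (\<lambda>s. k (p (1 - s)))"
      by (rule cmap_compose[OF cmap_post[OF p(1) k]]) (auto intro!: prod_continuous_intros)
    obtain T1 where T1: "cmap (?I \<times> ?K) D T1" "\<And>x. x \<in> ?K \<Longrightarrow> T1 (0, x) = \<delta> x"
      "\<And>s x. s \<in> ?I \<Longrightarrow> x \<in> ?dK \<Longrightarrow> T1 (s, x) = k (p (1 - s))"
    proof (rule spheroid_transport[OF spheroidsD(1)[OF \<delta>] _ kp], goal_cases)
      case (2 T) then show thesis by (intro 2(1)[of T]) simp_all
    qed (simp add: p spheroidsD(2)[OF \<delta>])
    have T1_end: "cmap ?K D (\<lambda>x. T1 (1, x))"
      by (rule cmap_compose[OF T1(1)]) (auto intro!: prod_continuous_intros)
    obtain T2 where T2: "cmap (?I \<times> ?K) D T2" "\<And>x. x \<in> ?K \<Longrightarrow> T2 (0, x) = T1 (1, x)"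
      "\<And>s x. s \<in> ?I \<Longrightarrow> x \<in> ?dK \<Longrightarrow> T2 (s, x) = l s"
    proof (rule spheroid_transport[OF T1_end _ lc], goal_cases)
      case (2 T) then show thesis by (intro 2(1)[of T]) simp_all
    qed (simp add: T1 p l01)
    define \<eta> where "\<eta> = (\<lambda>x. T2 (1, x))"
    have \<eta>: "\<eta> \<in> spheroids n D (k b)"
    proof (rule spheroidsI)
      show "cmap ?K D \<eta>" unfolding \<eta>_def
        by (rule cmap_compose[OF T2(1)]) (auto intro!: prod_continuous_intros)
    qed (simp add: \<eta>_def T2 l01)
    define c where "c = spheroid_rel n D (k b) `` {\<eta>}"
    have c: "c \<in> J" unfolding c_def J_def homotopy_group_def using \<eta> by (rule quotientI)
    have "(rep c, \<eta>) \<in> spheroid_rel n D (k b)"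
      using eq_equiv_class[OF _ equiv_spheroids \<eta>] rep(2)[OF c] unfolding c_def by simp
    then have "(\<lambda>x. F c (1, x), \<lambda>x. T2 (1, x)) \<in> spheroid_rel n D (l 1)"
      unfolding l01 by (rule spheroid_rel_cong) (use F(3)[OF c] in \<open>auto simp: \<eta>_def\<close>)
    then have "(\<lambda>x. F c (0, x), \<lambda>x. T2 (0, x)) \<in> spheroid_rel n D (l 0)"
      by (intro spheroid_rel_transport_back F(1)[OF c] T2(1)) (use l[OF c] T2(3) in auto)
    then have r1: "(\<lambda>x. k (M (c, x)), \<lambda>x. T1 (1, x)) \<in> spheroid_rel n D (k b')"
      unfolding l01 by (rule spheroid_rel_cong) (use F(2)[OF c] T2(2) in auto)
    obtain T3 where T3: "cmap (?I \<times> ?K) B T3" "\<And>x. x \<in> ?K \<Longrightarrow> T3 (0, x) = M (c, x)"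
      "\<And>s x. s \<in> ?I \<Longrightarrow> x \<in> ?dK \<Longrightarrow> T3 (s, x) = p s"
    proof (rule spheroid_transport[OF M'(1)[OF c] _ p(1)], goal_cases)
      case (2 T) then show thesis by (intro 2(1)[of T]) simp_all
    qed (simp add: M'(2)[OF c] p)
    have "(\<lambda>x. k (T3 (1, x)), \<lambda>x. (\<lambda>z. T1 (1 - fst z, snd z)) (1, x)) \<in> spheroid_rel n D (k (p 1))"
    proof (rule spheroid_rel_transport[OF cmap_post[OF T3(1) k] cmap_reverse[OF T1(1)]])
      show "(\<lambda>x. k (T3 (0, x)), \<lambda>x. T1 (1 - fst (0, x), snd (0, x))) \<in> spheroid_rel n D (k (p 0))"
        using r1 unfolding p by (rule spheroid_rel_cong) (auto simp: T3)
    qed (use T1 T3 in auto)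
    then have "(k \<circ> (\<lambda>x. T3 (1, x)), \<delta>) \<in> spheroid_rel n D (k b)"
      unfolding p by (rule spheroid_rel_cong) (auto simp: T1)
    moreover have "(\<lambda>x. T3 (1, x)) \<in> spheroids n B b"
    proof (rule spheroidsI)
      show "cmap ?K B (\<lambda>x. T3 (1, x))"
        by (rule cmap_compose[OF T3(1)]) (auto intro!: prod_continuous_intros)
    qed (simp add: T3 p)
    ultimately show "\<exists>\<gamma>\<in>spheroids n B b. (k \<circ> \<gamma>, \<delta>) \<in> spheroid_rel n D (k b)" by blast
  qed
qed

section \<open>Double powers of set-valued functors\<close>

context square_diagram
begin

text \<open>Surjectivity on path components, unpacked: the point (b, c, l) of the homotopy pullback
  is joined to the image of some \<open>a\<close>, and a path there consists of \<open>p\<close>,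
  \<open>q\<close> and the square \<open>H\<close>. The first coordinate of \<open>H\<close> runs
  along \<open>l\<close>, the second is the parameter of the path.\<close>

lemma cartesian_surj:
  assumes cart: "cartesian 2 \<X>" and b: "b \<in> topspace B" and c: "c \<in> topspace C"
    and l: "cmap {0..1::real} D l" "l 0 = h b" "l 1 = k c"
  obtains a p q H where "a \<in> topspace A" "cmap {0..1::real} B p" "p 0 = f a" "p 1 = b"
    "cmap {0..1::real} C q" "q 0 = g a" "q 1 = c"
    "cmap ({0..1::real} \<times> {0..1::real}) D H"
    "\<And>s. s \<in> {0..1} \<Longrightarrow> H (s, 0) = h (f a)" "\<And>s. s \<in> {0..1} \<Longrightarrow> H (s, 1) = l s"
    "\<And>t. t \<in> {0..1} \<Longrightarrow> H (0, t) = h (p t)" "\<And>t. t \<in> {0..1} \<Longrightarrow> H (1, t) = k (q t)"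
proof -
  let ?I = "{0..1::real}"
  have "cmap (?I \<times> {0::real}) D (\<lambda>z. l (fst z))"
    by (rule cmap_compose[OF l(1)]) (auto intro!: prod_continuous_intros)
  then have "cmap {0::real} P (\<lambda>_. holim_pt b c l)"
    using continuous_map_holim_pt[of "top_of_set {0::real}" "\<lambda>_. b" "\<lambda>_. c" "\<lambda>z. l (fst z)"] b c l by simp
  then have "holim_pt b c l \<in> topspace P" by (rule cmap_in) simp
  then obtain a where a: "a \<in> topspace A" "path_component_of P (to_holim 2 \<X> a) (holim_pt b c l)"
    using cart unfolding cartesian_def weak_equivalence_iff by blast
  then obtain \<phi> where \<phi>: "cmap ?I P \<phi>" "\<phi> 0 = to_holim 2 \<X> a" "\<phi> 1 = holim_pt b c l"
    unfolding path_component_of_def pathin_def by blast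
  have \<phi>P: "\<phi> t \<in> topspace P" if "t \<in> ?I" for t using \<phi>(1) that by (rule cmap_in)
  have "continuous_map (prod_topology (top_of_set ?I) (top_of_set ?I)) (prod_topology (top_of_set ?I) P)
      (\<lambda>z. (fst z, \<phi> (snd z)))"
    unfolding continuous_map_pairwise o_def fst_conv snd_conv
    by (intro conjI continuous_map_fst continuous_map_compose[OF continuous_map_snd \<phi>(1), unfolded o_def])
  from continuous_map_compose[OF this holim_components(3)]
  have H: "cmap (?I \<times> ?I) D (\<lambda>z. \<phi> (snd z) {0, Suc 0} (edge_pt (fst z)))"
    by (simp add: o_def case_prod_unfold)
  show thesis
    by (rule that[OF a(1) cmap_post[OF \<phi>(1) holim_components(1)] _ _ cmap_post[OF \<phi>(1) holim_components(2)] _ _ H])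
      (use a \<phi> holim_ends[OF \<phi>P] in \<open>simp_all add: to_holim_eq\<close>)
qed

lemma cartesian_inj:
  assumes cart: "cartesian 2 \<X>" and a: "a \<in> topspace A" "a' \<in> topspace A" and eq: "f a = f a'" "g a = g a'"
  shows "path_component_of A a a'"
proof -
  have "to_holim 2 \<X> a = to_holim 2 \<X> a'" using a eq by (simp add: to_holim_eq)
  moreover have "to_holim 2 \<X> a \<in> topspace P" using continuous_to_holim a by (auto simp: continuous_map_def)
  ultimately have "path_component_of P (to_holim 2 \<X> a) (to_holim 2 \<X> a')"
    by (simp add: path_component_of_refl)
  then show ?thesis using cart a unfolding cartesian_def weak_equivalence_iff by blast
qed

end



text \<open>Values of \<open>G\<close> live over another type. Each small one is copied into
  \<open>'u\<close> along a chosen injection \<open>e X\<close> and given the transported topology.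
  The injections are chosen independently, as \<open>on_map\<close> decodes, applies
  \<open>gm\<close> and encodes again.\<close>

lemma homotopy_functor_encode:
  fixes G :: "'u topology \<Rightarrow> 'w topology"
  assumes small: "\<And>X. small_space X \<Longrightarrow> topspace (G X) \<prec> (UNIV :: 'u set)"
    and cont: "\<And>X Y f. continuous_map X Y f \<Longrightarrow> continuous_map (G X) (G Y) (gm X Y f)"
    and cong: "\<And>X Y f f' w. \<lbrakk>continuous_map X Y f; continuous_map X Y f'; \<forall>x\<in>topspace X. f x = f' x;
      w \<in> topspace (G X)\<rbrakk> \<Longrightarrow> gm X Y f w = gm X Y f' w"
    and id: "\<And>X w. w \<in> topspace (G X) \<Longrightarrow> gm X X id w = w"
    and comp: "\<And>X Y Z f f' w. \<lbrakk>continuous_map X Y f; continuous_map Y Z f'; w \<in> topspace (G X)\<rbrakk> \<Longrightarrow>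
      gm X Z (f' \<circ> f) w = gm Y Z f' (gm X Y f w)"
    and we: "\<And>X Y f. weak_equivalence X Y f \<Longrightarrow> weak_equivalence (G X) (G Y) (gm X Y f)"
  obtains F e d where "homotopy_functor (F :: 'u top_functor)"
    "\<And>X. small_space X \<Longrightarrow> homeomorphic_maps (G X) (on_space F X) (e X) (d X)"
    "\<And>X Y f. on_map F X Y f = e Y \<circ> gm X Y f \<circ> d X"
proof -
  have "\<exists>e :: 'w \<Rightarrow> 'u. inj_on e (topspace (G X))" if "small_space X" for X
    using small[OF that] by (auto simp: lesspoll_def lepoll_def)
  then obtain e :: "'u topology \<Rightarrow> 'w \<Rightarrow> 'u" where e: "\<And>X. small_space X \<Longrightarrow> inj_on (e X) (topspace (G X))"
    by metis
  define d where "d X = inv_into (topspace (G X)) (e X)" for X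
  define F where "F = \<lparr>on_space = (\<lambda>X. pullback_topology (e X ` topspace (G X)) (d X) (G X)),
    on_map = (\<lambda>X Y f. e Y \<circ> gm X Y f \<circ> d X)\<rparr>"
  have F: "on_space F X = pullback_topology (e X ` topspace (G X)) (d X) (G X)"
    "on_map F X Y f = e Y \<circ> gm X Y f \<circ> d X" for X Y f
    by (simp_all add: F_def)
  have de: "d X (e X w) = w" if "small_space X" "w \<in> topspace (G X)" for X w
    using e[OF that(1)] that(2) by (simp add: d_def)
  have top: "topspace (on_space F X) = e X ` topspace (G X)" if "small_space X" for X
    using de[OF that] by (auto simp: F topspace_pullback_topology)
  have ed: "homeomorphic_maps (G X) (on_space F X) (e X) (d X)" if X: "small_space X" for X
    unfolding homeomorphic_maps_def
  proof (intro conjI ballI)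
    have "continuous_map (G X) (G X) (d X \<circ> e X)"
      by (rule continuous_map_eq[of _ _ id]) (use de[OF X] in \<open>auto simp: id_def\<close>)
    then show "continuous_map (G X) (on_space F X) (e X)"
      unfolding F by (rule continuous_map_pullback') auto
    have "continuous_map (G X) (G X) id" by (simp add: id_def)
    from continuous_map_pullback[OF this, of "e X ` topspace (G X)" "d X"]
    show "continuous_map (on_space F X) (G X) (d X)" unfolding F by simp
    show "d X (e X w) = w" if "w \<in> topspace (G X)" for w using de[OF X that] .
    show "e X (d X y) = y" if "y \<in> topspace (on_space F X)" for y using that de[OF X] unfolding top[OF X] by auto
  qed
  have ce: "continuous_map (G X) (on_space F X) (e X)" and cd: "continuous_map (on_space F X) (G X) (d X)"
    if "small_space X" for X using ed[OF that] by (auto simp: homeomorphic_maps_def)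
  have dG: "d X y \<in> topspace (G X)" and ed': "e X (d X y) = y" if "small_space X" "y \<in> topspace (on_space F X)" for X y
    using that ed[OF that(1)] cd[OF that(1)] by (auto simp: homeomorphic_maps_def continuous_map_def)
  have gG: "gm X Y f w \<in> topspace (G Y)" if "continuous_map X Y f" "w \<in> topspace (G X)" for X Y f w
    using cont[OF that(1)] that(2) by (auto simp: continuous_map_def)
  have isF: "is_functor F" unfolding is_functor_def
  proof (intro conjI allI impI ballI)
    fix X :: "'u topology" assume X: "small_space X"
    show "small_space (on_space F X)"
      unfolding small_space_def small_set_def top[OF X] using small[OF X] e[OF X] by simp
  next
    fix X Y :: "'u topology" and f assume "small_space X \<and> small_space Y \<and> continuous_map X Y f"
    then show "continuous_map (on_space F X) (on_space F Y) (on_map F X Y f)"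
      unfolding F(2) by (intro continuous_map_compose[OF _ ce] continuous_map_compose[OF cd] cont) auto
  next
    fix X Y :: "'u topology" and f f' x
    assume "small_space X \<and> small_space Y \<and> continuous_map X Y f \<and> continuous_map X Y f' \<and>
      (\<forall>x\<in>topspace X. f x = f' x)" "x \<in> topspace (on_space F X)"
    then show "on_map F X Y f x = on_map F X Y f' x"
      using cong[of X Y f f' "d X x"] dG[of X x] by (simp add: F(2))
  next
    fix X :: "'u topology" and x assume "small_space X" "x \<in> topspace (on_space F X)"
    then show "on_map F X X id x = x" using id[OF dG] ed' by (simp only: F(2) comp_apply)
  next
    fix X Y Z :: "'u topology" and f f' x
    assume "small_space X \<and> small_space Y \<and> small_space Z \<and> continuous_map X Y f \<and> continuous_map Y Z f'"
      "x \<in> topspace (on_space F X)"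
    then have *: "gm X Z (f' \<circ> f) (d X x) = gm Y Z f' (gm X Y f (d X x))"
      "d Y (e Y (gm X Y f (d X x))) = gm X Y f (d X x)"
      using comp[of X Y f Z f' "d X x"] dG[of X x] de[of Y] gG[of X Y f "d X x"] by blast+
    have "on_map F X Z (f' \<circ> f) x = e Z (gm X Z (f' \<circ> f) (d X x))"
      "on_map F Y Z f' (on_map F X Y f x) = e Z (gm Y Z f' (d Y (e Y (gm X Y f (d X x)))))"
      by (simp_all only: F(2) comp_apply)
    then show "on_map F X Z (f' \<circ> f) x = on_map F Y Z f' (on_map F X Y f x)"
      by (simp only: *)
  qed
  have "homotopy_functor F" unfolding homotopy_functor_def
  proof (intro conjI isF allI impI)
    fix X Y :: "'u topology" and f assume *: "small_space X \<and> small_space Y \<and> weak_equivalence X Y f"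
    then have X: "small_space X" and Y: "small_space Y" by auto
    have "weak_equivalence (G Y) (on_space F Y) (e Y)" "weak_equivalence (on_space F X) (G X) (d X)"
      using weak_equivalence_homeomorphic_maps ed[OF Y] ed[OF X] homeomorphic_maps_sym by blast+
    then show "weak_equivalence (on_space F X) (on_space F Y) (on_map F X Y f)"
      unfolding F(2) using we * by (intro weak_equivalence_compose[of _ "G X"] weak_equivalence_compose[of _ "G Y"]) auto
  qed
  then show thesis using that ed F(2) by blast
qed

section \<open>The double power functor\<close>

definition pre :: "('v \<Rightarrow> 'v) \<Rightarrow> 'v set \<Rightarrow> 'v set \<Rightarrow> 'v set" where
  "pre u S T = {s \<in> S. u s \<in> T}"

text \<open>Signs and circle are both subsets of the complex plane, so one construction covers the
  two choices of \<open>M\<close>.\<close>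

definition power_space :: "complex set \<Rightarrow> 'v set \<Rightarrow> ('v set \<Rightarrow> complex) topology" where
  "power_space M S = product_topology (\<lambda>_. top_of_set M) (Pow S)"

text \<open>Taking preimages is contravariant, and so is passing to functions on the power set;
  together they are covariant.\<close>

definition power_map :: "('v \<Rightarrow> 'v) \<Rightarrow> 'v set \<Rightarrow> 'v set \<Rightarrow> ('v set \<Rightarrow> complex) \<Rightarrow> 'v set \<Rightarrow> complex" where
  "power_map u S S' w = (\<lambda>T\<in>Pow S'. w (pre u S T))"

lemma pre_in_Pow: "pre u S T \<in> Pow S"
  by (auto simp: pre_def)

lemma topspace_power_space: "topspace (power_space M S) = Pow S \<rightarrow>\<^sub>E M"
  by (simp add: power_space_def)

lemma continuous_map_power_map: "continuous_map (power_space M S) (power_space M S') (power_map u S S')"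
  unfolding power_space_def continuous_map_componentwise
proof (intro conjI ballI)
  fix T assume T: "T \<in> Pow S'"
  have "continuous_map (product_topology (\<lambda>_. top_of_set M) (Pow S)) (top_of_set M) (\<lambda>w. w (pre u S T))"
    by (rule continuous_map_product_projection[OF pre_in_Pow])
  then show "continuous_map (product_topology (\<lambda>_. top_of_set M) (Pow S)) (top_of_set M) (\<lambda>w. power_map u S S' w T)"
    using T unfolding power_map_def by (simp del: Pow_iff)
qed (auto simp: power_map_def)

lemma power_map_id: "w \<in> topspace (power_space M S) \<Longrightarrow> (\<And>s. s \<in> S \<Longrightarrow> u s = s) \<Longrightarrow> power_map u S S w = w"
  unfolding topspace_power_space
  by (rule PiE_ext[where k = "Pow S" and s = "\<lambda>_. UNIV"])
    (auto simp: power_map_def pre_def PiE_def intro!: arg_cong[of _ _ w])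

lemma power_map_comp:
  "u ` S \<subseteq> S' \<Longrightarrow> power_map (v \<circ> u) S S'' w = power_map v S' S'' (power_map u S S' w)"
  unfolding power_map_def
  by (rule restrict_ext) (auto simp: pre_def intro!: arg_cong[of _ _ w])

lemma power_map_cong: "(\<And>s. s \<in> S \<Longrightarrow> u s = v s) \<Longrightarrow> power_map u S S' w = power_map v S S' w"
proof -
  assume "\<And>s. s \<in> S \<Longrightarrow> u s = v s"
  then have "pre u S = pre v S" by (auto simp: pre_def fun_eq_iff)
  then show ?thesis by (simp add: power_map_def)
qed

lemma weak_equivalence_power_map:
  assumes "bij_betw u S S'" shows "weak_equivalence (power_space M S) (power_space M S') (power_map u S S')"
proof (rule weak_equivalence_homeomorphic_maps)
  let ?v = "inv_into S u"
  have uv: "?v ` S' \<subseteq> S" "u ` S \<subseteq> S'" "\<And>s. s \<in> S \<Longrightarrow> ?v (u s) = s" "\<And>s. s \<in> S' \<Longrightarrow> u (?v s) = s"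
    using assms bij_betw_inv_into[OF assms] by (auto simp: bij_betw_def f_inv_into_f)
  show "homeomorphic_maps (power_space M S) (power_space M S') (power_map u S S') (power_map ?v S' S)"
    unfolding homeomorphic_maps_def
    by (intro conjI continuous_map_power_map ballI)
      (use uv in \<open>simp_all add: power_map_id flip: power_map_comp[OF uv(1)] power_map_comp[OF uv(2)]\<close>)
qed

lemma lesspoll_universe_power_space:
  fixes S :: "'v set"
  assumes U: "universe TYPE('u)" and S: "S \<prec> (UNIV :: 'u set)"
  shows "topspace (power_space M S) \<prec> (UNIV :: 'u set)"
proof -
  define G where "G w = {(T, w T) |T. T \<in> Pow S}" for w :: "'v set \<Rightarrow> complex"
  have "inj_on G (Pow S \<rightarrow>\<^sub>E M)"
  proof (rule inj_onI)
    fix w w' assume w: "w \<in> Pow S \<rightarrow>\<^sub>E M" "w' \<in> Pow S \<rightarrow>\<^sub>E M" "G w = G w'"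
    have "w T = w' T" if "T \<in> Pow S" for T
    proof -
      have "(T, w T) \<in> G w'" unfolding w(3)[symmetric] using that unfolding G_def by blast
      then show ?thesis unfolding G_def by blast
    qed
    then show "w = w'" by (rule PiE_ext[OF w(1,2)])
  qed
  moreover have "G ` (Pow S \<rightarrow>\<^sub>E M) \<subseteq> Pow (Pow S \<times> (UNIV :: complex set))" by (auto simp: G_def)
  ultimately have "Pow S \<rightarrow>\<^sub>E M \<lesssim> Pow (Pow S \<times> (UNIV :: complex set))" unfolding lepoll_def by blast
  moreover have "Pow (Pow S \<times> (UNIV :: complex set)) \<prec> (UNIV :: 'u set)"
    by (intro lesspoll_universe_Pow[OF U] lesspoll_universe_Times[OF U] S lesspoll_universe_complex[OF U])
  ultimately show ?thesis unfolding topspace_power_space using lesspoll_trans1 by blast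
qed

lemma set_functorD:
  assumes "set_functor ob mor"
  shows "\<And>X :: 'u topology. small_space X \<Longrightarrow> ob X \<prec> (UNIV :: 'u set)"
    "\<And>X Y f. continuous_map X Y f \<Longrightarrow> mor Y f ` ob X \<subseteq> ob Y"
    "\<And>X Y f g c. \<lbrakk>continuous_map X Y f; continuous_map X Y g; \<forall>x\<in>topspace X. f x = g x; c \<in> ob X\<rbrakk> \<Longrightarrow>
       mor Y f c = mor Y g c"
    "\<And>X c. c \<in> ob X \<Longrightarrow> mor X id c = c"
    "\<And>X Y Z f g c. \<lbrakk>continuous_map X Y f; continuous_map Y Z g; c \<in> ob X\<rbrakk> \<Longrightarrow>
       mor Z (g \<circ> f) c = mor Z g (mor Y f c)"
    "\<And>X Y f. weak_equivalence X Y f \<Longrightarrow> bij_betw (mor Y f) (ob X) (ob Y)"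
proof -
  note * = assms[unfolded set_functor_def]
  show "\<And>X :: 'u topology. small_space X \<Longrightarrow> ob X \<prec> (UNIV :: 'u set)"
    using *[THEN conjunct1] by blast
  show "\<And>X Y f. continuous_map X Y f \<Longrightarrow> mor Y f ` ob X \<subseteq> ob Y"
    using *[THEN conjunct2, THEN conjunct1] by blast
  show "\<And>X Y f g c. \<lbrakk>continuous_map X Y f; continuous_map X Y g; \<forall>x\<in>topspace X. f x = g x; c \<in> ob X\<rbrakk> \<Longrightarrow>
       mor Y f c = mor Y g c"
    using *[THEN conjunct2, THEN conjunct2, THEN conjunct1] by blast
  show "\<And>X c. c \<in> ob X \<Longrightarrow> mor X id c = c"
    using *[THEN conjunct2, THEN conjunct2, THEN conjunct2, THEN conjunct1] by blast
  show "\<And>X Y Z f g c. \<lbrakk>continuous_map X Y f; continuous_map Y Z g; c \<in> ob X\<rbrakk> \<Longrightarrow>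
       mor Z (g \<circ> f) c = mor Z g (mor Y f c)"
    using *[THEN conjunct2, THEN conjunct2, THEN conjunct2, THEN conjunct2, THEN conjunct1] by blast
  show "\<And>X Y f. weak_equivalence X Y f \<Longrightarrow> bij_betw (mor Y f) (ob X) (ob Y)"
    using *[THEN conjunct2, THEN conjunct2, THEN conjunct2, THEN conjunct2, THEN conjunct2] by blast
qed

lemma set_functor_prod:
  assumes U: "universe TYPE('u)"
    and F: "set_functor ob (mor :: 'u topology \<Rightarrow> _)" and F': "set_functor ob' (mor' :: 'u topology \<Rightarrow> _)"
  shows "set_functor (\<lambda>X. ob X \<times> ob' X) (\<lambda>Y f. map_prod (mor Y f) (mor' Y f))"
proof -
  note D = set_functorD[OF F] and D' = set_functorD[OF F']
  show ?thesis unfolding set_functor_def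
  proof (intro conjI allI impI ballI)
    show "ob X \<times> ob' X \<prec> (UNIV :: 'u set)" if "small_space X" for X
      using D(1)[OF that] D'(1)[OF that] by (rule lesspoll_universe_Times[OF U])
    show "map_prod (mor Y f) (mor' Y f) ` (ob X \<times> ob' X) \<subseteq> ob Y \<times> ob' Y" if "continuous_map X Y f" for X Y f
      using D(2)[OF that] D'(2)[OF that] by auto
    show "map_prod (mor Y f) (mor' Y f) c = map_prod (mor Y g) (mor' Y g) c"
      if "continuous_map X Y f \<and> continuous_map X Y g \<and> (\<forall>x\<in>topspace X. f x = g x)" "c \<in> ob X \<times> ob' X" for X Y f g c
      using that D(3)[of X Y f g] D'(3)[of X Y f g] by auto
    show "map_prod (mor X id) (mor' X id) c = c" if "c \<in> ob X \<times> ob' X" for X c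
      using that D(4) D'(4) by auto
    show "map_prod (mor Z (g \<circ> f)) (mor' Z (g \<circ> f)) c = map_prod (mor Z g) (mor' Z g) (map_prod (mor Y f) (mor' Y f) c)"
      if "continuous_map X Y f \<and> continuous_map Y Z g" "c \<in> ob X \<times> ob' X" for X Y Z f g c
      using that D(5)[of X Y f Z g] D'(5)[of X Y f Z g] by auto
    show "bij_betw (map_prod (mor Y f) (mor' Y f)) (ob X \<times> ob' X) (ob Y \<times> ob' Y)" if "weak_equivalence X Y f" for X Y f
      using D(6)[OF that] D'(6)[OF that] by (rule bij_betw_map_prod)
  qed
qed

section \<open>Absolutely cartesian squares under double powers\<close>

locale absolute_square =
  fixes A B C D :: "'u topology" and f g h k :: "'u \<Rightarrow> 'u"
  assumes U: "universe TYPE('u)"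
    and small: "small_space A" "small_space B" "small_space C" "small_space D"
    and cont: "continuous_map A B f" "continuous_map A C g" "continuous_map B D h" "continuous_map C D k"
    and comm: "\<And>a. a \<in> topspace A \<Longrightarrow> h (f a) = k (g a)"
    and ac: "absolutely_cartesian 2 (square_cube A B C D f g h k)"

locale absolute_square_functor = absolute_square A B C D f g h k
  for A B C D :: "'u topology" and f g h k :: "'u \<Rightarrow> 'u" +
  fixes ob :: "'u topology \<Rightarrow> 'v set" and mor :: "'u topology \<Rightarrow> ('u \<Rightarrow> 'u) \<Rightarrow> 'v \<Rightarrow> 'v"
  assumes sf: "set_functor ob mor"
begin

lemma power_homotopy_functor:
  obtains F e d where "homotopy_functor (F :: 'u top_functor)"
    "\<And>X. small_space X \<Longrightarrow> homeomorphic_maps (power_space M (ob X)) (on_space F X) (e X) (d X)"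
    "\<And>X Y f. on_map F X Y f = e Y \<circ> power_map (mor Y f) (ob X) (ob Y) \<circ> d X"
proof (rule homotopy_functor_encode[where G = "\<lambda>X. power_space M (ob X)" and gm = "\<lambda>X Y f. power_map (mor Y f) (ob X) (ob Y)"])
  note sf' = set_functorD[OF sf]
  show "topspace (power_space M (ob X)) \<prec> (UNIV :: 'u set)" if "small_space X" for X
    by (rule lesspoll_universe_power_space[OF U sf'(1)[OF that]])
  show "power_map (mor Y f) (ob X) (ob Y) w = power_map (mor Y f') (ob X) (ob Y) w"
    if "continuous_map X Y f" "continuous_map X Y f'" "\<forall>x\<in>topspace X. f x = f' x" for X Y f f' w
    by (rule power_map_cong[OF sf'(3)[OF that]])
  show "power_map (mor X id) (ob X) (ob X) w = w" if "w \<in> topspace (power_space M (ob X))" for X w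
    by (rule power_map_id[OF that sf'(4)])
  show "power_map (mor Z (f' \<circ> f)) (ob X) (ob Z) w = power_map (mor Z f') (ob Y) (ob Z) (power_map (mor Y f) (ob X) (ob Y) w)"
    if "continuous_map X Y f" "continuous_map Y Z f'" for X Y Z f f' w
  proof -
    have "power_map (mor Z (f' \<circ> f)) (ob X) (ob Z) w = power_map (mor Z f' \<circ> mor Y f) (ob X) (ob Z) w"
      by (rule power_map_cong) (use sf'(5)[OF that] in simp)
    then show ?thesis using power_map_comp[OF sf'(2)[OF that(1)]] by metis
  qed
  show "weak_equivalence (power_space M (ob X)) (power_space M (ob Y)) (power_map (mor Y f) (ob X) (ob Y))"
    if "weak_equivalence X Y f" for X Y f
    by (rule weak_equivalence_power_map[OF sf'(6)[OF that]])
qed (auto intro: continuous_map_power_map)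

text \<open>\<open>cartesian_surj\<close> for the encoded functor, decoded again, so that the
  arguments on sets below never see \<open>F\<close>.\<close>

lemma power_cartesian_surj:
  assumes V: "V \<in> topspace (power_space M (ob B))" and W: "W \<in> topspace (power_space M (ob C))"
    and l: "cmap {0..1::real} (power_space M (ob D)) l"
      "l 0 = power_map (mor D h) (ob B) (ob D) V" "l 1 = power_map (mor D k) (ob C) (ob D) W"
  obtains a p q H where "a \<in> topspace (power_space M (ob A))"
    "cmap {0..1::real} (power_space M (ob B)) p" "p 0 = power_map (mor B f) (ob A) (ob B) a" "p 1 = V"
    "cmap {0..1::real} (power_space M (ob C)) q" "q 0 = power_map (mor C g) (ob A) (ob C) a" "q 1 = W"
    "cmap ({0..1::real} \<times> {0..1::real}) (power_space M (ob D)) H"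
    "\<And>s. s \<in> {0..1} \<Longrightarrow> H (s, 0) = power_map (mor D h) (ob B) (ob D) (power_map (mor B f) (ob A) (ob B) a)"
    "\<And>s. s \<in> {0..1} \<Longrightarrow> H (s, 1) = l s"
    "\<And>t. t \<in> {0..1} \<Longrightarrow> H (0, t) = power_map (mor D h) (ob B) (ob D) (p t)"
    "\<And>t. t \<in> {0..1} \<Longrightarrow> H (1, t) = power_map (mor D k) (ob C) (ob D) (q t)"
proof -
  let ?G = "\<lambda>X. power_space M (ob X)" and ?m = "\<lambda>X Y f. power_map (mor Y f) (ob X) (ob Y)"
  obtain F e d where F: "homotopy_functor (F :: 'u top_functor)"
    and ed: "\<And>X. small_space X \<Longrightarrow> homeomorphic_maps (?G X) (on_space F X) (e X) (d X)"
    and Fm: "\<And>X Y f. on_map F X Y f = e Y \<circ> ?m X Y f \<circ> d X"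
  proof (rule power_homotopy_functor[where M = M], goal_cases)
    case (1 F e d) show thesis by (rule 1(1)[OF 1(2-)])
  qed
  have ce: "continuous_map (?G X) (on_space F X) (e X)" and cd: "continuous_map (on_space F X) (?G X) (d X)"
    and de: "\<And>w. w \<in> topspace (?G X) \<Longrightarrow> d X (e X w) = w"
    and ed': "\<And>y. y \<in> topspace (on_space F X) \<Longrightarrow> e X (d X y) = y"
    if "small_space X" for X
    using ed[OF that] by (auto simp: homeomorphic_maps_def)
  have mG: "?m X Y u w \<in> topspace (?G Y)" if "w \<in> topspace (?G X)" for X Y u w
    using continuous_map_power_map[where M = M and S = "ob X" and S' = "ob Y" and u = "mor Y u"] that
    by (auto simp: continuous_map_def)
  have eF: "e X w \<in> topspace (on_space F X)" if "small_space X" "w \<in> topspace (?G X)" for X w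
    using ce[OF that(1)] that(2) by (auto simp: continuous_map_def)
  have dG: "d X w \<in> topspace (?G X)" if "small_space X" "w \<in> topspace (on_space F X)" for X w
    using cd[OF that(1)] that(2) by (auto simp: continuous_map_def)
  have sq: "is_small_cube 2 (square_cube A B C D f g h k)"
    using ac by (simp add: absolutely_cartesian_def)
  interpret square_diagram "map_cube F (square_cube A B C D f g h k)" "on_space F B" "on_space F C" "on_space F D"
     "on_map F A B f" "on_map F A C g" "on_map F B D h" "on_map F C D k"
    by (rule square_diagram_map_cube[OF _ sq]) (use F in \<open>simp add: homotopy_functor_def\<close>)
  have FA: "vertex (map_cube F (square_cube A B C D f g h k)) {} = on_space F A"
    by (simp add: map_cube_def square_cube_def)
  have cart: "cartesian 2 (map_cube F (square_cube A B C D f g h k))"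
    using ac F by (simp add: absolutely_cartesian_def)
  have l0: "e D (l 0) = on_map F B D h (e B V)" "e D (l 1) = on_map F C D k (e C W)"
    using V W small l by (simp_all add: Fm de)
  obtain a p q H where *: "a \<in> topspace (on_space F A)" "cmap {0..1::real} (on_space F B) p" "p 0 = on_map F A B f a" "p 1 = e B V"
    "cmap {0..1::real} (on_space F C) q" "q 0 = on_map F A C g a" "q 1 = e C W"
    "cmap ({0..1::real} \<times> {0..1::real}) (on_space F D) H"
    "\<And>s. s \<in> {0..1} \<Longrightarrow> H (s, 0) = on_map F B D h (on_map F A B f a)" "\<And>s. s \<in> {0..1} \<Longrightarrow> H (s, 1) = e D (l s)"
    "\<And>t. t \<in> {0..1} \<Longrightarrow> H (0, t) = on_map F B D h (p t)" "\<And>t. t \<in> {0..1} \<Longrightarrow> H (1, t) = on_map F C D k (q t)"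
  proof (rule cartesian_surj[OF cart eF[OF small(2) V] eF[OF small(3) W] cmap_post[OF l(1) ce[OF small(4)]] l0], goal_cases)
    case (1 a p q H) show thesis by (rule 1(1)[OF 1(2-)[unfolded FA]])
  qed
  note a = dG[OF small(1) *(1)]
  have lG: "l s \<in> topspace (?G D)" if "s \<in> {0..1}" for s using l(1) that by (rule cmap_in)
  have pF: "p t \<in> topspace (on_space F B)" if "t \<in> {0..1}" for t using *(2) that by (rule cmap_in)
  have qF: "q t \<in> topspace (on_space F C)" if "t \<in> {0..1}" for t using *(5) that by (rule cmap_in)
  show thesis
  proof (rule that[OF a cmap_post[OF *(2) cd[OF small(2)]] _ _ cmap_post[OF *(5) cd[OF small(3)]] _ _
        cmap_post[OF *(8) cd[OF small(4)]]])
    show "d B (p 0) = ?m A B f (d A a)" "d C (q 0) = ?m A C g (d A a)"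
      using a small by (simp_all add: * Fm de mG)
    show "d B (p 1) = V" "d C (q 1) = W" using V W small by (simp_all add: * de)
    show "d D (H (s, 0)) = ?m B D h (?m A B f (d A a))" if "s \<in> {0..1}" for s
      using a small by (simp add: *(9)[OF that] Fm de mG)
    show "d D (H (s, 1)) = l s" if "s \<in> {0..1}" for s
      using small lG[OF that] by (simp add: *(10)[OF that] de)
    show "d D (H (0, t)) = ?m B D h (d B (p t))" if "t \<in> {0..1}" for t
      using small dG[OF small(2) pF[OF that]] by (simp add: *(11)[OF that] Fm de mG)
    show "d D (H (1, t)) = ?m C D k (d C (q t))" if "t \<in> {0..1}" for t
      using small dG[OF small(3) qF[OF that]] by (simp add: *(12)[OF that] Fm de mG)
  qed
qed

lemma power_cartesian_inj:
  assumes a: "a \<in> topspace (power_space M (ob A))" "a' \<in> topspace (power_space M (ob A))"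
    and eq: "power_map (mor B f) (ob A) (ob B) a = power_map (mor B f) (ob A) (ob B) a'"
      "power_map (mor C g) (ob A) (ob C) a = power_map (mor C g) (ob A) (ob C) a'"
  shows "path_component_of (power_space M (ob A)) a a'"
proof -
  let ?G = "\<lambda>X. power_space M (ob X)" and ?m = "\<lambda>X Y f. power_map (mor Y f) (ob X) (ob Y)"
  obtain F e d where F: "homotopy_functor (F :: 'u top_functor)"
    and ed: "\<And>X. small_space X \<Longrightarrow> homeomorphic_maps (?G X) (on_space F X) (e X) (d X)"
    and Fm: "\<And>X Y f. on_map F X Y f = e Y \<circ> ?m X Y f \<circ> d X"
  proof (rule power_homotopy_functor[where M = M], goal_cases)
    case (1 F e d) show thesis by (rule 1(1)[OF 1(2-)])
  qed
  have ce: "continuous_map (?G A) (on_space F A) (e A)" and cd: "continuous_map (on_space F A) (?G A) (d A)"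
    and de: "\<And>w. w \<in> topspace (?G A) \<Longrightarrow> d A (e A w) = w"
    using ed[OF small(1)] by (auto simp: homeomorphic_maps_def)
  have sq: "is_small_cube 2 (square_cube A B C D f g h k)"
    using ac by (simp add: absolutely_cartesian_def)
  interpret square_diagram "map_cube F (square_cube A B C D f g h k)" "on_space F B" "on_space F C" "on_space F D"
     "on_map F A B f" "on_map F A C g" "on_map F B D h" "on_map F C D k"
    by (rule square_diagram_map_cube[OF _ sq]) (use F in \<open>simp add: homotopy_functor_def\<close>)
  have FA: "vertex (map_cube F (square_cube A B C D f g h k)) {} = on_space F A"
    by (simp add: map_cube_def square_cube_def)
  have cart: "cartesian 2 (map_cube F (square_cube A B C D f g h k))"
    using ac F by (simp add: absolutely_cartesian_def)
  have "path_component_of (on_space F A) (e A a) (e A a')"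
    using cartesian_inj[OF cart, of "e A a" "e A a'"] a ce eq unfolding FA
    by (auto simp: Fm de continuous_map_def)
  from path_component_of_map[OF cd this] show ?thesis using a de by simp
qed

end

section \<open>The square of sets obtained from an absolutely cartesian square\<close>

text \<open>Each coordinate of the path has a connected finite image. Hence, for signs, the path
  components of the homotopy pullback are the points of the strict pullback.\<close>

lemma sign_path_constant:
  assumes "cmap {0..1::real} (power_space {1, -1} S) p"
  shows "p 0 = p 1"
proof (rule PiE_ext)
  show "p 0 \<in> Pow S \<rightarrow>\<^sub>E {1, -1}" "p 1 \<in> Pow S \<rightarrow>\<^sub>E {1, -1}"
    using cmap_in[OF assms, of 0] cmap_in[OF assms, of 1] by (simp_all add: topspace_power_space)
  fix T assume "T \<in> Pow S"
  then have "continuous_map (power_space {1, -1} S) (top_of_set {1, -1}) (\<lambda>w. w T)"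
    unfolding power_space_def by (rule continuous_map_product_projection)
  then have "cmap {0..1::real} (top_of_set {1, -1::complex}) (\<lambda>t. p t T)" by (rule cmap_post[OF assms])
  then have c: "continuous_on {0..1::real} (\<lambda>t. p t T)" and im: "(\<lambda>t. p t T) ` {0..1} \<subseteq> {1, -1}" by auto
  have "connected ((\<lambda>t. p t T) ` {0..1})" by (rule connected_continuous_image[OF c]) simp
  moreover have "finite ((\<lambda>t. p t T) ` {0..1})" by (rule finite_subset[OF im]) simp
  ultimately obtain y where "(\<lambda>t. p t T) ` {0..1} = {y}" by (auto simp: connected_finite_iff_sing)
  moreover have "p 0 T \<in> (\<lambda>t. p t T) ` {0..1}" "p 1 T \<in> (\<lambda>t. p t T) ` {0..1}" by auto
  ultimately show "p 0 T = p 1 T" by simp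
qed

text \<open>Preimages are unions of fibres, and \<open>x\<close> is not alone in its fibre.\<close>

lemma pre_neq_singleton:
  assumes "x \<in> S" "y \<in> S" "x \<noteq> y" "u x = u y" shows "pre u S T \<noteq> {x}"
proof
  assume eq: "pre u S T = {x}"
  then have "x \<in> pre u S T" by simp
  then have "y \<in> pre u S T" using assms by (simp add: pre_def)
  then show False using eq assms by simp
qed

context absolute_square_functor
begin

abbreviation (input) "\<A> \<equiv> ob A"
abbreviation (input) "\<B> \<equiv> ob B"
abbreviation (input) "\<C> \<equiv> ob C"
abbreviation (input) "\<D> \<equiv> ob D"
abbreviation (input) "f' \<equiv> mor B f"
abbreviation (input) "g' \<equiv> mor C g"
abbreviation (input) "h' \<equiv> mor D h"
abbreviation (input) "k' \<equiv> mor D k"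

lemma mor_in: "a \<in> \<A> \<Longrightarrow> f' a \<in> \<B>" "a \<in> \<A> \<Longrightarrow> g' a \<in> \<C>" "b \<in> \<B> \<Longrightarrow> h' b \<in> \<D>" "c \<in> \<C> \<Longrightarrow> k' c \<in> \<D>"
  using set_functorD(2)[OF sf cont(1)] set_functorD(2)[OF sf cont(2)]
    set_functorD(2)[OF sf cont(3)] set_functorD(2)[OF sf cont(4)] by blast+

lemma mor_commutes: "a \<in> \<A> \<Longrightarrow> h' (f' a) = k' (g' a)"
proof -
  assume a: "a \<in> \<A>"
  have "h' (f' a) = mor D (h \<circ> f) a"
    by (rule set_functorD(5)[OF sf cont(1,3) a, symmetric])
  also have "\<dots> = mor D (k \<circ> g) a"
    by (rule set_functorD(3)[OF sf continuous_map_compose[OF cont(1,3)] continuous_map_compose[OF cont(2,4)] _ a])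
      (simp add: comm)
  also have "\<dots> = k' (g' a)"
    by (rule set_functorD(5)[OF sf cont(2,4) a])
  finally show ?thesis .
qed

text \<open>The existence half of the pullback property for signs. A sign function on a power set is
  a set of subsets, with - 1 marking membership. The compatible pair is joined by a constant path,
  and since \<open>p\<close> and \<open>q\<close> are constant as well, the element found over
  \<open>ob A\<close> restricts to the pair exactly.\<close>

lemma sets_of_sets_pullback_exists:
  assumes VU: "\<And>T. T \<subseteq> \<D> \<Longrightarrow> pre h' \<B> T \<in> V \<longleftrightarrow> pre k' \<C> T \<in> U"
  obtains W where "\<And>T. T \<subseteq> \<B> \<Longrightarrow> pre f' \<A> T \<in> W \<longleftrightarrow> T \<in> V" "\<And>T. T \<subseteq> \<C> \<Longrightarrow> pre g' \<A> T \<in> W \<longleftrightarrow> T \<in> U"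
proof -
  define v where "v = (\<lambda>T\<in>Pow \<B>. if T \<in> V then - 1 else 1 :: complex)"
  define u where "u = (\<lambda>T\<in>Pow \<C>. if T \<in> U then - 1 else 1 :: complex)"
  have v: "v \<in> topspace (power_space {1, -1} \<B>)" and u: "u \<in> topspace (power_space {1, -1} \<C>)"
    by (auto simp: topspace_power_space v_def u_def)
  have vu: "power_map h' \<B> \<D> v = power_map k' \<C> \<D> u"
    unfolding power_map_def v_def u_def using pre_in_Pow[of h' \<B>] pre_in_Pow[of k' \<C>]
    by (intro restrict_ext) (simp add: VU del: Pow_iff, simp add: VU)
  have "power_map h' \<B> \<D> v \<in> topspace (power_space {1, -1} \<D>)"
    using continuous_map_power_map[where M = "{1, -1}" and S = "\<B>" and S' = "\<D>" and u = h'] v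
    by (auto simp: continuous_map_def)
  then have l: "cmap {0..1::real} (power_space {1, -1} \<D>) (\<lambda>_. power_map h' \<B> \<D> v)" by simp
  obtain a p q where a: "cmap {0..1::real} (power_space {1, -1} \<B>) p" "p 0 = power_map f' \<A> \<B> a" "p 1 = v"
    "cmap {0..1::real} (power_space {1, -1} \<C>) q" "q 0 = power_map g' \<A> \<C> a" "q 1 = u"
  proof (rule power_cartesian_surj[OF v u l refl vu], goal_cases)
    case (1 a p q H) show thesis by (rule 1(1)[OF 1(3-8)])
  qed
  have "power_map f' \<A> \<B> a = v" "power_map g' \<A> \<C> a = u"
    using sign_path_constant[OF a(1)] sign_path_constant[OF a(4)] a by simp_all
  then have av: "a (pre f' \<A> T) = v T" and au: "S \<subseteq> \<C> \<Longrightarrow> a (pre g' \<A> S) = u S" if "T \<subseteq> \<B>" for T S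
    using that by (auto simp: power_map_def fun_eq_iff split: if_splits)
  show thesis
  proof (rule that[of "{T. a T = - 1}"])
    show "pre f' \<A> T \<in> {T. a T = - 1} \<longleftrightarrow> T \<in> V" if "T \<subseteq> \<B>" for T
      using av[OF that] that by (simp add: v_def)
    show "pre g' \<A> T \<in> {T. a T = - 1} \<longleftrightarrow> T \<in> U" if "T \<subseteq> \<C>" for T
      using au[OF empty_subsetI that] that by (simp add: u_def)
  qed
qed

text \<open>The uniqueness half: sign functions with the same two images lie in one path component,
  which is a single point.\<close>

lemma sets_of_sets_pullback_unique:
  assumes f: "\<And>T. T \<subseteq> \<B> \<Longrightarrow> pre f' \<A> T \<in> W \<longleftrightarrow> pre f' \<A> T \<in> W'"
    and g: "\<And>T. T \<subseteq> \<C> \<Longrightarrow> pre g' \<A> T \<in> W \<longleftrightarrow> pre g' \<A> T \<in> W'" and Z: "Z \<subseteq> \<A>"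
  shows "Z \<in> W \<longleftrightarrow> Z \<in> W'"
proof -
  define w where "w W = (\<lambda>T\<in>Pow \<A>. if T \<in> W then - 1 else 1 :: complex)" for W
  have w: "w W \<in> topspace (power_space {1, -1} \<A>)" for W
    by (auto simp: topspace_power_space w_def)
  have "power_map f' \<A> \<B> (w W) = power_map f' \<A> \<B> (w W')"
    unfolding power_map_def w_def using pre_in_Pow[of f' \<A>]
    by (intro restrict_ext) (simp add: f del: Pow_iff, simp add: f)
  moreover have "power_map g' \<A> \<C> (w W) = power_map g' \<A> \<C> (w W')"
    unfolding power_map_def w_def using pre_in_Pow[of g' \<A>]
    by (intro restrict_ext) (simp add: g del: Pow_iff, simp add: g)
  ultimately have "path_component_of (power_space {1, -1} \<A>) (w W) (w W')"
    by (rule power_cartesian_inj[OF w w])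
  then obtain p where "cmap {0..1::real} (power_space {1, -1} \<A>) p" "p 0 = w W" "p 1 = w W'"
    unfolding path_component_of_def pathin_def by blast
  then have "w W = w W'" using sign_path_constant by metis
  then have "w W Z = w W' Z" by simp
  then show ?thesis using Z by (simp add: w_def split: if_splits)
qed

text \<open>As \<open>{b1}\<close> is no preimage under \<open>h'\<close>, the existence half gives
  a set that contains \<open>?Z1\<close> but no preimage under \<open>g'\<close>; so
  \<open>?Z1\<close> is none, and likewise \<open>?Z2\<close> is no preimage under
  \<open>f'\<close>. If the symmetric difference \<open>?Z\<close> were a preimage under
  \<open>f'\<close>, so would be \<open>?Z2\<close>, and dually for \<open>g'\<close>. Thus
  \<open>{?Z}\<close> and \<open>{}\<close> cannot be told apart along \<open>f'\<close> and
  \<open>g'\<close>, against uniqueness.\<close>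

lemma not_both_non_injective: "inj_on h' \<B> \<or> inj_on k' \<C>"
proof (rule ccontr)
  assume "\<not> ?thesis"
  then obtain b1 b2 c1 c2 where b: "b1 \<in> \<B>" "b2 \<in> \<B>" "b1 \<noteq> b2" "h' b1 = h' b2"
    and c: "c1 \<in> \<C>" "c2 \<in> \<C>" "c1 \<noteq> c2" "k' c1 = k' c2" by (auto simp: inj_on_def)
  have hb: "pre h' \<B> T \<noteq> {b1}" for T using b by (rule pre_neq_singleton)
  have kc: "pre k' \<C> T \<noteq> {c1}" for T using c by (rule pre_neq_singleton)
  let ?Z1 = "pre f' \<A> {b1}" and ?Z2 = "pre g' \<A> {c1}"
  obtain W1 where W1: "\<And>T. T \<subseteq> \<B> \<Longrightarrow> pre f' \<A> T \<in> W1 \<longleftrightarrow> T \<in> {{b1}}" "\<And>T. T \<subseteq> \<C> \<Longrightarrow> pre g' \<A> T \<in> W1 \<longleftrightarrow> T \<in> {}"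
    using sets_of_sets_pullback_exists[of "{{b1}}" "{}"] hb by auto
  obtain W2 where W2: "\<And>T. T \<subseteq> \<B> \<Longrightarrow> pre f' \<A> T \<in> W2 \<longleftrightarrow> T \<in> {}" "\<And>T. T \<subseteq> \<C> \<Longrightarrow> pre g' \<A> T \<in> W2 \<longleftrightarrow> T \<in> {{c1}}"
    using sets_of_sets_pullback_exists[of "{}" "{{c1}}"] kc by auto
  have Z1: "?Z1 \<noteq> pre g' \<A> T" if "T \<subseteq> \<C>" for T
    using W1(1)[of "{b1}"] W1(2)[OF that] b by auto
  have Z2: "?Z2 \<noteq> pre f' \<A> T" if "T \<subseteq> \<B>" for T
    using W2(2)[of "{c1}"] W2(1)[OF that] c by auto
  let ?Z = "(?Z1 - ?Z2) \<union> (?Z2 - ?Z1)"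
  have fZ: "pre f' \<A> T \<noteq> ?Z" if "T \<subseteq> \<B>" for T
  proof
    assume eq: "pre f' \<A> T = ?Z"
    have "?Z2 = (?Z1 - pre f' \<A> T) \<union> (pre f' \<A> T - ?Z1)" unfolding eq by auto
    also have "\<dots> = pre f' \<A> (({b1} - T) \<union> (T - {b1}))" by (auto simp: pre_def)
    finally show False using Z2[of "({b1} - T) \<union> (T - {b1})"] that b by auto
  qed
  have gZ: "pre g' \<A> T \<noteq> ?Z" if "T \<subseteq> \<C>" for T
  proof
    assume eq: "pre g' \<A> T = ?Z"
    have "?Z1 = (?Z2 - pre g' \<A> T) \<union> (pre g' \<A> T - ?Z2)" unfolding eq by auto
    also have "\<dots> = pre g' \<A> (({c1} - T) \<union> (T - {c1}))" by (auto simp: pre_def)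
    finally show False using Z1[of "({c1} - T) \<union> (T - {c1})"] that c by auto
  qed
  have "?Z \<in> {?Z} \<longleftrightarrow> ?Z \<in> {}"
  proof (rule sets_of_sets_pullback_unique)
    show "pre f' \<A> T \<in> {?Z} \<longleftrightarrow> pre f' \<A> T \<in> {}" if "T \<subseteq> \<B>" for T using fZ[OF that] by blast
    show "pre g' \<A> T \<in> {?Z} \<longleftrightarrow> pre g' \<A> T \<in> {}" if "T \<subseteq> \<C>" for T using gZ[OF that] by blast
    show "?Z \<subseteq> \<A>" unfolding pre_def by blast
  qed
  then show False by blast
qed

text \<open>An element over \<open>c1\<close> would be sent by \<open>f'\<close> to a preimage of
  \<open>d\<close>, so \<open>{c1}\<close> has the same empty preimage in \<open>ob A\<close> as the
  empty subset of \<open>ob B\<close>. But \<open>{c1}\<close> is no preimage under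
  \<open>k'\<close> if \<open>c1\<close> shares its fibre, so the existence half separates the
  two.\<close>

lemma unique_preimage_right:
  assumes d: "d \<notin> h' ` \<B>" and c: "c1 \<in> \<C>" "c2 \<in> \<C>" "k' c1 = d" "k' c2 = d"
  shows "c1 = c2"
proof (rule ccontr)
  assume ne: "c1 \<noteq> c2"
  have kc: "pre k' \<C> T \<noteq> {c1}" for T by (rule pre_neq_singleton[OF c(1,2) ne]) (simp add: c)
  obtain W where W: "\<And>T. T \<subseteq> \<B> \<Longrightarrow> pre f' \<A> T \<in> W \<longleftrightarrow> T \<in> {}" "\<And>T. T \<subseteq> \<C> \<Longrightarrow> pre g' \<A> T \<in> W \<longleftrightarrow> T \<in> {{c1}}"
    using sets_of_sets_pullback_exists[of "{}" "{{c1}}"] kc by auto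
  have "pre g' \<A> {c1} = pre f' \<A> {}"
    using d c mor_commutes mor_in by (force simp: pre_def)
  then show False using W(1)[of "{}"] W(2)[of "{c1}"] c by simp
qed

lemma unique_preimage_left:
  assumes d: "d \<notin> k' ` \<C>" and b: "b1 \<in> \<B>" "b2 \<in> \<B>" "h' b1 = d" "h' b2 = d"
  shows "b1 = b2"
proof (rule ccontr)
  assume ne: "b1 \<noteq> b2"
  have hb: "pre h' \<B> T \<noteq> {b1}" for T by (rule pre_neq_singleton[OF b(1,2) ne]) (simp add: b)
  obtain W where W: "\<And>T. T \<subseteq> \<B> \<Longrightarrow> pre f' \<A> T \<in> W \<longleftrightarrow> T \<in> {{b1}}" "\<And>T. T \<subseteq> \<C> \<Longrightarrow> pre g' \<A> T \<in> W \<longleftrightarrow> T \<in> {}"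
    using sets_of_sets_pullback_exists[of "{{b1}}" "{}"] hb by auto
  have "pre f' \<A> {b1} = pre g' \<A> {}"
    using d b mor_commutes mor_in by (force simp: pre_def)
  then show False using W(1)[of "{b1}"] W(2)[of "{}"] b by simp
qed

text \<open>A loop \<open>l\<close> at the constant function 1 is a point of the homotopy pullback
  for the circle. If it is joined to a point from \<open>A\<close>, the loop deforms into paths
  coming from B and C, and these cannot make the coordinate \<open>{d}\<close> wind relative to the
  coordinate \<open>{}\<close>.\<close>

lemma jointly_surjective:
  assumes d: "d \<in> \<D>" shows "d \<in> h' ` \<B> \<or> d \<in> k' ` \<C>"
proof (rule ccontr)
  assume not: "\<not> ?thesis"
  let ?M = "sphere (0::complex) 1" and ?I = "{0..1::real}"
  define one where "one S = (\<lambda>T\<in>Pow S. 1 :: complex)" for S :: "'v set"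
  define l where "l s = (\<lambda>T\<in>Pow \<D>. if d \<in> T then exp (2 * of_real pi * \<i> * of_real s) else 1)" for s :: real
  have one: "one S \<in> topspace (power_space ?M S)" for S
    by (auto simp: topspace_power_space one_def)
  have norm1: "norm (exp (2 * of_real pi * \<i> * of_real s)) = 1" for s :: real
    using norm_exp_i_times[of "2 * pi * s"] by (simp add: mult_ac)
  have l: "cmap ?I (power_space ?M \<D>) l"
    unfolding power_space_def continuous_map_componentwise
  proof (intro conjI ballI)
    fix T assume T: "T \<in> Pow \<D>"
    have "continuous_on ?I (\<lambda>s. if d \<in> T then exp (2 * of_real pi * \<i> * of_real s) else 1 :: complex)"
      by (cases "d \<in> T") (auto intro!: continuous_intros)
    then show "cmap ?I (top_of_set ?M) (\<lambda>s. l s T)"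
      using T norm1 by (auto simp: l_def)
  qed (auto simp: l_def)
  have pm: "power_map u S \<D> (one S) = one \<D>" for u S
    unfolding power_map_def one_def by (rule restrict_ext) (simp add: pre_def)
  have l0: "l 0 = power_map h' \<B> \<D> (one \<B>)" and l1: "l 1 = power_map k' \<C> \<D> (one \<C>)"
    unfolding pm by (auto simp: l_def one_def)
  obtain a p q H where H: "cmap (?I \<times> ?I) (power_space ?M \<D>) H"
    "\<And>s. s \<in> ?I \<Longrightarrow> H (s, 0) = power_map h' \<B> \<D> (power_map f' \<A> \<B> a)" "\<And>s. s \<in> ?I \<Longrightarrow> H (s, 1) = l s"
    "\<And>t. t \<in> ?I \<Longrightarrow> H (0, t) = power_map h' \<B> \<D> (p t)" "\<And>t. t \<in> ?I \<Longrightarrow> H (1, t) = power_map k' \<C> \<D> (q t)"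
  proof (rule power_cartesian_surj[OF one one l l0 l1], goal_cases)
    case (1 a p q H) show thesis by (rule 1(1)[OF 1(9-13)])
  qed
  have HM: "H z T \<in> ?M" if "z \<in> ?I \<times> ?I" "T \<subseteq> \<D>" for z T
    using cmap_in[OF H(1) that(1)] that(2) by (auto simp: topspace_power_space)
  have Hc: "continuous_on (?I \<times> ?I) (\<lambda>z. H z T)" if "T \<subseteq> \<D>" for T
  proof -
    have "continuous_map (power_space ?M \<D>) (top_of_set ?M) (\<lambda>w. w T)"
      unfolding power_space_def by (rule continuous_map_product_projection) (use that in simp)
    from cmap_post[OF H(1) this] show ?thesis by simp
  qed
  \<comment> \<open>The \<open>d\<close>-coordinate relative to the \<open>{}\<close>-coordinate: it is \<open>1\<close> on everything that comes from
    \<open>\<B>\<close> or \<open>\<C>\<close>, since \<open>d\<close> has no preimages, but winds once around the circle along \<open>l\<close>.\<close>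
  define r where "r z = H z {d} / H z {}" for z
  have nz: "H z {} \<noteq> 0" "H z {d} \<noteq> 0" if "z \<in> ?I \<times> ?I" for z
    using HM[OF that, of "{}"] HM[OF that, of "{d}"] d by auto
  have rc: "continuous_on (?I \<times> ?I) r"
    unfolding r_def using d nz by (intro continuous_on_divide Hc) auto
  have pre_d: "pre h' \<B> {d} = pre h' \<B> {}" "pre k' \<C> {d} = pre k' \<C> {}"
    using not by (auto simp: pre_def)
  have pm_d: "power_map h' \<B> \<D> w {d} = power_map h' \<B> \<D> w {}" "power_map k' \<C> \<D> w {d} = power_map k' \<C> \<D> w {}" for w
    using d by (simp_all add: power_map_def pre_d)
  have r1: "r (s, 0) = 1" "r (0, s) = 1" "r (1, s) = 1" if "s \<in> ?I" for s
    using that nz(1)[of "(s, 0)"] nz(1)[of "(0, s)"] nz(1)[of "(1, s)"] pm_d H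
    by (simp_all add: r_def)
  have rl: "r (s, 1) = exp (2 * of_real pi * \<i> * of_real s)" if "s \<in> ?I" for s
    using that d H(3)[OF that] by (simp add: r_def l_def)
  \<comment> \<open>The side t = 1 of the square \<open>r\<close> is the circle and the other three
    sides are constantly 1. Read from t = 1 down to t = 0 it is therefore a homotopy of paths with
    fixed ends.\<close>
  have "homotopic_paths (- {0}) (circlepath 0 1) (\<lambda>_. 1)"
    unfolding homotopic_paths
  proof (intro exI[of _ "\<lambda>z. r (snd z, 1 - fst z)"] conjI ballI)
    show "continuous_on (?I \<times> ?I) (\<lambda>z. r (snd z, 1 - fst z))"
      by (rule continuous_on_compose2[OF rc]) (auto intro!: prod_continuous_intros)
    show "(\<lambda>z. r (snd z, 1 - fst z)) \<in> ?I \<times> ?I \<rightarrow> - {0}"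
      using nz by (auto simp: r_def)
  qed (auto simp: circlepath rl r1 pathstart_def pathfinish_def)
  then have "winding_number (circlepath 0 1) 0 = winding_number (\<lambda>_. 1) 0"
    by (rule winding_number_homotopic_paths)
  then show False
    using winding_number_circlepath_centre[of 1 0] winding_number_zero_const[of 1 0] by simp
qed

end

section \<open>From set-valued functors back to weak equivalences\<close>

context absolute_square
begin

text \<open>In the product a pair is missed as soon as one component is, so two missed elements
  combine at once. If one map misses \<open>d\<close> and the other hits a point twice,
  \<open>jointly_surjective\<close> for a single factor supplies a preimage of \<open>d\<close>
  under the other map, and with it the double hit becomes one over a missed pair.\<close>

lemma bij_betw_or_bij_betw:
  fixes mor :: "'u topology \<Rightarrow> ('u \<Rightarrow> 'u) \<Rightarrow> 'v \<Rightarrow> 'v" and mor' :: "'u topology \<Rightarrow> ('u \<Rightarrow> 'u) \<Rightarrow> 'w \<Rightarrow> 'w"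
  assumes F: "set_functor ob mor" and F': "set_functor ob' mor'"
  shows "bij_betw (mor D h) (ob B) (ob D) \<or> bij_betw (mor' D k) (ob' C) (ob' D)"
proof (rule ccontr)
  assume not: "\<not> ?thesis"
  interpret S: absolute_square_functor A B C D f g h k ob mor by unfold_locales (rule F)
  interpret S': absolute_square_functor A B C D f g h k ob' mor' by unfold_locales (rule F')
  interpret P: absolute_square_functor A B C D f g h k "\<lambda>X. ob X \<times> ob' X" "\<lambda>Y f. map_prod (mor Y f) (mor' Y f)"
    by unfold_locales (rule set_functor_prod[OF U F F'])
  have h: "inj_on (mor D h) (ob B) \<Longrightarrow> \<exists>d\<in>ob D. d \<notin> mor D h ` ob B"
    using not S.mor_in(3) by (auto simp: bij_betw_def)
  have k: "inj_on (mor' D k) (ob' C) \<Longrightarrow> \<exists>d\<in>ob' D. d \<notin> mor' D k ` ob' C"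
    using not S'.mor_in(4) by (auto simp: bij_betw_def)
  show False
  proof (cases "inj_on (mor D h) (ob B)")
    case True
    then obtain d where d: "d \<in> ob D" "d \<notin> mor D h ` ob B" using h by blast
    then obtain c where c: "c \<in> ob C" "d = mor D k c" using S.jointly_surjective by blast
    show False
    proof (cases "inj_on (mor' D k) (ob' C)")
      case True
      then obtain d' where "d' \<in> ob' D" "d' \<notin> mor' D k ` ob' C" using k by blast
      then show False using P.jointly_surjective[of "(d, d')"] d by auto
    next
      case False
      then obtain c1 c2 where "c1 \<in> ob' C" "c2 \<in> ob' C" "c1 \<noteq> c2" "mor' D k c1 = mor' D k c2"
        by (auto simp: inj_on_def)
      then show False
        using P.unique_preimage_right[of "(d, mor' D k c1)" "(c, c1)" "(c, c2)"] d c by auto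
    qed
  next
    case False
    then obtain b1 b2 where b: "b1 \<in> ob B" "b2 \<in> ob B" "b1 \<noteq> b2" "mor D h b1 = mor D h b2"
      by (auto simp: inj_on_def)
    show False
    proof (cases "inj_on (mor' D k) (ob' C)")
      case True
      then obtain d where d: "d \<in> ob' D" "d \<notin> mor' D k ` ob' C" using k by blast
      then obtain b where "b \<in> ob' B" "d = mor' D h b" using S'.jointly_surjective by blast
      then show False
        using P.unique_preimage_left[of "(mor D h b1, d)" "(b1, b)" "(b2, b)"] d b by auto
    next
      case False
      then obtain c1 c2 where c: "c1 \<in> ob' C" "c2 \<in> ob' C" "c1 \<noteq> c2" "mor' D k c1 = mor' D k c2"
        by (auto simp: inj_on_def)
      \<comment> \<open>To compare the two pairs in the product, both need a partner in the other factor.\<close>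
      have "mor D h b1 \<in> mor D k ` ob C"
        using S.unique_preimage_left[of "mor D h b1" b1 b2] b by metis
      then obtain c where c': "c \<in> ob C" by blast
      have "mor' D k c1 \<in> mor' D h ` ob' B"
        using S'.unique_preimage_right[of "mor' D k c1" c1 c2] c by metis
      then obtain b where b': "b \<in> ob' B" by blast
      have "\<not> inj_on (map_prod (mor D h) (mor' D h)) (ob B \<times> ob' B)"
      proof
        assume "inj_on (map_prod (mor D h) (mor' D h)) (ob B \<times> ob' B)"
        from inj_onD[OF this, of "(b1, b)" "(b2, b)"] show False using b b' by simp
      qed
      moreover have "\<not> inj_on (map_prod (mor D k) (mor' D k)) (ob C \<times> ob' C)"
      proof
        assume "inj_on (map_prod (mor D k) (mor' D k)) (ob C \<times> ob' C)"
        from inj_onD[OF this, of "(c, c1)" "(c, c2)"] show False using c c' by simp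
      qed
      ultimately show False using P.not_both_non_injective by blast
    qed
  qed
qed

lemma weak_equivalences:
  "weak_equivalence A B f \<and> weak_equivalence C D k \<or> weak_equivalence A C g \<and> weak_equivalence B D h"
proof -
  have hk: "weak_equivalence B D h \<or> weak_equivalence C D k"
  proof (rule ccontr)
    assume not: "\<not> ?thesis"
    obtain n and I :: "((nat \<Rightarrow> real) \<Rightarrow> 'u) set set" where
      I: "I \<prec> (UNIV :: 'u set)" "\<not> bij_betw (bouquet_classes_map n I D h) (bouquet_classes n I B) (bouquet_classes n I D)"
      using weak_equivalence_if_bouquets[OF U cont(3) small(4)] not by blast
    obtain n' and I' :: "((nat \<Rightarrow> real) \<Rightarrow> 'u) set set" where
      I': "I' \<prec> (UNIV :: 'u set)" "\<not> bij_betw (bouquet_classes_map n' I' D k) (bouquet_classes n' I' C) (bouquet_classes n' I' D)"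
      using weak_equivalence_if_bouquets[OF U cont(4) small(4)] not by blast
    show False
      using bij_betw_or_bij_betw[OF set_functor_bouquet[OF U I(1)] set_functor_bouquet[OF U I'(1)]] I(2) I'(2)
      by blast
  qed
  \<comment> \<open>The identity functor shows that the square itself is cartesian. Then a weak
    equivalence \<open>k\<close> forces the opposite map \<open>f\<close> to be one, and likewise
    \<open>h\<close> forces \<open>g\<close>.\<close>
  let ?I = "id_functor :: 'u top_functor"
  have sq: "is_small_cube 2 (square_cube A B C D f g h k)"
    using ac by (simp add: absolutely_cartesian_def)
  interpret square_diagram "map_cube ?I (square_cube A B C D f g h k)" B C D f g h k
    using square_diagram_map_cube[OF _ sq, of ?I] homotopy_functor_id[where 'u = 'u]
    by (simp add: homotopy_functor_def id_functor_def)
  have IA: "vertex (map_cube ?I (square_cube A B C D f g h k)) {} = A"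
    by (simp add: map_cube_def square_cube_def id_functor_def)
  have cart: "cartesian 2 (map_cube ?I (square_cube A B C D f g h k))"
    using ac homotopy_functor_id[where 'u = 'u] by (simp add: absolutely_cartesian_def)
  show ?thesis
    using hk cart cartesian_iff_weak_equivalence1 cartesian_iff_weak_equivalence2 unfolding IA by blast
qed

end

theorem theorem1p1:
  fixes A B C D :: "'u topology"
    and f g h k :: "'u \<Rightarrow> 'u"
  assumes "universe TYPE('u)"
    and "small_space A" "small_space B" "small_space C" "small_space D"
    and "continuous_map A B f" "continuous_map A C g"
    and "continuous_map B D h" "continuous_map C D k"
    and "\<forall>a\<in>topspace A. h (f a) = k (g a)"
  shows "(absolutely_cartesian 2 (square_cube A B C D f g h k) \<longleftrightarrow>
            absolutely_cartesian 1 (arrow_cube A B f) \<and> absolutely_cartesian 1 (arrow_cube C D k) \<or>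
            absolutely_cartesian 1 (arrow_cube A C g) \<and> absolutely_cartesian 1 (arrow_cube B D h)) \<and>
         (absolutely_cartesian 2 (square_cube A B C D f g h k) \<longleftrightarrow>
            weak_equivalence A B f \<and> weak_equivalence C D k \<or>
            weak_equivalence A C g \<and> weak_equivalence B D h)"
proof -
  have iff: "absolutely_cartesian 2 (square_cube A B C D f g h k) \<longleftrightarrow>
      weak_equivalence A B f \<and> weak_equivalence C D k \<or> weak_equivalence A C g \<and> weak_equivalence B D h"
  proof
    assume "absolutely_cartesian 2 (square_cube A B C D f g h k)"
    then interpret absolute_square A B C D f g h k
      using assms by unfold_locales auto
    show "weak_equivalence A B f \<and> weak_equivalence C D k \<or> weak_equivalence A C g \<and> weak_equivalence B D h"
      by (rule weak_equivalences)
  next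
    assume "weak_equivalence A B f \<and> weak_equivalence C D k \<or> weak_equivalence A C g \<and> weak_equivalence B D h"
    then show "absolutely_cartesian 2 (square_cube A B C D f g h k)"
      using assms by (intro absolutely_cartesian_square is_small_cube_square) auto
  qed
  show ?thesis
    unfolding iff absolutely_cartesian_arrow_iff[OF assms(2,3,6)] absolutely_cartesian_arrow_iff[OF assms(4,5,9)]
      absolutely_cartesian_arrow_iff[OF assms(2,4,7)] absolutely_cartesian_arrow_iff[OF assms(3,5,8)]
    by simp
qed

end
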